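(* Let $n=1$, and suppose that $f$ is a function in $L^1(\gamma)$ on $\mathbb{R}$. Then $f$ is in $H^1(\gamma)$ if and only if $\mathcal{M}_{\mathrm{loc}}f\in L^1(\gamma)$ and $E(f)<\infty$. Moreover, the norms $\|f\|_{H^1(\gamma)}$ and $\|\mathcal{M}_{\mathrm{loc}}f\|_{L^1(\gamma)}+E(f)$ are equivalent.
   Context: $\gamma$ is the Gauss measure on $\mathbb{R}^n$, with density $\gamma_0(x)=\pi^{-n/2}e^{-|x|^2}$ with respect to Lebesgue measure $\lambda$ (here $n=1$). A closed ball $B$ with radius $r_B$ and centre $c_B$ is called admissible if $r_B\le\min(1,1/|c_B|)$ (where $\min(1,1/|x|)=1$ for $x=0$). A Gaussian atom is either the constant function $1$ or a function $a\in L^\infty(\gamma)$ supported in an admissible ball $B$ with $\int a\,d\gamma=0$ and $\|a\|_\infty\le\gamma(B)^{-1}$. $H^1(\gamma)$ is the space of all $f\in L^1(\gamma)$ that admit a decomposition $f=\sum_j\lambda_j a_j$ with $a_j$ Gaussian atoms and $(\lambda_j)$ a summable sequence of complex numbers; $\|f\|_{H^1(\gamma)}$ is the infimum of $\sum_j|\lambda_j|$ over all such representations. Let $\Phi=\{\phi\in C_c^1(B(0,1)):\ |D^\alpha\phi|\le1\ \text{for}\ |\alpha|=0,1\}$ and $\phi_t(x)=t^{-n}\phi(x/t)$. The local grand maximal function is $$\mathcal{M}_{\mathrm{loc}}f(x)=\sup\{|\phi_t*f(x)|:\ \phi\in\Phi,\ 0<t<\min(1,1/|x|)\},$$ where the convolution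 is taken with respect to Lebesgue measure. For $n=1$ and $f\in L^1(\gamma)$, $$E(f)=\int_0^\infty x\left(\left|\int_x^\infty f\,d\gamma\right|+\left|\int_{-\infty}^{-x}f\,d\gamma\right|\right)d\lambda(x).$$ *)

theory Defs
  imports "HOL-Probability.Essential_Supremum"
begin

text \<open>
  The Gauss measure on the real line and the Gaussian Hardy space of complex-valued functions.
  Elements of \<open>L\<^sup>1\<close> and \<open>L\<^sup>\<infinity>\<close> are represented by Borel functions, and the notions below
  do not depend on the choice of representative.
\<close>

definition gauss :: "real measure" where
  "gauss = density lborel (\<lambda>x. ennreal (exp (- x\<^sup>2) / sqrt pi))"

text \<open>The case distinction is needed because \<open>1 / 0 = 0\<close> in HOL.\<close>

definition admissible_radius :: "real \<Rightarrow> real" where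
  "admissible_radius x = (if x = 0 then 1 else min 1 (1 / \<bar>x\<bar>))"

definition admissible_ball :: "real set \<Rightarrow> bool" where
  "admissible_ball B \<longleftrightarrow> (\<exists>c r. 0 < r \<and> r \<le> admissible_radius c \<and> B = cball c r)"

definition gauss_atom :: "(real \<Rightarrow> complex) \<Rightarrow> bool" where
  "gauss_atom a \<longleftrightarrow>
     a = (\<lambda>x. 1) \<or>
     (\<exists>B. admissible_ball B \<and>
          a \<in> borel_measurable gauss \<and>
          (AE x in gauss. x \<notin> B \<longrightarrow> a x = 0) \<and>
          (LINT x|gauss. a x) = 0 \<and>
          esssup gauss (\<lambda>x. ereal (norm (a x))) \<le> ereal (1 / measure gauss B))"

text \<open>
  The series of an atomic decomposition is required to converge in \<open>L\<^sup>1\<close> of the Gauss measure.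
  As atoms have \<open>L\<^sup>1\<close> norm at most 1 and the coefficients are absolutely summable, this amounts
  to convergence almost everywhere. Finite sums are covered by zero coefficients.
\<close>

definition atomic_decomposition ::
    "(real \<Rightarrow> complex) \<Rightarrow> (nat \<Rightarrow> complex) \<Rightarrow> (nat \<Rightarrow> real \<Rightarrow> complex) \<Rightarrow> bool" where
  "atomic_decomposition f l a \<longleftrightarrow>
     (\<forall>j. gauss_atom (a j)) \<and>
     summable (\<lambda>j. norm (l j)) \<and>
     (\<lambda>N. \<integral>\<^sup>+ x. ennreal (norm (f x - (\<Sum>j<N. l j * a j x))) \<partial>gauss) \<longlonglongrightarrow> 0"

definition gauss_H1 :: "(real \<Rightarrow> complex) set" where
  "gauss_H1 = {f. integrable gauss f \<and> (\<exists>l a. atomic_decomposition f l a)}"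

definition gauss_H1_norm :: "(real \<Rightarrow> complex) \<Rightarrow> ennreal" where
  "gauss_H1_norm f =
     Inf {ennreal (\<Sum>j. norm (l j)) | l a. atomic_decomposition f l a}"

definition test_functions :: "(real \<Rightarrow> complex) set" where
  "test_functions =
     {\<phi>. \<phi> C1_differentiable_on UNIV \<and>
         compact (closure {x. \<phi> x \<noteq> 0}) \<and> closure {x. \<phi> x \<noteq> 0} \<subseteq> ball 0 1 \<and>
         (\<forall>x. norm (\<phi> x) \<le> 1) \<and>
         (\<forall>x. norm (vector_derivative \<phi> (at x)) \<le> 1)}"

definition dilation :: "real \<Rightarrow> (real \<Rightarrow> complex) \<Rightarrow> real \<Rightarrow> complex" where
  "dilation t \<phi> x = (1 / t) *\<^sub>R \<phi> (x / t)"

definition convolution :: "(real \<Rightarrow> complex) \<Rightarrow> (real \<Rightarrow> complex) \<Rightarrow> real \<Rightarrow> complex" where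
  "convolution g f x = (LINT y|lborel. g (x - y) * f y)"

text \<open>The supremum is taken in the extended reals since it may be infinite at some points.\<close>

definition M_loc :: "(real \<Rightarrow> complex) \<Rightarrow> real \<Rightarrow> ennreal" where
  "M_loc f x =
     Sup {ennreal (norm (convolution (dilation t \<phi>) f x)) | \<phi> t.
            \<phi> \<in> test_functions \<and> 0 < t \<and> t < admissible_radius x}"

definition gauss_L1_norm :: "(real \<Rightarrow> ennreal) \<Rightarrow> ennreal" where
  "gauss_L1_norm g = (\<integral>\<^sup>+ x. g x \<partial>gauss)"

definition in_gauss_L1 :: "(real \<Rightarrow> ennreal) \<Rightarrow> bool" where
  "in_gauss_L1 g \<longleftrightarrow> g \<in> borel_measurable gauss \<and> gauss_L1_norm g < \<infinity>"

definition E_functional :: "(real \<Rightarrow> complex) \<Rightarrow> ennreal" where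
  "E_functional f =
     (\<integral>\<^sup>+ x\<in>{0..}. ennreal (x * (norm (LINT y:{x..}|gauss. f y) +
                                norm (LINT y:{..- x}|gauss. f y))) \<partial>lborel)"

end

(*
  A primitive of f with respect to the Gauss measure turns the local grand maximal function into a
  pointwise Lipschitz bound: if M_loc f <= L at both ends of a short interval, then the integral of f
  over it is at most a constant times L times the Gauss measure of the interval (telescope smooth
  cutoffs at dyadic scales at both ends). In dimension one this replaces the Whitney decomposition:
  on a short interval I whose ends are good points, let g_k be f outside the open set
  {M_loc f > 2^k L} and the average of f on each of its components. Then g_k = O(2^k L), and
  g_(k+1) - g_k has mean zero on every component at level k, hence is a sum of multiples of atoms
  whose total cost is controlled by the integral of M_loc f over I.

  The line is cut into such intervals at points x_j close to the grid sqrt(j)/16, chosen so that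
  M_loc f and the tail F(x_j) of f beyond x_j are at most comparable to local averages. For f of mean
  zero, the averages of f over the intervals telescope to the sum of F(x_j) (u_j - u_(j-1)), where u_j
  is the normalised indicator function of the j-th interval, and E(f) bounds the sum of the |F(x_j)|.
*)

theory Submission
  imports Defs "HOL-Probability.Distributions"
begin

section \<open>The Gauss measure\<close>

text \<open>\<open>M_loc\<close> tests f against Lebesgue measure, while atoms have mean zero for
  \<open>gauss\<close>. Rewriting one integral as the other brings in the density, whose derivative
  costs a factor |u|. The restriction t < \<open>admissible_radius x\<close> keeps |u| below 2 / t
  near x, so this costs no more than differentiating the test function. In the direction from H1,
  \<open>M_loc\<close> and E are built from functionals with bounded kernels; these pass through L1
  convergent series, so only single atoms need an estimate. In the other direction, the square root
  grid has cells of length comparable to 1 / (1 + |x|), and the factor 1/16 makes three consecutive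
  cells shorter than the admissible radius at each of their points. Mean zero makes the tail to the
  right of x minus the tail to the left, so one primitive F is controlled by E at both ends of the
  line. The weight x in E is the reciprocal of the cell length, which turns the integral of |x|
  |F(x)| into a sum over cells. A number \<delta> > 0 is added to \<open>M_loc\<close> so that all
  heights and averages are positive; it tends to 0 only in the final norm estimate.\<close>

definition gdens :: "real \<Rightarrow> real" where
  "gdens x = exp (- x\<^sup>2) / sqrt pi"

lemma gdens_pos [simp]: "0 < gdens x"
  by (simp add: gdens_def)

lemma gdens_nonneg [simp]: "0 \<le> gdens x"
  by (simp add: gdens_def)

lemma gdens_neq_0 [simp]: "gdens x \<noteq> 0"
  using gdens_pos[of x] by linarith

lemma borel_measurable_gdens [measurable]: "gdens \<in> borel_measurable borel"
  unfolding gdens_def[abs_def] by measurable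

lemma isCont_gdens: "isCont gdens x"
  unfolding gdens_def[abs_def] by (intro continuous_intros) auto

lemma gauss_eq: "gauss = density lborel (\<lambda>x. ennreal (gdens x))"
  by (simp add: gauss_def gdens_def)

lemma sets_gauss [simp, measurable_cong]: "sets gauss = sets borel"
  by (simp add: gauss_def)

lemma space_gauss [simp]: "space gauss = UNIV"
  by (simp add: gauss_def)

lemma borel_measurable_gauss [simp]: "borel_measurable gauss = borel_measurable borel"
  by (rule measurable_cong_sets) auto

lemma AE_gauss: "(AE x in gauss. P x) \<longleftrightarrow> (AE x in lborel. P x)"
  unfolding gauss_eq by (subst AE_density) auto

lemma nn_integral_gauss:
  "g \<in> borel_measurable borel \<Longrightarrow> (\<integral>\<^sup>+x. g x \<partial>gauss) = (\<integral>\<^sup>+x. ennreal (gdens x) * g x \<partial>lborel)"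
  unfolding gauss_eq by (subst nn_integral_density) auto

lemma integral_gauss:
  fixes g :: "real \<Rightarrow> 'a :: {banach, second_countable_topology}"
  shows "g \<in> borel_measurable borel \<Longrightarrow> (LINT x|gauss. g x) = (LINT x|lborel. gdens x *\<^sub>R g x)"
  unfolding gauss_eq by (subst integral_density) auto

lemma integrable_gauss_iff:
  fixes g :: "real \<Rightarrow> 'a :: {banach, second_countable_topology}"
  shows "g \<in> borel_measurable borel \<Longrightarrow> integrable gauss g \<longleftrightarrow> integrable lborel (\<lambda>x. gdens x *\<^sub>R g x)"
  unfolding gauss_eq by (subst integrable_density) auto

lemma prob_space_gauss: "prob_space gauss"
proof
  have "(\<lambda>x. ennreal (exp (- x\<^sup>2) / sqrt pi)) = (\<lambda>x. ennreal (normal_density 0 (sqrt (1/2)) x))"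
    by (auto simp: normal_density_def power_divide real_sqrt_divide)
  then have "gauss = density lborel (\<lambda>x. ennreal (normal_density 0 (sqrt (1/2)) x))"
    unfolding gauss_def by simp
  then show "emeasure gauss (space gauss) = 1"
    using prob_space.emeasure_space_1[OF prob_space_normal_density[of "sqrt (1/2)" 0]] by simp
qed

interpretation gauss: prob_space gauss
  by (rule prob_space_gauss)

lemma borel_measurable_integrable_gauss:
  "integrable gauss f \<Longrightarrow> f \<in> borel_measurable borel"
  using borel_measurable_integrable[of gauss f] by simp

section \<open>Admissible radius and local comparability of the Gauss measure\<close>

lemma admissible_radius_eq: "admissible_radius x = 1 / max 1 \<bar>x\<bar>"
  by (auto simp: admissible_radius_def min_def max_def field_simps)

lemma admissible_radius_pos [simp]: "0 < admissible_radius x"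
  by (simp add: admissible_radius_eq)

lemma admissible_radius_nonneg [simp]: "0 \<le> admissible_radius x"
  by (simp add: less_imp_le)

lemma admissible_radius_neq_0 [simp]: "admissible_radius x \<noteq> 0"
  using admissible_radius_pos[of x] by linarith

lemma admissible_radius_le_1: "admissible_radius x \<le> 1"
  by (simp add: admissible_radius_eq)

lemma admissible_radius_mult: "admissible_radius x * (1 + \<bar>x\<bar>) \<le> 2"
  by (simp add: admissible_radius_eq max_def field_simps)

lemma admissible_radius_ge: "1 / (1 + \<bar>x\<bar>) \<le> admissible_radius x"
  by (auto simp: admissible_radius_eq max_def intro!: divide_left_mono)

lemma continuous_on_admissible_radius: "continuous_on UNIV admissible_radius"
  unfolding admissible_radius_eq[abs_def] by (intro continuous_intros) (auto simp: max_def)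

text \<open>The reciprocal of the admissible radius is max 1 |x|, a 1-Lipschitz function; moving y
  by K times its value changes it at most by the factor 1 + K.\<close>

lemma admissible_radius_le_mult:
  assumes "\<bar>x - y\<bar> \<le> K / admissible_radius y" "0 \<le> K"
  shows "admissible_radius y \<le> (1 + K) * admissible_radius x"
proof -
  let ?X = "max 1 \<bar>x\<bar>" and ?Y = "max 1 \<bar>y\<bar>"
  have *: "\<bar>x - y\<bar> \<le> K * ?Y" using assms by (simp add: admissible_radius_eq)
  have "\<bar>x\<bar> \<le> ?Y + K * ?Y" using * by linarith
  moreover have "1 \<le> ?Y + K * ?Y" using assms by (simp add: add_increasing2)
  ultimately have "?X \<le> (1 + K) * ?Y" by (simp add: algebra_simps)
  then show ?thesis
    by (simp add: admissible_radius_eq field_simps)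
qed

text \<open>Both |x| and 1 are at most the reciprocal of the admissible radius, so x^2 and y^2
  differ by at most K * (K + 2). Hence the density is constant up to a fixed factor on admissible
  scales; K = 1 gives the \<open>exp 3\<close> seen throughout.\<close>

lemma gdens_le_mult:
  assumes "\<bar>x - y\<bar> \<le> K * admissible_radius x" "0 \<le> K"
  shows "gdens y \<le> exp (K * (K + 2)) * gdens x" "gdens x \<le> exp (K * (K + 2)) * gdens y"
proof -
  let ?m = "admissible_radius x"
  have m: "\<bar>x\<bar> * ?m \<le> 1" "?m \<le> 1" "0 \<le> ?m"
    by (auto simp: admissible_radius_eq field_simps)
  have "\<bar>x\<^sup>2 - y\<^sup>2\<bar> = \<bar>x - y\<bar> * \<bar>2 * x - (x - y)\<bar>"
    by (simp add: power2_eq_square algebra_simps flip: abs_mult)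
  also have "\<dots> \<le> \<bar>x - y\<bar> * (2 * \<bar>x\<bar> + \<bar>x - y\<bar>)"
    by (intro mult_left_mono) auto
  also have "\<dots> \<le> (K * ?m) * (2 * \<bar>x\<bar> + K * ?m)"
    using assms m by (intro mult_mono) auto
  also have "\<dots> = K * (2 * (\<bar>x\<bar> * ?m) + K * (?m * ?m))"
    by (simp add: algebra_simps)
  also have "\<dots> \<le> K * (2 * 1 + K * 1)"
    using assms m mult_le_one[OF m(2,3,2)] by (intro mult_left_mono add_mono) auto
  finally have *: "\<bar>x\<^sup>2 - y\<^sup>2\<bar> \<le> K * (K + 2)" by (simp add: algebra_simps)
  have exp_le: "exp (- v\<^sup>2) \<le> exp (K * (K + 2)) * exp (- u\<^sup>2)" if "\<bar>u\<^sup>2 - v\<^sup>2\<bar> \<le> K * (K + 2)" for u v :: real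
    using that by (simp flip: exp_add)
  show "gdens y \<le> exp (K * (K + 2)) * gdens x" "gdens x \<le> exp (K * (K + 2)) * gdens y"
    using exp_le[of x y] exp_le[of y x] * by (simp_all add: gdens_def divide_right_mono abs_minus_commute)
qed

lemma gdens_near:
  assumes "\<bar>x - y\<bar> \<le> admissible_radius x"
  shows "gdens y \<le> exp 3 * gdens x" "gdens x \<le> exp 3 * gdens y"
  using gdens_le_mult[of x y 1] assms by simp_all

lemma measure_gauss_eq:
  assumes [measurable]: "A \<in> sets borel"
  shows "measure gauss A = (LINT x|lborel. gdens x * indicator A x)"
proof -
  have "measure gauss A = (LINT x|gauss. indicator A x)"
    using gauss.emeasure_finite[of A] by (simp add: less_top)
  also have "\<dots> = (LINT x|lborel. gdens x * indicator A x)"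
    by (subst integral_gauss) auto
  finally show ?thesis .
qed

lemma measure_gauss_bounds:
  assumes "a \<le> b" and le: "\<And>x. x \<in> {a..b} \<Longrightarrow> gdens x \<le> M" and ge: "\<And>x. x \<in> {a..b} \<Longrightarrow> m \<le> gdens x"
  shows "measure gauss {a..b} \<le> M * (b - a)" "m * (b - a) \<le> measure gauss {a..b}"
proof -
  have M0: "0 \<le> M" using le[of a] gdens_nonneg[of a] \<open>a \<le> b\<close> by (auto simp del: gdens_nonneg)
  have int: "integrable lborel (\<lambda>x. gdens x * indicator {a..b} x)"
  proof -
    have "integrable gauss (indicator {a..b} :: real \<Rightarrow> real)"
      by (simp add: integrable_indicator_iff less_top[symmetric])
    then show ?thesis by (subst (asm) integrable_gauss_iff) auto
  qed
  have int': "integrable lborel (indicat_real {a..b})"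
    using \<open>a \<le> b\<close> by (simp add: integrable_indicator_iff)
  have "measure gauss {a..b} \<le> (LINT x|lborel. M * indicator {a..b} x)"
    unfolding measure_gauss_eq[OF borel_closed[OF closed_atLeastAtMost]]
    using int int' le by (intro integral_mono) (auto split: split_indicator)
  then show "measure gauss {a..b} \<le> M * (b - a)" using \<open>a \<le> b\<close> by simp
  have "(LINT x|lborel. m * indicator {a..b} x) \<le> measure gauss {a..b}"
    unfolding measure_gauss_eq[OF borel_closed[OF closed_atLeastAtMost]]
    using int int' ge by (intro integral_mono) (auto split: split_indicator)
  then show "m * (b - a) \<le> measure gauss {a..b}" using \<open>a \<le> b\<close> by simp
qed

lemma measure_gauss_interval:
  assumes "a \<le> b" and near: "\<And>x. x \<in> {a..b} \<Longrightarrow> \<bar>z - x\<bar> \<le> admissible_radius z"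
  shows "measure gauss {a..b} \<le> exp 3 * gdens z * (b - a)"
    and "exp (-3) * gdens z * (b - a) \<le> measure gauss {a..b}"
proof -
  have 2: "exp (-3) * gdens z \<le> gdens x" if "x \<in> {a..b}" for x
    using gdens_near(2)[OF near[OF that]] by (simp add: exp_minus field_simps)
  show "measure gauss {a..b} \<le> exp 3 * gdens z * (b - a)"
    "exp (-3) * gdens z * (b - a) \<le> measure gauss {a..b}"
    using measure_gauss_bounds[OF assms(1) gdens_near(1)[OF near] 2] by auto
qed

lemma measure_gauss_pos: "a < b \<Longrightarrow> 0 < measure gauss {a..b}"
proof -
  assume "a < b"
  have "continuous_on {a..b} gdens"
    by (intro continuous_at_imp_continuous_on ballI isCont_gdens)
  then obtain z where "\<And>x. x \<in> {a..b} \<Longrightarrow> gdens z \<le> gdens x"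
    using continuous_attains_inf[of "{a..b}" gdens] \<open>a < b\<close> by force
  moreover obtain y where "\<And>x. x \<in> {a..b} \<Longrightarrow> gdens x \<le> gdens y"
    using continuous_attains_sup[of "{a..b}" gdens] \<open>a < b\<close> \<open>continuous_on {a..b} gdens\<close> by force
  ultimately have "gdens z * (b - a) \<le> measure gauss {a..b}"
    using measure_gauss_bounds[of a b "gdens y" "gdens z"] \<open>a < b\<close> by auto
  moreover have "0 < gdens z * (b - a)" using \<open>a < b\<close> by simp
  ultimately show ?thesis by linarith
qed

lemma measure_gauss_ivl_eq:
  assumes "a \<le> b"
  shows "measure gauss {a<..<b} = measure gauss {a..b}"
proof (rule measure_eq_AE)
  have "AE x in lborel. x \<noteq> a" "AE x in lborel. x \<noteq> b"
    by (rule AE_lborel_singleton)+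
  then show "AE x in gauss. x \<in> {a<..<b} \<longleftrightarrow> x \<in> {a..b}"
    unfolding AE_gauss by eventually_elim auto
qed auto

lemma integrable_indicator_mult:
  fixes f :: "real \<Rightarrow> complex"
  assumes "integrable gauss f" "A \<in> sets borel"
  shows "integrable gauss (\<lambda>x. indicator A x *\<^sub>R f x)"
  using assms by (intro integrable_mult_indicator) auto

text \<open>On a bounded interval the density is at least its value at the end farther from the
  origin, so Gauss integrability gives Lebesgue integrability there.\<close>

lemma integrable_lborel_on:
  fixes f :: "real \<Rightarrow> complex"
  assumes "integrable gauss f"
  shows "set_integrable lborel {a..b} f"
proof -
  have [measurable]: "f \<in> borel_measurable borel" by (rule borel_measurable_integrable_gauss[OF assms])
  define L where "L = max \<bar>a\<bar> \<bar>b\<bar>"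
  have 1: "gdens L \<le> gdens x" if "x \<in> {a..b}" for x
  proof -
    have "x\<^sup>2 \<le> L\<^sup>2" using that by (intro power2_le_iff_abs_le[THEN iffD2]) (auto simp: L_def)
    then show ?thesis by (simp add: gdens_def divide_right_mono)
  qed
  have "integrable lborel (\<lambda>x. (1 / gdens L) *\<^sub>R (gdens x *\<^sub>R f x))"
    using assms by (intro integrable_scaleR_right) (simp add: integrable_gauss_iff)
  then show ?thesis unfolding set_integrable_def
  proof (rule Bochner_Integration.integrable_bound)
    show "AE x in lborel. norm (indicat_real {a..b} x *\<^sub>R f x) \<le> norm ((1 / gdens L) *\<^sub>R gdens x *\<^sub>R f x)"
    proof (intro always_eventually allI)
      fix x
      show "norm (indicat_real {a..b} x *\<^sub>R f x) \<le> norm ((1 / gdens L) *\<^sub>R gdens x *\<^sub>R f x)"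
        using 1[of x] mult_right_mono[of 1 "gdens x / gdens L" "norm (f x)"]
        by (auto split: split_indicator simp: field_simps)
    qed
  qed measurable
qed

section \<open>Atomic decompositions\<close>

lemma gauss_atom_measurable: "gauss_atom a \<Longrightarrow> a \<in> borel_measurable borel"
  by (auto simp: gauss_atom_def)

lemma gauss_atom_nn_integral_le:
  assumes "gauss_atom a"
  shows "(\<integral>\<^sup>+x. ennreal (norm (a x)) \<partial>gauss) \<le> 1"
  using assms unfolding gauss_atom_def
proof (elim disjE exE conjE)
  assume "a = (\<lambda>x. 1)"
  then show ?thesis using gauss.emeasure_space_1 by simp
next
  fix B assume B: "admissible_ball B" and supp: "AE x in gauss. x \<notin> B \<longrightarrow> a x = 0"
    and sup: "esssup gauss (\<lambda>x. ereal (norm (a x))) \<le> ereal (1 / measure gauss B)"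
  have [measurable]: "B \<in> sets borel" using B by (auto simp: admissible_ball_def)
  have "AE x in gauss. ereal (norm (a x)) \<le> ereal (1 / measure gauss B)"
    using esssup_AE[of "\<lambda>x. ereal (norm (a x))" gauss] by eventually_elim (rule order_trans[OF _ sup])
  with supp have "AE x in gauss. ennreal (norm (a x)) \<le> ennreal (1 / measure gauss B) * indicator B x"
    by eventually_elim (auto split: split_indicator intro!: ennreal_leI)
  then have "(\<integral>\<^sup>+x. ennreal (norm (a x)) \<partial>gauss) \<le> (\<integral>\<^sup>+x. ennreal (1 / measure gauss B) * indicator B x \<partial>gauss)"
    by (rule nn_integral_mono_AE)
  also have "\<dots> = ennreal (1 / measure gauss B) * ennreal (measure gauss B)"
    by (subst nn_integral_cmult_indicator) (auto simp: gauss.emeasure_eq_measure)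
  also have "\<dots> \<le> 1"
    by (subst ennreal_mult[symmetric]) (auto simp: ennreal_le_1)
  finally show ?thesis .
qed

lemma gauss_atom_integrable: "gauss_atom a \<Longrightarrow> integrable gauss a"
proof (rule integrableI_bounded)
  assume a: "gauss_atom a"
  then show "a \<in> borel_measurable gauss" by (simp add: gauss_atom_measurable)
  show "(\<integral>\<^sup>+x. ennreal (norm (a x)) \<partial>gauss) < \<infinity>"
    using gauss_atom_nn_integral_le[OF a] by (rule order_le_less_trans) simp
qed

lemma nn_integral_atomic_series_le:
  assumes "\<forall>j. gauss_atom (a j)" "summable (\<lambda>j. norm (l j))"
  shows "(\<integral>\<^sup>+x. (\<Sum>j. ennreal (norm (l j * a j x))) \<partial>gauss) \<le> ennreal (\<Sum>j. norm (l j))"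
proof -
  have [measurable]: "a j \<in> borel_measurable borel" for j
    using assms(1) by (simp add: gauss_atom_measurable)
  have "(\<integral>\<^sup>+x. (\<Sum>j. ennreal (norm (l j * a j x))) \<partial>gauss) = (\<Sum>j. \<integral>\<^sup>+x. ennreal (norm (l j * a j x)) \<partial>gauss)"
    by (rule nn_integral_suminf) simp
  also have "\<dots> \<le> (\<Sum>j. ennreal (norm (l j)))"
  proof (rule suminf_le)
    fix j
    have "(\<integral>\<^sup>+x. ennreal (norm (l j * a j x)) \<partial>gauss) = ennreal (norm (l j)) * (\<integral>\<^sup>+x. ennreal (norm (a j x)) \<partial>gauss)"
      by (simp add: norm_mult ennreal_mult nn_integral_cmult)
    also have "\<dots> \<le> ennreal (norm (l j)) * 1"
      using gauss_atom_nn_integral_le assms(1) by (intro mult_left_mono) auto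
    finally show "(\<integral>\<^sup>+x. ennreal (norm (l j * a j x)) \<partial>gauss) \<le> ennreal (norm (l j))" by simp
  qed auto
  also have "\<dots> = ennreal (\<Sum>j. norm (l j))"
    using assms(2) by (intro suminf_ennreal2) auto
  finally show ?thesis .
qed

lemma AE_summable_atomic_series:
  assumes "\<forall>j. gauss_atom (a j)" "summable (\<lambda>j. norm (l j))"
  shows "AE x in gauss. summable (\<lambda>j. norm (l j * a j x))"
proof -
  have [measurable]: "a j \<in> borel_measurable borel" for j
    using assms(1) by (simp add: gauss_atom_measurable)
  have "AE x in gauss. (\<Sum>j. ennreal (norm (l j * a j x))) \<noteq> \<infinity>"
  proof (rule nn_integral_noteq_infinite)
    show "(\<integral>\<^sup>+x. (\<Sum>j. ennreal (norm (l j * a j x))) \<partial>gauss) \<noteq> \<infinity>"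
      using nn_integral_atomic_series_le[OF assms] by (auto simp: top_unique)
  qed simp
  then show ?thesis
    by eventually_elim (auto intro: summable_suminf_not_top)
qed

text \<open>Atoms have L1 norm at most 1, so the L1 norm of the remainder after N terms is bounded
  by the tail of the coefficient series. Decompositions can therefore be built from pointwise
  convergence.\<close>

lemma atomic_decompositionI:
  assumes a: "\<forall>j. gauss_atom (a j)" and l: "summable (\<lambda>j. norm (l j))"
    and sums: "AE x in gauss. (\<lambda>j. l j * a j x) sums f x"
  shows "atomic_decomposition f l a"
  unfolding atomic_decomposition_def
proof (intro conjI a l)
  have [measurable]: "a j \<in> borel_measurable borel" for j
    using a by (simp add: gauss_atom_measurable)
  let ?t = "\<lambda>N. \<Sum>j. norm (l (j + N))"
  have "?t = (\<lambda>N. (\<Sum>j. norm (l j)) - (\<Sum>j<N. norm (l j)))"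
    using suminf_minus_initial_segment[OF l] by auto
  moreover have "(\<lambda>N. (\<Sum>j. norm (l j)) - (\<Sum>j<N. norm (l j))) \<longlonglongrightarrow> (\<Sum>j. norm (l j)) - (\<Sum>j. norm (l j))"
    by (intro tendsto_diff tendsto_const summable_LIMSEQ[OF l])
  ultimately have "?t \<longlonglongrightarrow> (\<Sum>j. norm (l j)) - (\<Sum>j. norm (l j))"
    by simp
  then have lim: "(\<lambda>N. ennreal (?t N)) \<longlonglongrightarrow> 0"
    using tendsto_ennrealI[of ?t 0] by simp
  have "(\<integral>\<^sup>+x. ennreal (norm (f x - (\<Sum>j<N. l j * a j x))) \<partial>gauss) \<le> ennreal (?t N)" for N
  proof -
    have "AE x in gauss. ennreal (norm (f x - (\<Sum>j<N. l j * a j x))) \<le> (\<Sum>j. ennreal (norm (l (j + N) * a (j + N) x)))"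
      using sums AE_summable_atomic_series[OF a l]
    proof eventually_elim
      case (elim x)
      have s: "summable (\<lambda>j. norm (l (j + N) * a (j + N) x))"
        using elim(2) by (subst summable_iff_shift)
      have "f x - (\<Sum>j<N. l j * a j x) = (\<Sum>j. l (j + N) * a (j + N) x)"
        using elim(1) suminf_minus_initial_segment[of "\<lambda>j. l j * a j x" N] by (auto simp: sums_iff)
      then have "norm (f x - (\<Sum>j<N. l j * a j x)) \<le> (\<Sum>j. norm (l (j + N) * a (j + N) x))"
        using summable_norm[OF s] by simp
      then show ?case
        using s by (subst suminf_ennreal2) (auto intro: ennreal_leI)
    qed
    then have "(\<integral>\<^sup>+x. ennreal (norm (f x - (\<Sum>j<N. l j * a j x))) \<partial>gauss)
        \<le> (\<integral>\<^sup>+x. (\<Sum>j. ennreal (norm (l (j + N) * a (j + N) x))) \<partial>gauss)"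
      by (rule nn_integral_mono_AE)
    also have "\<dots> \<le> ennreal (?t N)"
      using a l summable_iff_shift[of "\<lambda>j. norm (l j)" N]
      by (intro nn_integral_atomic_series_le[of "\<lambda>j. a (j + N)" "\<lambda>j. l (j + N)"]) simp_all
    finally show ?thesis .
  qed
  then show "(\<lambda>N. \<integral>\<^sup>+x. ennreal (norm (f x - (\<Sum>j<N. l j * a j x))) \<partial>gauss) \<longlonglongrightarrow> 0"
    by (intro tendsto_sandwich[OF _ _ tendsto_const lim]) auto
qed

lemma atomic_decompositionD:
  assumes "atomic_decomposition f l a"
  shows "\<forall>j. gauss_atom (a j)" "summable (\<lambda>j. norm (l j))"
    "(\<lambda>N. \<integral>\<^sup>+x. ennreal (norm (f x - (\<Sum>j<N. l j * a j x))) \<partial>gauss) \<longlonglongrightarrow> 0"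
  using assms by (auto simp: atomic_decomposition_def)

text \<open>The series converges absolutely almost everywhere, and its pointwise sum S is also its
  limit in L1; uniqueness of L1 limits gives f = S almost everywhere.\<close>

lemma atomic_decomposition_sums:
  assumes f: "f \<in> borel_measurable borel" and ad: "atomic_decomposition f l a"
  shows "AE x in gauss. (\<lambda>j. l j * a j x) sums f x"
proof -
  note D = atomic_decompositionD[OF ad]
  note [measurable] = f
  have [measurable]: "a j \<in> borel_measurable borel" for j
    using D(1) by (simp add: gauss_atom_measurable)
  define S where "S = (\<lambda>x. \<Sum>j. l j * a j x)"
  have [measurable]: "S \<in> borel_measurable borel" unfolding S_def by measurable
  have S: "AE x in gauss. (\<lambda>j. l j * a j x) sums S x"
    using AE_summable_atomic_series[OF D(1,2)]
    by eventually_elim (auto simp: S_def dest: summable_norm_cancel summable_sums)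
  note D' = atomic_decompositionD[OF atomic_decompositionI[OF D(1,2) S]]
  have "(\<integral>\<^sup>+x. ennreal (norm (f x - S x)) \<partial>gauss)
     \<le> (\<integral>\<^sup>+x. ennreal (norm (f x - (\<Sum>j<N. l j * a j x))) \<partial>gauss) + (\<integral>\<^sup>+x. ennreal (norm (S x - (\<Sum>j<N. l j * a j x))) \<partial>gauss)" for N
  proof -
    have "(\<integral>\<^sup>+x. ennreal (norm (f x - S x)) \<partial>gauss)
      \<le> (\<integral>\<^sup>+x. ennreal (norm (f x - (\<Sum>j<N. l j * a j x))) + ennreal (norm (S x - (\<Sum>j<N. l j * a j x))) \<partial>gauss)"
    proof (rule nn_integral_mono)
      fix x
      have "norm (f x - S x) \<le> norm (f x - (\<Sum>j<N. l j * a j x)) + norm (S x - (\<Sum>j<N. l j * a j x))"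
        using norm_triangle_ineq4[of "f x - (\<Sum>j<N. l j * a j x)" "S x - (\<Sum>j<N. l j * a j x)"] by simp
      then show "ennreal (norm (f x - S x)) \<le> ennreal (norm (f x - (\<Sum>j<N. l j * a j x))) + ennreal (norm (S x - (\<Sum>j<N. l j * a j x)))"
        by (simp flip: ennreal_plus add: ennreal_leI)
    qed
    also have "\<dots> = (\<integral>\<^sup>+x. ennreal (norm (f x - (\<Sum>j<N. l j * a j x))) \<partial>gauss) + (\<integral>\<^sup>+x. ennreal (norm (S x - (\<Sum>j<N. l j * a j x))) \<partial>gauss)"
      by (rule nn_integral_add) measurable
    finally show ?thesis .
  qed
  moreover have "(\<lambda>N. (\<integral>\<^sup>+x. ennreal (norm (f x - (\<Sum>j<N. l j * a j x))) \<partial>gauss) + (\<integral>\<^sup>+x. ennreal (norm (S x - (\<Sum>j<N. l j * a j x))) \<partial>gauss)) \<longlonglongrightarrow> 0 + 0"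
    by (intro tendsto_add D(3) D'(3))
  ultimately have "(\<integral>\<^sup>+x. ennreal (norm (f x - S x)) \<partial>gauss) \<le> 0 + 0"
    using LIMSEQ_le_const by blast
  then have "AE x in gauss. ennreal (norm (f x - S x)) = 0"
    by (simp add: nn_integral_0_iff_AE)
  with S show ?thesis
    by eventually_elim auto
qed

text \<open>Unlike a bound on the infimum \<open>gauss_H1_norm\<close>, this asks for one
  decomposition within the budget K. Membership and norm bound then travel together through
  countable sums, without an epsilon for each summand.\<close>

definition gauss_H1_le :: "(real \<Rightarrow> complex) \<Rightarrow> ennreal \<Rightarrow> bool" where
  "gauss_H1_le f K \<longleftrightarrow>
     integrable gauss f \<and> (\<exists>l a. atomic_decomposition f l a \<and> ennreal (\<Sum>j. norm (l j)) \<le> K)"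

lemma gauss_H1_leD:
  assumes "gauss_H1_le f K"
  shows "integrable gauss f" "f \<in> gauss_H1" "gauss_H1_norm f \<le> K"
proof -
  obtain l a where la: "atomic_decomposition f l a" "ennreal (\<Sum>j. norm (l j)) \<le> K" and f: "integrable gauss f"
    using assms by (auto simp: gauss_H1_le_def)
  show "integrable gauss f" by fact
  show "f \<in> gauss_H1" using la f by (auto simp: gauss_H1_def)
  have "gauss_H1_norm f \<le> ennreal (\<Sum>j. norm (l j))"
    unfolding gauss_H1_norm_def using la(1) by (intro Inf_lower) auto
  with la(2) show "gauss_H1_norm f \<le> K" by simp
qed

lemma gauss_H1_leI:
  assumes a: "\<forall>j. gauss_atom (a j)" and l: "(\<Sum>j. ennreal (norm (l j))) \<le> K" "K < \<infinity>"
    and f: "f \<in> borel_measurable borel" and sums: "AE x in gauss. (\<lambda>j. l j * a j x) sums f x"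
  shows "gauss_H1_le f K"
proof -
  have sl: "summable (\<lambda>j. norm (l j))"
    using l by (intro summable_suminf_not_top) auto
  then have eq: "(\<Sum>j. ennreal (norm (l j))) = ennreal (\<Sum>j. norm (l j))"
    by (intro suminf_ennreal2) auto
  have "(\<integral>\<^sup>+x. ennreal (norm (f x)) \<partial>gauss) \<le> (\<integral>\<^sup>+x. (\<Sum>j. ennreal (norm (l j * a j x))) \<partial>gauss)"
  proof (rule nn_integral_mono_AE)
    show "AE x in gauss. ennreal (norm (f x)) \<le> (\<Sum>j. ennreal (norm (l j * a j x)))"
      using sums AE_summable_atomic_series[OF a sl]
    proof eventually_elim
      case (elim x)
      then have "norm (f x) \<le> (\<Sum>j. norm (l j * a j x))"
        using summable_norm[OF elim(2)] by (auto simp: sums_iff)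
      then show ?case
        using elim(2) by (subst suminf_ennreal2) (auto intro: ennreal_leI)
    qed
  qed
  also have "\<dots> \<le> ennreal (\<Sum>j. norm (l j))"
    by (rule nn_integral_atomic_series_le[OF a sl])
  finally have "integrable gauss f"
    using f by (intro integrableI_bounded) (auto intro: order_le_less_trans)
  moreover have "atomic_decomposition f l a"
    by (rule atomic_decompositionI[OF a sl sums])
  ultimately show ?thesis
    using l eq by (auto simp: gauss_H1_le_def)
qed

lemma gauss_H1_le_mono: "gauss_H1_le f K \<Longrightarrow> K \<le> L \<Longrightarrow> gauss_H1_le f L"
  by (auto simp: gauss_H1_le_def)

text \<open>The decompositions are merged into one sequence through \<open>prod_decode\<close>.
  Almost everywhere the merged series converges absolutely, so it may be summed row by row, which
  gives back the f i and then g.\<close>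

lemma gauss_H1_le_sums:
  assumes H: "\<And>i. gauss_H1_le (f i) (c i)" and c: "(\<Sum>i. c i) \<le> K" "K < \<infinity>"
    and g: "g \<in> borel_measurable borel" and sums: "AE x in gauss. (\<lambda>i. f i x) sums g x"
  shows "gauss_H1_le g K"
proof -
  have "\<exists>l a. atomic_decomposition (f i) l a \<and> ennreal (\<Sum>j. norm (l j)) \<le> c i" for i
    using H[of i] by (auto simp: gauss_H1_le_def)
  then obtain l a where ad: "\<And>i. atomic_decomposition (f i) (l i) (a i)"
      and le: "\<And>i. ennreal (\<Sum>j. norm (l i j)) \<le> c i"
    by metis
  note D = atomic_decompositionD[OF ad]
  have f: "f i \<in> borel_measurable borel" for i
    using gauss_H1_leD(1)[OF H] by (rule borel_measurable_integrable_gauss)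
  define L where "L n = (case prod_decode n of (i, j) \<Rightarrow> l i j)" for n
  define A where "A n = (case prod_decode n of (i, j) \<Rightarrow> a i j)" for n
  have A: "\<forall>n. gauss_atom (A n)"
    using D(1) by (auto simp: A_def split: prod.split)
  have "(\<Sum>n. ennreal (norm (L n))) = (\<Sum>n. (\<lambda>(i, j). ennreal (norm (l i j))) (prod_decode n))"
    by (rule suminf_cong) (simp add: L_def split: prod.split)
  also have "\<dots> = (\<Sum>i. \<Sum>j. ennreal (norm (l i j)))"
    by (rule suminf_ennreal_2dimen) simp
  also have "\<dots> = (\<Sum>i. ennreal (\<Sum>j. norm (l i j)))"
    using D(2) by (intro suminf_cong suminf_ennreal2) auto
  also have "\<dots> \<le> (\<Sum>i. c i)"
    by (intro suminf_le le) auto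
  finally have L: "(\<Sum>n. ennreal (norm (L n))) \<le> K" using c(1) by simp
  have sL: "summable (\<lambda>n. norm (L n))"
    using L c(2) by (intro summable_suminf_not_top) auto
  have "AE x in gauss. \<forall>i. (\<lambda>j. l i j * a i j x) sums f i x"
    unfolding AE_all_countable using atomic_decomposition_sums[OF f ad] by simp
  moreover have "AE x in gauss. \<forall>i. summable (\<lambda>j. norm (l i j * a i j x))"
    unfolding AE_all_countable using AE_summable_atomic_series[OF D(1,2)] by simp
  ultimately have "AE x in gauss. (\<lambda>n. L n * A n x) sums g x"
    using AE_summable_atomic_series[OF A sL] sums
  proof eventually_elim
    case (elim x)
    let ?S = "\<Sum>n. L n * A n x"
    let ?F = "\<lambda>(i, j). l i j * a i j x"
    have sm: "summable (\<lambda>n. L n * A n x)" using elim(3) by (rule summable_norm_cancel)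
    have "((\<lambda>n. L n * A n x) has_sum ?S) UNIV"
      by (rule norm_summable_imp_has_sum[OF elim(3) summable_sums[OF sm]])
    moreover have "(\<lambda>n. L n * A n x) = ?F \<circ> prod_decode"
      by (auto simp: L_def A_def fun_eq_iff split: prod.split)
    ultimately have "(?F has_sum ?S) (prod_decode ` UNIV)"
      using has_sum_reindex[OF inj_prod_decode, of ?F UNIV ?S] by simp
    then have "(?F has_sum ?S) (Sigma UNIV (\<lambda>_. UNIV))" by (simp add: surj_prod_decode)
    moreover have "((\<lambda>j. ?F (i, j)) has_sum f i x) UNIV" for i
      unfolding prod.case
      by (rule norm_summable_imp_has_sum[OF elim(2)[rule_format] elim(1)[rule_format]])
    ultimately have "((\<lambda>i. f i x) has_sum ?S) UNIV"
      by (rule has_sum_SigmaD)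
    then have "?S = g x"
      using sums_unique2[OF has_sum_imp_sums elim(4)] by simp
    then show ?case using sm by (auto simp: sums_iff)
  qed
  then show ?thesis
    by (rule gauss_H1_leI[OF A L c(2) g])
qed

lemma gauss_H1_le_0: "gauss_H1_le (\<lambda>x. 0) 0"
  by (rule gauss_H1_leI[where a="\<lambda>_ _. 1" and l="\<lambda>_. 0"]) (auto simp: gauss_atom_def)

text \<open>A version for unordered countable index sets: it is applied to components of an open set
  and to pairs of a cell and a flag, where no natural enumeration exists.\<close>

lemma gauss_H1_le_has_sum:
  fixes A :: "'i set"
  assumes A: "countable A" and H: "\<And>i. i \<in> A \<Longrightarrow> gauss_H1_le (f i) (c i)"
    and c: "\<And>B. finite B \<Longrightarrow> B \<subseteq> A \<Longrightarrow> sum c B \<le> K" "K < \<infinity>"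
    and g: "g \<in> borel_measurable borel" and sums: "AE x in gauss. ((\<lambda>i. f i x) has_sum g x) A"
  shows "gauss_H1_le g K"
proof -
  let ?T = "to_nat_on A ` A"
  \<comment> \<open>Numbers that code no element of A carry the zero function at cost 0, so a finite
    A needs no separate treatment.\<close>
  let ?f = "\<lambda>n. if n \<in> ?T then f (from_nat_into A n) else (\<lambda>x. 0)"
  let ?c = "\<lambda>n. if n \<in> ?T then c (from_nat_into A n) else 0"
  have inj: "inj_on (to_nat_on A) A" using A by (rule inj_on_to_nat_on)
  show ?thesis
  proof (rule gauss_H1_le_sums[where f = ?f and c = ?c])
    show "gauss_H1_le (?f n) (?c n)" for n
      using H A by (auto simp: gauss_H1_le_0)
    show "(\<Sum>n. ?c n) \<le> K"
      unfolding suminf_eq_SUP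
    proof (rule SUP_least)
      fix n
      let ?B = "{i \<in> A. to_nat_on A i < n}"
      have injB: "inj_on (to_nat_on A) ?B" using inj by (rule inj_on_subset) auto
      have "finite (to_nat_on A ` ?B)" by (rule finite_subset[of _ "{..<n}"]) auto
      then have "finite ?B" using injB by (rule finite_imageD)
      have "(\<Sum>m<n. ?c m) = (\<Sum>m\<in>to_nat_on A ` ?B. c (from_nat_into A m))"
        by (rule sum.mono_neutral_cong_right) auto
      also have "\<dots> = (\<Sum>i\<in>?B. c (from_nat_into A (to_nat_on A i)))"
        using injB by (subst sum.reindex) auto
      also have "\<dots> = sum c ?B" using A by (intro sum.cong) auto
      also have "\<dots> \<le> K" using \<open>finite ?B\<close> by (intro c) auto
      finally show "(\<Sum>m<n. ?c m) \<le> K" .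
    qed
    show "AE x in gauss. (\<lambda>n. ?f n x) sums g x"
      using sums
    proof eventually_elim
      case (elim x)
      have "((\<lambda>n. ?f n x) has_sum g x) UNIV \<longleftrightarrow> ((\<lambda>n. f (from_nat_into A n) x) has_sum g x) ?T"
        by (rule has_sum_cong_neutral) auto
      also have "\<dots> \<longleftrightarrow> ((\<lambda>n. f (from_nat_into A n) x) \<circ> to_nat_on A has_sum g x) A"
        by (rule has_sum_reindex[OF inj])
      also have "\<dots> \<longleftrightarrow> ((\<lambda>i. f i x) has_sum g x) A"
        using A by (intro has_sum_cong) auto
      finally show ?case using elim by (intro has_sum_imp_sums) simp
    qed
  qed (use c g in auto)
qed

lemma gauss_H1_le_add:
  assumes f: "gauss_H1_le f K" and g: "gauss_H1_le g L" and fin: "K + L < \<infinity>"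
  shows "gauss_H1_le (\<lambda>x. f x + g x) (K + L)"
proof (rule gauss_H1_le_has_sum[where A = "UNIV :: bool set" and f = "\<lambda>b. if b then f else g" and c = "\<lambda>b. if b then K else L"])
  show "sum (\<lambda>b. if b then K else L) B \<le> K + L" for B
  proof -
    have "sum (\<lambda>b. if b then K else L) B \<le> sum (\<lambda>b. if b then K else L) UNIV"
      by (intro sum_mono2) auto
    then show ?thesis by (simp add: UNIV_bool add.commute)
  qed
  show "(\<lambda>x. f x + g x) \<in> borel_measurable borel"
    using borel_measurable_integrable_gauss[OF gauss_H1_leD(1)[OF f]]
      borel_measurable_integrable_gauss[OF gauss_H1_leD(1)[OF g]] by measurable
  show "AE x in gauss. ((\<lambda>i. (if i then f else g) x) has_sum f x + g x) UNIV"
  proof (intro always_eventually allI)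
    fix x
    show "((\<lambda>i. (if i then f else g) x) has_sum f x + g x) UNIV"
      using has_sum_finite[of "UNIV :: bool set" "\<lambda>i. (if i then f else g) x"] by (simp add: UNIV_bool add.commute)
  qed
qed (use f g fin in auto)

lemma gauss_H1_le_single:
  assumes a: "gauss_atom a" and f: "f \<in> borel_measurable borel" and eq: "AE x in gauss. f x = l * a x"
  shows "gauss_H1_le f (ennreal (norm l))"
proof (rule gauss_H1_leI[where a = "\<lambda>_. a" and l = "\<lambda>j. if j = 0 then l else 0"])
  have "(\<Sum>j. ennreal (norm (if j = 0 then l else 0))) = (\<Sum>j\<in>{0 :: nat}. ennreal (norm (if j = 0 then l else 0)))"
    by (rule suminf_finite) auto
  then show "(\<Sum>j. ennreal (norm (if j = 0 then l else 0))) \<le> ennreal (norm l)" by simp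
  show "AE x in gauss. (\<lambda>j. (if j = 0 then l else 0) * a x) sums f x"
    using eq
  proof eventually_elim
    case (elim x)
    then show ?case
      using sums_single[of 0 "\<lambda>_. l * a x"] by (simp add: if_distrib[of "\<lambda>y. y * _"] cong: if_cong)
  qed
qed (use a f in auto)

lemma gauss_H1_le_const: "gauss_H1_le (\<lambda>x. c) (ennreal (norm c))"
  by (rule gauss_H1_le_single[of "\<lambda>x. 1"]) (auto simp: gauss_atom_def)

text \<open>Divided by A times the Gauss measure of the interval, g is an atom for the ball around
  the midpoint. This is the only source of nonconstant atoms in the construction.\<close>

lemma gauss_H1_le_mean_zero:
  assumes ab: "a < b" "(b - a) / 2 \<le> admissible_radius ((a + b) / 2)"
    and g: "g \<in> borel_measurable borel" and bd: "AE x in gauss. norm (g x) \<le> A * indicator {a..b} x"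
    and mean: "(LINT x|gauss. g x) = 0"
  shows "gauss_H1_le g (ennreal (A * measure gauss {a..b}))"
proof (cases "A \<le> 0")
  case True
  \<comment> \<open>With A at most 0 the bound forces g to vanish, and the constant atom with
    coefficient 0 represents it.\<close>
  have "AE x in gauss. g x = 0 * 1"
    using bd
  proof eventually_elim
    case (elim x)
    moreover have "A * indicator {a..b} x \<le> 0" using True by (simp add: mult_nonpos_nonneg)
    ultimately have "norm (g x) \<le> 0" by linarith
    then show ?case by simp
  qed
  then have "gauss_H1_le g (ennreal (norm (0::complex)))"
    using g by (intro gauss_H1_le_single[where a="\<lambda>x. 1"]) (auto simp: gauss_atom_def)
  then show ?thesis by (rule gauss_H1_le_mono) auto
next
  case False
  define G where "G = measure gauss {a..b}"
  have G: "0 < G" unfolding G_def using ab(1) by (rule measure_gauss_pos)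
  let ?l = "complex_of_real (A * G)"
  have l: "?l \<noteq> 0" using G False by simp
  have ball: "cball ((a + b) / 2) ((b - a) / 2) = {a..b}"
    unfolding cball_eq_atLeastAtMost by (rule arg_cong2[where f = atLeastAtMost]) (simp_all add: field_simps)
  have "gauss_H1_le g (ennreal (norm ?l))"
  proof (rule gauss_H1_le_single[where a="\<lambda>x. g x / ?l"])
    show "gauss_atom (\<lambda>x. g x / ?l)"
      unfolding gauss_atom_def
    proof (intro disjI2 exI conjI)
      show "admissible_ball {a..b}"
        unfolding admissible_ball_def
        using ab by (intro exI[of _ "(a + b) / 2"] exI[of _ "(b - a) / 2"] conjI ball[symmetric]) simp_all
      show "(\<lambda>x. g x / ?l) \<in> borel_measurable gauss" using g by simp
      show "AE x in gauss. x \<notin> {a..b} \<longrightarrow> g x / ?l = 0"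
        using bd by eventually_elim auto
      show "(LINT x|gauss. g x / ?l) = 0" using mean by simp
      show "esssup gauss (\<lambda>x. ereal (norm (g x / ?l))) \<le> ereal (1 / measure gauss {a..b})"
      proof (rule esssup_I)
        show "AE x in gauss. ereal (norm (g x / ?l)) \<le> ereal (1 / measure gauss {a..b})"
          using bd
        proof eventually_elim
          case (elim x)
          moreover have "A * indicator {a..b} x \<le> A"
            using False by (simp split: split_indicator)
          ultimately have "norm (g x) \<le> A" by linarith
          then have "norm (g x) / (A * G) \<le> A / (A * G)"
            using False G by (intro divide_right_mono) auto
          moreover have "norm ?l = A * G" using False G by (simp only: norm_of_real) simp
          ultimately show ?case using False G
            by (simp only: norm_divide ereal_less_eq G_def[symmetric]) simp
        qed
      qed (use g in simp)
    qed
  qed (use g l in auto)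
  moreover have "norm ?l = A * G" using False G by (simp only: norm_of_real) simp
  ultimately show ?thesis by (simp only: G_def)
qed

section \<open>Maximal function and tails as suprema of functionals\<close>

lemma sums_ennreal_norm_le:
  fixes u :: "nat \<Rightarrow> 'a :: banach"
  assumes "u sums s"
  shows "ennreal (norm s) \<le> (\<Sum>j. ennreal (norm (u j)))"
proof (cases "(\<Sum>j. ennreal (norm (u j))) = top")
  case False
  then have s: "summable (\<lambda>j. norm (u j))"
    by (intro summable_suminf_not_top) auto
  have "norm s \<le> (\<Sum>j. norm (u j))"
    using summable_norm[OF s] assms by (simp add: sums_iff)
  then show ?thesis
    using s by (subst suminf_ennreal2) (auto intro: ennreal_leI)
qed simp

lemma integrable_bounded_mult:
  fixes f k :: "real \<Rightarrow> complex"
  assumes f: "integrable gauss f" and k: "k \<in> borel_measurable borel" "\<And>y. norm (k y) \<le> K"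
  shows "integrable gauss (\<lambda>y. k y * f y)"
proof (rule Bochner_Integration.integrable_bound[of gauss "\<lambda>y. of_real K * f y"])
  show "(\<lambda>y. k y * f y) \<in> borel_measurable gauss"
    using k(1) borel_measurable_integrable_gauss[OF f] by simp
  show "AE y in gauss. norm (k y * f y) \<le> norm (of_real K * f y)"
  proof (intro always_eventually allI)
    fix y
    have "0 \<le> K" using k(2)[of y] norm_ge_zero order_trans by blast
    then show "norm (k y * f y) \<le> norm (of_real K * f y)"
      using k(2)[of y] by (simp add: norm_mult mult_right_mono)
  qed
qed (use f in simp)

lemma norm_functional_le:
  fixes f k :: "real \<Rightarrow> complex"
  assumes f: "integrable gauss f" and k: "k \<in> borel_measurable borel" "\<And>y. norm (k y) \<le> K"
  shows "norm (LINT y|gauss. k y * f y) \<le> K * (LINT y|gauss. norm (f y))"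
proof -
  have "norm (LINT y|gauss. k y * f y) \<le> (LINT y|gauss. norm (k y * f y))"
    by (rule integral_norm_bound)
  also have "\<dots> \<le> (LINT y|gauss. K * norm (f y))"
  proof (rule integral_mono)
    show "integrable gauss (\<lambda>y. norm (k y * f y))"
      by (rule integrable_norm[OF integrable_bounded_mult[OF assms]])
    show "integrable gauss (\<lambda>y. K * norm (f y))" using f by simp
    show "norm (k y * f y) \<le> K * norm (f y)" for y
      using k(2)[of y] by (simp add: norm_mult mult_right_mono)
  qed
  finally show ?thesis by simp
qed

text \<open>A bounded kernel defines a continuous functional on L1, and the atomic series converges
  in L1. Convolution at a fixed point and scale, and integration over a half line, are both of this
  form.\<close>

lemma atomic_decomposition_functional_sums:
  fixes f k :: "real \<Rightarrow> complex"
  assumes f: "integrable gauss f" and ad: "atomic_decomposition f l a"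
    and k: "k \<in> borel_measurable borel" "\<And>y. norm (k y) \<le> K"
  shows "(\<lambda>j. l j * (LINT y|gauss. k y * a j y)) sums (LINT y|gauss. k y * f y)"
proof -
  note D = atomic_decompositionD[OF ad]
  have a: "integrable gauss (a j)" for j using D(1) gauss_atom_integrable by blast
  let ?S = "\<lambda>N y. \<Sum>j<N. l j * a j y"
  let ?T = "\<lambda>g. LINT y|gauss. k y * g y"
  have S: "integrable gauss (?S N)" for N
    using a by (intro Bochner_Integration.integrable_sum) auto
  have TS: "?T (?S N) = (\<Sum>j<N. l j * ?T (a j))" for N
  proof -
    have "?T (?S N) = (LINT y|gauss. (\<Sum>j<N. l j * (k y * a j y)))"
      by (simp add: sum_distrib_left mult.left_commute)
    also have "\<dots> = (\<Sum>j<N. LINT y|gauss. l j * (k y * a j y))"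
      using integrable_bounded_mult[OF a k] by (intro Bochner_Integration.integral_sum) auto
    finally show ?thesis by simp
  qed
  have int: "(\<lambda>N. LINT y|gauss. norm (f y - ?S N y)) \<longlonglongrightarrow> 0"
  proof -
    have "(\<integral>\<^sup>+y. ennreal (norm (f y - ?S N y)) \<partial>gauss) = ennreal (LINT y|gauss. norm (f y - ?S N y))" for N
      using f S by (intro nn_integral_eq_integral) auto
    then have "(\<lambda>N. ennreal (LINT y|gauss. norm (f y - ?S N y))) \<longlonglongrightarrow> ennreal 0" using D(3) by simp
    then show ?thesis by (subst (asm) tendsto_ennreal_iff) auto
  qed
  have "(\<lambda>N. ?T (?S N) - ?T f) \<longlonglongrightarrow> 0"
  proof (rule Lim_null_comparison)
    show "\<forall>\<^sub>F N in sequentially. norm (?T (?S N) - ?T f) \<le> K * (LINT y|gauss. norm (f y - ?S N y))"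
    proof (intro always_eventually allI)
      fix N
      have "?T (?S N) - ?T f = - ?T (\<lambda>y. f y - ?S N y)"
        using integrable_bounded_mult[OF S k, of N] integrable_bounded_mult[OF f k]
        by (simp add: right_diff_distrib)
      then show "norm (?T (?S N) - ?T f) \<le> K * (LINT y|gauss. norm (f y - ?S N y))"
        using norm_functional_le[OF Bochner_Integration.integrable_diff[OF f S[of N]] k] by simp
    qed
    show "(\<lambda>N. K * (LINT y|gauss. norm (f y - ?S N y))) \<longlonglongrightarrow> 0"
      using tendsto_mult_right_zero[OF int] by simp
  qed
  then have "(\<lambda>N. ?T (?S N)) \<longlonglongrightarrow> ?T f" by (simp add: LIM_zero_iff)
  then show ?thesis unfolding sums_def TS .
qed

lemma atomic_decomposition_functional_le:
  fixes f k :: "real \<Rightarrow> complex"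
  assumes "integrable gauss f" "atomic_decomposition f l a" "k \<in> borel_measurable borel" "\<And>y. norm (k y) \<le> K"
  shows "ennreal (norm (LINT y|gauss. k y * f y)) \<le> (\<Sum>j. ennreal (norm (l j)) * ennreal (norm (LINT y|gauss. k y * a j y)))"
  using sums_ennreal_norm_le[OF atomic_decomposition_functional_sums[OF assms]]
  by (simp add: norm_mult ennreal_mult)

section \<open>Test functions and their kernels against the Gauss measure\<close>

lemma test_functionsD:
  assumes "\<phi> \<in> test_functions"
  shows "continuous_on UNIV \<phi>" "\<phi> \<in> borel_measurable borel" "norm (\<phi> x) \<le> 1"
    "1 \<le> \<bar>x\<bar> \<Longrightarrow> \<phi> x = 0" "norm (\<phi> x - \<phi> y) \<le> \<bar>x - y\<bar>"
proof -
  have C1: "\<phi> C1_differentiable_on UNIV" and supp: "closure {x. \<phi> x \<noteq> 0} \<subseteq> ball 0 1"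
    and le: "\<And>x. norm (\<phi> x) \<le> 1" "\<And>x. norm (vector_derivative \<phi> (at x)) \<le> 1"
    using assms by (auto simp: test_functions_def)
  show "continuous_on UNIV \<phi>" by (rule C1_differentiable_imp_continuous_on[OF C1])
  then show "\<phi> \<in> borel_measurable borel" by (rule borel_measurable_continuous_onI)
  show "norm (\<phi> x) \<le> 1" by (rule le)
  show "\<phi> x = 0" if "1 \<le> \<bar>x\<bar>"
  proof (rule ccontr)
    assume "\<phi> x \<noteq> 0"
    then have "x \<in> closure {x. \<phi> x \<noteq> 0}" using closure_subset by fast
    then show False using supp that by auto
  qed
  have "(\<phi> has_vector_derivative vector_derivative \<phi> (at x)) (at x within UNIV)" for x
    using C1 by (simp add: C1_differentiable_on_eq vector_derivative_works)
  then have "norm (\<phi> x - \<phi> y) \<le> 1 * norm (x - y)"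
    unfolding has_vector_derivative_def
    by (intro differentiable_bound[where S=UNIV]) (auto simp: onorm_scaleR_left onorm_id le)
  then show "norm (\<phi> x - \<phi> y) \<le> \<bar>x - y\<bar>" by simp
qed

lemma dilation_test:
  assumes \<phi>: "\<phi> \<in> test_functions" and t: "0 < t"
  shows "continuous_on UNIV (dilation t \<phi>)" "norm (dilation t \<phi> x) \<le> 1 / t"
    "t \<le> \<bar>x\<bar> \<Longrightarrow> dilation t \<phi> x = 0" "norm (dilation t \<phi> x - dilation t \<phi> y) \<le> \<bar>x - y\<bar> / t\<^sup>2"
proof -
  note D = test_functionsD[OF \<phi>]
  show "continuous_on UNIV (dilation t \<phi>)"
    unfolding dilation_def[abs_def] using t
    by (intro continuous_intros continuous_on_compose2[OF D(1)]) auto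
  show "norm (dilation t \<phi> x) \<le> 1 / t"
    using D(3)[of "x / t"] t by (simp add: dilation_def divide_right_mono)
  show "t \<le> \<bar>x\<bar> \<Longrightarrow> dilation t \<phi> x = 0"
    using D(4)[of "x / t"] t by (simp add: dilation_def)
  have "dilation t \<phi> x - dilation t \<phi> y = (1 / t) *\<^sub>R (\<phi> (x / t) - \<phi> (y / t))"
    by (simp add: dilation_def scaleR_diff_right)
  also have "norm \<dots> \<le> (1 / t) * (\<bar>x - y\<bar> / t)"
  proof -
    have "\<bar>x / t - y / t\<bar> = \<bar>x - y\<bar> / t" using t by (simp add: diff_divide_distrib[symmetric])
    then show ?thesis
      using mult_left_mono[OF D(5)[of "x / t" "y / t"], of "1 / t"] t by simp
  qed
  finally show "norm (dilation t \<phi> x - dilation t \<phi> y) \<le> \<bar>x - y\<bar> / t\<^sup>2"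
    by (simp add: power2_eq_square)
qed

lemma borel_measurable_dilation [measurable]:
  "\<phi> \<in> test_functions \<Longrightarrow> 0 < t \<Longrightarrow> dilation t \<phi> \<in> borel_measurable borel"
  by (rule borel_measurable_continuous_onI[OF dilation_test(1)])

text \<open>
  Dividing by the density turns the convolution, which is taken with respect to Lebesgue measure,
  into a functional on \<open>L\<^sup>1\<close> of the Gauss measure.
\<close>

definition kernel :: "real \<Rightarrow> (real \<Rightarrow> complex) \<Rightarrow> real \<Rightarrow> real \<Rightarrow> complex" where
  "kernel t \<phi> x y = dilation t \<phi> (x - y) / of_real (gdens y)"

lemma borel_measurable_kernel [measurable]:
  "\<phi> \<in> test_functions \<Longrightarrow> 0 < t \<Longrightarrow> kernel t \<phi> x \<in> borel_measurable borel"
  unfolding kernel_def[abs_def] by measurable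

lemma convolution_eq:
  assumes [measurable]: "\<phi> \<in> test_functions" and t [measurable]: "0 < t" and [measurable]: "f \<in> borel_measurable borel"
  shows "Defs.convolution (dilation t \<phi>) f x = (LINT y|gauss. kernel t \<phi> x y * f y)"
  unfolding Defs.convolution_def
  by (subst integral_gauss) (auto simp: kernel_def scaleR_conv_of_real)

lemma kernel_eq_0:
  "\<phi> \<in> test_functions \<Longrightarrow> 0 < t \<Longrightarrow> t \<le> \<bar>x - y\<bar> \<Longrightarrow> kernel t \<phi> x y = 0"
  by (simp add: kernel_def dilation_test)

text \<open>Dividing by the density is harmless for fixed x and t: the kernel lives on |x - y| < t,
  where |y| <= |x| + t bounds the density from below.\<close>

lemma kernel_bounded:
  assumes \<phi>: "\<phi> \<in> test_functions" and t: "0 < t"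
  shows "norm (kernel t \<phi> x y) \<le> 1 / (t * gdens (\<bar>x\<bar> + t))"
proof (cases "\<bar>x - y\<bar> < t")
  case True
  then have "y\<^sup>2 \<le> (\<bar>x\<bar> + t)\<^sup>2" by (intro power2_le_iff_abs_le[THEN iffD2]) auto
  then have "gdens (\<bar>x\<bar> + t) \<le> gdens y" by (simp add: gdens_def divide_right_mono)
  have "norm (kernel t \<phi> x y) = norm (dilation t \<phi> (x - y)) / gdens y"
    by (simp add: kernel_def norm_divide)
  also have "\<dots> \<le> (1 / t) / gdens (\<bar>x\<bar> + t)"
    using dilation_test(2)[OF assms] \<open>gdens (\<bar>x\<bar> + t) \<le> gdens y\<close> t by (intro frac_le) auto
  finally show ?thesis by simp
next
  case False
  then show ?thesis using kernel_eq_0[OF assms, of x y] t by simp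
qed

lemma continuous_on_convolution:
  assumes \<phi>: "\<phi> \<in> test_functions" and t: "0 < t" and f: "integrable gauss f"
  shows "continuous_on UNIV (Defs.convolution (dilation t \<phi>) f)"
  unfolding continuous_on_sequentially
proof (intro allI impI ballI)
  fix u x assume "(\<forall>n. u n \<in> (UNIV :: real set)) \<and> u \<longlonglongrightarrow> x"
  then have u: "u \<longlonglongrightarrow> x" by simp
  have fm [measurable]: "f \<in> borel_measurable borel" by (rule borel_measurable_integrable_gauss[OF f])
  have "Bseq u" using u convergent_imp_Bseq convergent_def by blast
  then obtain R where R: "\<And>n. norm (u n) \<le> R" by (auto simp: Bseq_def)
  have int: "integrable lborel (\<lambda>y. (1 / t) *\<^sub>R (indicator {- R - t..R + t} y *\<^sub>R f y))"
    using integrable_lborel_on[OF f] by (intro integrable_scaleR_right) (auto simp: set_integrable_def)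
  have dm [measurable]: "(\<lambda>y. dilation t \<phi> (z - y) * f y) \<in> borel_measurable lborel" for z
    using borel_measurable_dilation[OF \<phi> t] by measurable
  show "(Defs.convolution (dilation t \<phi>) f \<circ> u) \<longlonglongrightarrow> Defs.convolution (dilation t \<phi>) f x"
    unfolding o_def Defs.convolution_def
  proof (rule integral_dominated_convergence[where w="\<lambda>y. norm ((1 / t) *\<^sub>R (indicator {- R - t..R + t} y *\<^sub>R f y))"])
    show "AE y in lborel. (\<lambda>n. dilation t \<phi> (u n - y) * f y) \<longlonglongrightarrow> dilation t \<phi> (x - y) * f y"
    proof (intro always_eventually allI tendsto_mult tendsto_const)
      fix y
      have "isCont (dilation t \<phi>) (x - y)"
        using dilation_test(1)[OF \<phi> t] by (simp add: continuous_on_eq_continuous_at)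
      then show "(\<lambda>n. dilation t \<phi> (u n - y)) \<longlonglongrightarrow> dilation t \<phi> (x - y)"
        by (rule isCont_tendsto_compose) (intro tendsto_diff u tendsto_const)
    qed
    show "AE y in lborel. norm (dilation t \<phi> (u n - y) * f y) \<le> norm ((1 / t) *\<^sub>R indicator {- R - t..R + t} y *\<^sub>R f y)" for n
    proof (intro always_eventually allI)
      fix y
      show "norm (dilation t \<phi> (u n - y) * f y) \<le> norm ((1 / t) *\<^sub>R indicator {- R - t..R + t} y *\<^sub>R f y)"
      proof (cases "t \<le> \<bar>u n - y\<bar>")
        case True
        then show ?thesis using dilation_test(3)[OF \<phi> t] by simp
      next
        case False
        then have "y \<in> {- R - t..R + t}" using R[of n] by auto
        then show ?thesis
          using dilation_test(2)[OF \<phi> t, of "u n - y"] t mult_right_mono[of _ "1/t" "norm (f y)"]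
          by (simp add: norm_mult)
      qed
    qed
    show "integrable lborel (\<lambda>y. norm ((1 / t) *\<^sub>R (indicator {- R - t..R + t} y *\<^sub>R f y)))"
      by (rule integrable_norm[OF int])
  qed auto
qed

lemma M_loc_upper:
  "\<phi> \<in> test_functions \<Longrightarrow> 0 < t \<Longrightarrow> t < admissible_radius x \<Longrightarrow>
    ennreal (norm (Defs.convolution (dilation t \<phi>) f x)) \<le> M_loc f x"
  unfolding M_loc_def by (intro Sup_upper) auto

lemma M_loc_least:
  "(\<And>\<phi> t. \<phi> \<in> test_functions \<Longrightarrow> 0 < t \<Longrightarrow> t < admissible_radius x \<Longrightarrow>
    ennreal (norm (Defs.convolution (dilation t \<phi>) f x)) \<le> K) \<Longrightarrow> M_loc f x \<le> K"
  unfolding M_loc_def by (intro Sup_least) auto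

text \<open>Each convolution is continuous, and the constraint t <
  \<open>admissible_radius x\<close> is open in x, so \<open>M_loc\<close> is lower semicontinuous.
  Besides measurability this makes the level sets open, hence unions of intervals.\<close>

lemma open_M_loc_greater:
  assumes f: "integrable gauss f"
  shows "open {x. c < M_loc f x}"
proof -
  let ?U = "\<lambda>\<phi> t. {x. t < admissible_radius x} \<inter> {x. c < ennreal (norm (Defs.convolution (dilation t \<phi>) f x))}"
  have "{x. c < M_loc f x} = (\<Union>\<phi>\<in>test_functions. \<Union>t\<in>{0<..}. ?U \<phi> t)"
    unfolding M_loc_def less_Sup_iff by auto
  also have "open \<dots>"
  proof (intro open_UN open_Int ballI)
    fix \<phi> :: "real \<Rightarrow> complex" and t :: real assume *: "\<phi> \<in> test_functions" "t \<in> {0<..}"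
    show "open {x. t < admissible_radius x}"
      by (rule open_Collect_less[OF _ continuous_on_admissible_radius]) simp
    show "open {x. c < ennreal (norm (Defs.convolution (dilation t \<phi>) f x))}"
      by (rule open_Collect_less) (use * in \<open>auto intro!: continuous_on_ennreal continuous_on_norm continuous_on_convolution f\<close>)
  qed
  finally show ?thesis .
qed

lemma borel_measurable_M_loc [measurable]:
  "integrable gauss f \<Longrightarrow> M_loc f \<in> borel_measurable borel"
  by (rule borel_measurableI_greater) (use open_M_loc_greater in auto)

lemma M_loc_atomic_decomposition_le:
  assumes f: "integrable gauss f" and ad: "atomic_decomposition f l a"
  shows "M_loc f x \<le> (\<Sum>j. ennreal (norm (l j)) * M_loc (a j) x)"
proof (rule M_loc_least)
  fix \<phi> t assume t: "\<phi> \<in> test_functions" "0 < t" "t < admissible_radius x"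
  have fm: "f \<in> borel_measurable borel" by (rule borel_measurable_integrable_gauss[OF f])
  have am: "a j \<in> borel_measurable borel" for j
    using atomic_decompositionD(1)[OF ad] by (simp add: gauss_atom_measurable)
  have "ennreal (norm (Defs.convolution (dilation t \<phi>) f x))
      \<le> (\<Sum>j. ennreal (norm (l j)) * ennreal (norm (Defs.convolution (dilation t \<phi>) (a j) x)))"
    unfolding convolution_eq[OF t(1,2) fm] convolution_eq[OF t(1,2) am]
    by (rule atomic_decomposition_functional_le[OF f ad _ kernel_bounded[OF t(1,2)]])
      (use t in measurable)
  also have "\<dots> \<le> (\<Sum>j. ennreal (norm (l j)) * M_loc (a j) x)"
    using t by (intro suminf_le mult_left_mono M_loc_upper) auto
  finally show "ennreal (norm (Defs.convolution (dilation t \<phi>) f x)) \<le> (\<Sum>j. ennreal (norm (l j)) * M_loc (a j) x)" .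
qed

lemma M_loc_diff_le:
  assumes f: "integrable gauss f" and g: "integrable gauss g"
  shows "M_loc (\<lambda>x. f x - g x) x \<le> M_loc f x + M_loc g x"
proof (rule M_loc_least)
  fix \<phi> t assume t: "\<phi> \<in> test_functions" "0 < t" "t < admissible_radius x"
  have fm: "f \<in> borel_measurable borel" "g \<in> borel_measurable borel"
    using borel_measurable_integrable_gauss f g by auto
  have k: "kernel t \<phi> x \<in> borel_measurable borel" using t by measurable
  have "Defs.convolution (dilation t \<phi>) (\<lambda>x. f x - g x) x = Defs.convolution (dilation t \<phi>) f x - Defs.convolution (dilation t \<phi>) g x"
    using integrable_bounded_mult[OF f k kernel_bounded[OF t(1,2)]] integrable_bounded_mult[OF g k kernel_bounded[OF t(1,2)]] fm
    by (subst (1 2 3) convolution_eq[OF t(1,2)]) (auto simp: right_diff_distrib)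
  then have "ennreal (norm (Defs.convolution (dilation t \<phi>) (\<lambda>x. f x - g x) x))
     \<le> ennreal (norm (Defs.convolution (dilation t \<phi>) f x)) + ennreal (norm (Defs.convolution (dilation t \<phi>) g x))"
    using norm_triangle_ineq4 by (simp flip: ennreal_plus add: ennreal_leI)
  also have "\<dots> \<le> M_loc f x + M_loc g x"
    using t by (intro add_mono M_loc_upper)
  finally show "ennreal (norm (Defs.convolution (dilation t \<phi>) (\<lambda>x. f x - g x) x)) \<le> M_loc f x + M_loc g x" .
qed

lemma M_loc_le_local_bound:
  assumes f: "f \<in> borel_measurable borel" and A: "0 \<le> A" and bd: "AE y in lborel. norm (f y) \<le> A"
  shows "M_loc f x \<le> ennreal (2 * A)"
proof (rule M_loc_least, rule ennreal_leI)
  fix \<phi> t assume t: "\<phi> \<in> test_functions" "0 < t" "t < admissible_radius x"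
  have int: "integrable lborel (\<lambda>y. A / t * indicator {x - t..x + t} y)"
    using t by (intro integrable_mult_right) (auto simp: integrable_indicator_iff)
  have le: "AE y in lborel. norm (dilation t \<phi> (x - y) * f y) \<le> A / t * indicator {x - t..x + t} y"
    using bd
  proof eventually_elim
    case (elim y)
    show ?case
    proof (cases "t \<le> \<bar>x - y\<bar>")
      case True
      then show ?thesis using dilation_test(3)[OF t(1,2) True] A t by simp
    next
      case False
      then have "y \<in> {x - t..x + t}" by auto
      moreover have "norm (dilation t \<phi> (x - y) * f y) \<le> (1 / t) * A"
        unfolding norm_mult using dilation_test(2)[OF t(1,2)] elim t by (intro mult_mono) auto
      ultimately show ?thesis by simp
    qed
  qed
  have dm [measurable]: "(\<lambda>y. dilation t \<phi> (x - y) * f y) \<in> borel_measurable lborel"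
    using borel_measurable_dilation[OF t(1,2)] f by measurable
  have "norm (Defs.convolution (dilation t \<phi>) f x) \<le> (LINT y|lborel. norm (dilation t \<phi> (x - y) * f y))"
    unfolding Defs.convolution_def by (rule integral_norm_bound)
  also have "\<dots> \<le> (LINT y|lborel. A / t * indicator {x - t..x + t} y)"
  proof (rule integral_mono_AE)
    show "integrable lborel (\<lambda>y. norm (dilation t \<phi> (x - y) * f y))"
    proof (rule Bochner_Integration.integrable_bound[OF int])
      show "AE y in lborel. norm (norm (dilation t \<phi> (x - y) * f y)) \<le> norm (A / t * indicator {x - t..x + t} y)"
        using le
      proof eventually_elim
        case (elim y)
        then show ?case
          using abs_ge_self[of "A / t * indicator {x - t..x + t} y"]
          unfolding real_norm_def abs_norm_cancel by linarith
      qed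
    qed simp
  qed (use int le in auto)
  \<comment> \<open>The kernel has height 1 / t on an interval of length 2 t, whence the factor
    2.\<close>
  also have "\<dots> = A / t * (2 * t)" using t by simp
  finally show "norm (Defs.convolution (dilation t \<phi>) f x) \<le> 2 * A" using t by simp
qed

section \<open>Tail integrals\<close>

abbreviation tails :: "(real \<Rightarrow> complex) \<Rightarrow> real \<Rightarrow> real" where
  "tails f x \<equiv> norm (LINT y:{x..}|gauss. f y) + norm (LINT y:{..- x}|gauss. f y)"

lemma borel_measurable_tails [measurable]:
  fixes f :: "real \<Rightarrow> complex"
  assumes [measurable]: "f \<in> borel_measurable borel"
  shows "(\<lambda>x. norm (LINT y:{x..}|gauss. f y)) \<in> borel_measurable borel"
    "(\<lambda>x. norm (LINT y:{..x}|gauss. f y)) \<in> borel_measurable borel"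
    "(\<lambda>x. norm (LINT y:{..-x}|gauss. f y)) \<in> borel_measurable borel"
proof -
  \<comment> \<open>Moving the half line into the integrand gives a jointly measurable function of
    (x, y), to which measurability of parameter integrals applies.\<close>
  have 1: "(\<lambda>x. LINT y:{x..}|gauss. f y) = (\<lambda>x. LINT y|gauss. (if x \<le> y then f y else 0))"
    unfolding set_lebesgue_integral_def by (intro ext Bochner_Integration.integral_cong) auto
  have "(\<lambda>x. LINT y:{x..}|gauss. f y) \<in> borel_measurable borel" unfolding 1
    by (rule gauss.borel_measurable_lebesgue_integral[where f = "\<lambda>x y. if x \<le> y then f y else 0"]) measurable
  then show "(\<lambda>x. norm (LINT y:{x..}|gauss. f y)) \<in> borel_measurable borel" by measurable
  have 2: "(\<lambda>x. LINT y:{..x}|gauss. f y) = (\<lambda>x. LINT y|gauss. (if y \<le> x then f y else 0))"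
    unfolding set_lebesgue_integral_def by (intro ext Bochner_Integration.integral_cong) auto
  have *: "(\<lambda>x. LINT y:{..x}|gauss. f y) \<in> borel_measurable borel" unfolding 2
    by (rule gauss.borel_measurable_lebesgue_integral[where f = "\<lambda>x y. if y \<le> x then f y else 0"]) measurable
  then show "(\<lambda>x. norm (LINT y:{..x}|gauss. f y)) \<in> borel_measurable borel" by measurable
  have "(\<lambda>x. (\<lambda>x. LINT y:{..x}|gauss. f y) (- x)) \<in> borel_measurable borel" using * by measurable
  then show "(\<lambda>x. norm (LINT y:{..-x}|gauss. f y)) \<in> borel_measurable borel" by measurable
qed

lemma E_functional_eq: "E_functional f = (\<integral>\<^sup>+x. ennreal (x * tails f x) * indicator {0..} x \<partial>lborel)"
  by (simp add: E_functional_def)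

text \<open>A tail is a functional whose kernel is an indicator function, hence bounded by 1.
  Subadditivity therefore holds for each x and survives integration against the weight x.\<close>

lemma E_atomic_decomposition_le:
  assumes f: "integrable gauss f" and ad: "atomic_decomposition f l a"
  shows "E_functional f \<le> (\<Sum>j. ennreal (norm (l j)) * E_functional (a j))"
proof -
  have fm [measurable]: "f \<in> borel_measurable borel" by (rule borel_measurable_integrable_gauss[OF f])
  have am [measurable]: "a j \<in> borel_measurable borel" for j
    using atomic_decompositionD(1)[OF ad] by (simp add: gauss_atom_measurable)
  have le1: "ennreal (norm (LINT y:A|gauss. f y)) \<le> (\<Sum>j. ennreal (norm (l j)) * ennreal (norm (LINT y:A|gauss. a j y)))"
    if "A \<in> sets borel" for A
  proof -
    have eq: "(LINT y:A|gauss. g y) = (LINT y|gauss. indicator A y * g y)" for g :: "real \<Rightarrow> complex"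
      unfolding set_lebesgue_integral_def
      by (intro Bochner_Integration.integral_cong) (auto simp: indicator_def)
    show ?thesis unfolding eq
      by (rule atomic_decomposition_functional_le[OF f ad, where K = 1]) (use that in \<open>auto simp: indicator_def\<close>)
  qed
  have le: "ennreal (x * tails f x) * indicator {0..} x \<le> (\<Sum>j. ennreal (norm (l j)) * (ennreal (x * tails (a j) x) * indicator {0..} x))" for x
  proof (cases "0 \<le> x")
    case True
    have "ennreal (x * tails f x) = ennreal x * (ennreal (norm (LINT y:{x..}|gauss. f y)) + ennreal (norm (LINT y:{..- x}|gauss. f y)))"
      using True by (simp add: ennreal_mult flip: ennreal_plus)
    also have "\<dots> \<le> ennreal x * ((\<Sum>j. ennreal (norm (l j)) * ennreal (norm (LINT y:{x..}|gauss. a j y)))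
        + (\<Sum>j. ennreal (norm (l j)) * ennreal (norm (LINT y:{..- x}|gauss. a j y))))"
      by (intro mult_left_mono add_mono le1) auto
    also have "\<dots> = (\<Sum>j. ennreal (norm (l j)) * ennreal (x * tails (a j) x))"
    proof -
      have "ennreal (norm (l j)) * ennreal (x * tails (a j) x) =
          ennreal x * (ennreal (norm (l j)) * ennreal (norm (LINT y:{x..}|gauss. a j y)))
          + ennreal x * (ennreal (norm (l j)) * ennreal (norm (LINT y:{..- x}|gauss. a j y)))" for j
        using True by (simp add: distrib_left ennreal_mult mult.left_commute)
      then show ?thesis
        by (simp add: suminf_add distrib_left del: ennreal_suminf_cmult flip: ennreal_suminf_cmult)
    qed
    finally show ?thesis using True by simp
  qed simp
  have "E_functional f \<le> (\<integral>\<^sup>+x. (\<Sum>j. ennreal (norm (l j)) * (ennreal (x * tails (a j) x) * indicator {0..} x)) \<partial>lborel)"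
    unfolding E_functional_eq by (intro nn_integral_mono le)
  also have "\<dots> = (\<Sum>j. \<integral>\<^sup>+x. ennreal (norm (l j)) * (ennreal (x * tails (a j) x) * indicator {0..} x) \<partial>lborel)"
    by (rule nn_integral_suminf) measurable
  also have "\<dots> = (\<Sum>j. ennreal (norm (l j)) * E_functional (a j))"
    unfolding E_functional_eq by (subst nn_integral_cmult) auto
  finally show ?thesis .
qed

section \<open>Atoms\<close>

lemma borel_measurable_M_loc_atom [measurable]:
  "gauss_atom a \<Longrightarrow> M_loc a \<in> borel_measurable borel"
  by (intro borel_measurable_M_loc gauss_atom_integrable)

text \<open>Half of the exponent is spent on decay: exp (- y^2) <= exp (- x^2 / 2) * exp (- y^2 /
  2), and the second factor integrates to a multiple of the standard normal density.\<close>

lemma gauss_tail_le: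
  assumes A: "A \<in> sets borel" and far: "\<And>y. y \<in> A \<Longrightarrow> x\<^sup>2 \<le> y\<^sup>2"
  shows "measure gauss A \<le> 2 * exp (- x\<^sup>2 / 2)"
proof -
  note [measurable] = A
  have "emeasure gauss A = (\<integral>\<^sup>+y. indicator A y \<partial>gauss)" by simp
  also have "\<dots> = (\<integral>\<^sup>+y. ennreal (gdens y) * indicator A y \<partial>lborel)"
    by (rule nn_integral_gauss) simp
  also have "\<dots> \<le> (\<integral>\<^sup>+y. ennreal (sqrt 2 * exp (- x\<^sup>2 / 2)) * ennreal (std_normal_density y) \<partial>lborel)"
  proof (rule nn_integral_mono)
    fix y
    have "gdens y \<le> sqrt 2 * exp (- x\<^sup>2 / 2) * std_normal_density y" if "y \<in> A"
    proof -
      have "exp (- y\<^sup>2) \<le> exp (- x\<^sup>2 / 2) * exp (- y\<^sup>2 / 2)"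
        using far[OF that] by (simp flip: exp_add)
      then show ?thesis
        by (simp add: gdens_def std_normal_density_def real_sqrt_mult field_simps)
    qed
    then show "ennreal (gdens y) * indicator A y \<le> ennreal (sqrt 2 * exp (- x\<^sup>2 / 2)) * ennreal (std_normal_density y)"
      by (auto simp: ennreal_mult[symmetric] split: split_indicator intro!: ennreal_leI)
  qed
  also have "\<dots> = ennreal (sqrt 2 * exp (- x\<^sup>2 / 2)) * (\<integral>\<^sup>+y. ennreal (std_normal_density y) \<partial>lborel)"
    by (rule nn_integral_cmult) simp
  also have "(\<integral>\<^sup>+y. ennreal (std_normal_density y) \<partial>lborel) = 1"
    using prob_space.emeasure_space_1[OF prob_space_normal_density[of 1 0]] by (simp add: emeasure_density)
  finally have "measure gauss A \<le> sqrt 2 * exp (- x\<^sup>2 / 2)"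
    by (simp add: gauss.emeasure_eq_measure)
  also have "\<dots> \<le> 2 * exp (- x\<^sup>2 / 2)"
    using real_sqrt_le_mono[of 2 4] by (intro mult_right_mono) auto
  finally show ?thesis .
qed

lemma E_functional_1_le: "E_functional (\<lambda>x. 1) \<le> 4"
proof -
  have "E_functional (\<lambda>x. 1) \<le> (\<integral>\<^sup>+x. ennreal (4 * (x * exp (- x\<^sup>2 / 2))) * indicator {0..} x \<partial>lborel)"
    unfolding E_functional_eq
  proof (intro nn_integral_mono)
    fix x :: real
    show "ennreal (x * tails (\<lambda>x. 1) x) * indicator {0..} x \<le> ennreal (4 * (x * exp (- x\<^sup>2 / 2))) * indicator {0..} x"
    proof (cases "0 \<le> x")
      case True
      have "tails (\<lambda>x. 1) x = measure gauss {x..} + measure gauss {..-x}"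
        by (simp add: set_lebesgue_integral_def scaleR_conv_of_real)
      also have "\<dots> \<le> 2 * exp (- x\<^sup>2 / 2) + 2 * exp (- x\<^sup>2 / 2)"
      proof (intro add_mono gauss_tail_le)
        show "x\<^sup>2 \<le> y\<^sup>2" if "y \<in> {x..}" for y using that True by (simp add: power_mono)
        show "x\<^sup>2 \<le> y\<^sup>2" if "y \<in> {..-x}" for y
          using that True power_mono[of x "-y" 2] by simp
      qed auto
      finally have "x * tails (\<lambda>x. 1) x \<le> x * (4 * exp (- x\<^sup>2 / 2))"
        using True by (intro mult_left_mono) auto
      also have "\<dots> = 4 * (x * exp (- x\<^sup>2 / 2))" by simp
      finally have "ennreal (x * tails (\<lambda>x. 1) x) \<le> ennreal (4 * (x * exp (- x\<^sup>2 / 2)))"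
        by (rule ennreal_leI)
      then show ?thesis by (intro mult_right_mono) auto
    qed simp
  qed
  \<comment> \<open>The weight x of E makes the Gaussian tail bound an exact derivative, of - 4 *
    exp (- x^2 / 2).\<close>
  also have "\<dots> = ennreal (0 - (- 4 * exp (- 0\<^sup>2 / 2)))"
  proof (rule nn_integral_FTC_atLeast)
    show "((\<lambda>x. - 4 * exp (- x\<^sup>2 / 2)) has_real_derivative 4 * (x * exp (- x\<^sup>2 / 2))) (at x)" for x :: real
      by (auto intro!: derivative_eq_intros)
    have "filterlim (\<lambda>x::real. 1 / 2 * x\<^sup>2) at_top at_top"
      by (intro filterlim_tendsto_pos_mult_at_top[OF tendsto_const] filterlim_pow_at_top filterlim_ident) auto
    then have "filterlim (\<lambda>x::real. - (1 / 2 * x\<^sup>2)) at_bot at_top"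
      by (rule filterlim_compose[OF filterlim_uminus_at_bot_at_top])
    then have "((\<lambda>x::real. exp (- (1 / 2 * x\<^sup>2))) \<longlongrightarrow> 0) at_top"
      by (rule filterlim_compose[OF exp_at_bot])
    then show "((\<lambda>x::real. - 4 * exp (- x\<^sup>2 / 2)) \<longlongrightarrow> 0) at_top"
      using tendsto_mult_right_zero[of "\<lambda>x::real. exp (- (1 / 2 * x\<^sup>2))" at_top "-4"] by simp
  qed auto
  finally show ?thesis by simp
qed

lemma M_loc_1_le: "(\<integral>\<^sup>+x. M_loc (\<lambda>x. 1) x \<partial>gauss) \<le> 2"
proof -
  have "(\<integral>\<^sup>+x. M_loc (\<lambda>x. 1) x \<partial>gauss) \<le> (\<integral>\<^sup>+x. 2 \<partial>gauss)"
    using M_loc_le_local_bound[of "\<lambda>x. 1" 1] by (intro nn_integral_mono) auto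
  also have "\<dots> = 2" using gauss.emeasure_space_1 by simp
  finally show ?thesis .
qed

lemma gdens_deriv: "(gdens has_real_derivative - 2 * x * gdens x) (at x)"
  unfolding gdens_def[abs_def] by (auto intro!: derivative_eq_intros simp: field_simps)

text \<open>Mean value theorem: the derivative of 1 / \<open>gdens\<close> is 2 u /
  \<open>gdens u\<close>, and |u| <= 1 + |c| is at most 2 / \<open>admissible_radius c\<close> on
  the ball.\<close>

lemma inverse_gdens_diff_le:
  assumes y: "\<bar>y - c\<bar> \<le> admissible_radius c"
  shows "\<bar>1 / gdens y - 1 / gdens c\<bar> \<le> 4 * exp 3 * \<bar>y - c\<bar> / (admissible_radius c * gdens c)"
proof -
  let ?m = "admissible_radius c"
  let ?I = "{min c y..max c y}"
  have der: "((\<lambda>u. 1 / gdens u) has_real_derivative 2 * u / gdens u) (at u within ?I)" for u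
    by (rule derivative_eq_intros has_field_derivative_at_within[OF gdens_deriv] refl gdens_neq_0)+ simp
  have le: "norm (2 * u / gdens u) \<le> 4 * exp 3 / (?m * gdens c)" if u: "u \<in> ?I" for u
  proof -
    have uc: "\<bar>c - u\<bar> \<le> ?m" using u y by auto
    have "\<bar>u\<bar> \<le> 1 + \<bar>c\<bar>" using uc admissible_radius_le_1[of c] by linarith
    also have "1 + \<bar>c\<bar> \<le> 2 / ?m" using admissible_radius_mult[of c] by (simp add: field_simps)
    finally have "2 * \<bar>u\<bar> \<le> 4 / ?m" by simp
    moreover have "1 / gdens u \<le> exp 3 / gdens c"
      using gdens_near(2)[OF uc] by (simp add: field_simps)
    ultimately have "(2 * \<bar>u\<bar>) * (1 / gdens u) \<le> (4 / ?m) * (exp 3 / gdens c)"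
      by (intro mult_mono) auto
    then show ?thesis by (simp add: abs_mult)
  qed
  have "norm (1 / gdens y - 1 / gdens c) \<le> 4 * exp 3 / (?m * gdens c) * norm (y - c)"
    by (rule field_differentiable_bound[where S = ?I, OF _ der le]) auto
  then show ?thesis by simp
qed

text \<open>The first term is the Lipschitz bound of the dilated test function; the second is the
  price for varying the density, which is where the admissible radius enters.\<close>

lemma kernel_diff_le:
  assumes \<phi>: "\<phi> \<in> test_functions" and t: "0 < t"
    and y: "\<bar>y - c\<bar> \<le> r" and r: "r \<le> admissible_radius c"
  shows "norm (kernel t \<phi> x y - kernel t \<phi> x c)
     \<le> exp 3 / gdens c * (r / t\<^sup>2 + 4 * r / (t * admissible_radius c))"
proof -
  let ?m = "admissible_radius c" and ?d = "dilation t \<phi>"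
  have r0: "0 \<le> r" using y by linarith
  have ycm: "\<bar>c - y\<bar> \<le> ?m" "\<bar>y - c\<bar> \<le> ?m" using y r by linarith+
  have "kernel t \<phi> x y - kernel t \<phi> x c
      = (?d (x - y) - ?d (x - c)) / of_real (gdens y) + ?d (x - c) * of_real (1 / gdens y - 1 / gdens c)"
    by (simp add: kernel_def field_simps)
  also have "norm \<dots> \<le> norm (?d (x - y) - ?d (x - c)) * (1 / gdens y) + norm (?d (x - c)) * \<bar>1 / gdens y - 1 / gdens c\<bar>"
    by (intro norm_triangle_le add_mono) (simp_all only: norm_mult norm_divide norm_of_real, simp_all)
  also have "\<dots> \<le> (r / t\<^sup>2) * (exp 3 / gdens c) + (1 / t) * (4 * exp 3 * r / (?m * gdens c))"
  proof (intro add_mono mult_mono)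
    have "norm (?d (x - y) - ?d (x - c)) \<le> \<bar>(x - y) - (x - c)\<bar> / t\<^sup>2"
      by (rule dilation_test(4)[OF \<phi> t])
    also have "\<dots> \<le> r / t\<^sup>2" using y by (intro divide_right_mono) auto
    finally show "norm (?d (x - y) - ?d (x - c)) \<le> r / t\<^sup>2" .
    show "1 / gdens y \<le> exp 3 / gdens c" using gdens_near(2)[OF ycm(1)] by (simp add: field_simps)
    show "norm (?d (x - c)) \<le> 1 / t" by (rule dilation_test(2)[OF \<phi> t])
    have "\<bar>1 / gdens y - 1 / gdens c\<bar> \<le> 4 * exp 3 * \<bar>y - c\<bar> / (?m * gdens c)"
      by (rule inverse_gdens_diff_le[OF ycm(2)])
    also have "\<dots> \<le> 4 * exp 3 * r / (?m * gdens c)"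
      using y by (intro divide_right_mono mult_left_mono) auto
    finally show "\<bar>1 / gdens y - 1 / gdens c\<bar> \<le> 4 * exp 3 * r / (?m * gdens c)" .
  qed (use t r0 in auto)
  also have "\<dots> = exp 3 / gdens c * (r / t\<^sup>2 + 4 * r / (t * ?m))"
    using t by (simp add: field_simps)
  finally show ?thesis .
qed

locale mean_zero_atom =
  fixes a :: "real \<Rightarrow> complex" and c r :: real
  assumes r: "0 < r" "r \<le> admissible_radius c"
    and integrable: "integrable gauss a"
    and supp: "AE y in lborel. y \<notin> cball c r \<longrightarrow> a y = 0"
    and bound: "AE y in lborel. norm (a y) \<le> 1 / measure gauss (cball c r)"
    and mean: "(LINT y|gauss. a y) = 0"
    and norm1: "(LINT y|gauss. norm (a y)) \<le> 1"
begin

lemma measurable_a [measurable]: "a \<in> borel_measurable borel"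
  by (rule borel_measurable_integrable_gauss[OF integrable])

lemma measure_ball_ge: "exp (- 3) * gdens c * (2 * r) \<le> measure gauss (cball c r)"
proof -
  have "exp (- 3) * gdens c * (c + r - (c - r)) \<le> measure gauss {c - r..c + r}"
    using r by (intro measure_gauss_interval(2)) auto
  then show ?thesis by (simp add: cball_eq_atLeastAtMost)
qed

lemma conv_far:
  assumes t: "\<phi> \<in> test_functions" "0 < t" and far: "t \<le> \<bar>x - c\<bar> - r"
  shows "Defs.convolution (dilation t \<phi>) a x = 0"
proof -
  have "AE y in lborel. dilation t \<phi> (x - y) * a y = 0"
    using supp
  proof eventually_elim
    case (elim y)
    show ?case
    proof (cases "y \<in> cball c r")
      case True
      then have "t \<le> \<bar>x - y\<bar>" using far by (auto simp: dist_real_def)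
      then show ?thesis using dilation_test(3)[OF t] by simp
    qed (use elim in simp)
  qed
  then show ?thesis
    unfolding Defs.convolution_def by (rule integral_eq_zero_AE)
qed

text \<open>The atom has mean zero for \<open>gauss\<close>, so the kernel that already contains 1 /
  \<open>gdens\<close> may be replaced by its increment from the centre c. Subtracting a constant
  from the plain dilation would not cancel.\<close>

lemma conv_cancel:
  assumes t: "\<phi> \<in> test_functions" "0 < t"
  shows "norm (Defs.convolution (dilation t \<phi>) a x)
     \<le> exp 3 / gdens c * (r / t\<^sup>2 + 4 * r / (t * admissible_radius c))"
proof -
  let ?K = "exp 3 / gdens c * (r / t\<^sup>2 + 4 * r / (t * admissible_radius c))"
  have K: "0 \<le> ?K" using t r by auto
  note [measurable] = borel_measurable_kernel[OF t]
  let ?k = "\<lambda>y. indicator (cball c r) y * (kernel t \<phi> x y - kernel t \<phi> x c)"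
  have k: "?k \<in> borel_measurable borel"
    by (intro borel_measurable_times borel_measurable_diff borel_measurable_indicator
        borel_measurable_kernel[OF t] borel_measurable_const borel_closed closed_cball)
  have k': "norm (?k y) \<le> ?K" for y
  proof (cases "y \<in> cball c r")
    case True
    then show ?thesis
      using kernel_diff_le[OF t, of y c r x] r by (simp add: dist_real_def abs_minus_commute)
  qed (use K in simp)
  have "Defs.convolution (dilation t \<phi>) a x = (LINT y|gauss. kernel t \<phi> x y * a y)"
    by (rule convolution_eq[OF t measurable_a])
  also have "\<dots> = (LINT y|gauss. kernel t \<phi> x y * a y) - kernel t \<phi> x c * (LINT y|gauss. a y)"
    using mean by simp
  also have "\<dots> = (LINT y|gauss. kernel t \<phi> x y * a y - kernel t \<phi> x c * a y)"
    using integrable_bounded_mult[OF integrable _ kernel_bounded[OF t]] integrable by simp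
  also have "\<dots> = (LINT y|gauss. ?k y * a y)"
  proof (rule integral_cong_AE)
    show "AE y in gauss. kernel t \<phi> x y * a y - kernel t \<phi> x c * a y = ?k y * a y"
      using supp unfolding AE_gauss by eventually_elim (auto simp: left_diff_distrib split: split_indicator)
    show "(\<lambda>y. ?k y * a y) \<in> borel_measurable gauss" using k by simp
  qed simp
  also have "norm \<dots> \<le> ?K * (LINT y|gauss. norm (a y))"
    by (rule norm_functional_le[OF integrable k k'])
  also have "\<dots> \<le> ?K * 1"
    using norm1 K by (rule mult_left_mono)
  finally show ?thesis by simp
qed

text \<open>Near the ball the size bound of the atom is used. Away from it only scales t larger than
  the distance to the ball contribute, and cancellation gives r / t^2 plus a density term. The
  profile r / (r^2 + (x - c)^2) covers both regimes with an integrable function.\<close>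

lemma M_loc_le:
  "M_loc a x \<le> ennreal (5 * exp 3 / gdens c * (r / (r\<^sup>2 + (x - c)\<^sup>2) + 1 / admissible_radius c)
      * indicator {c - 4 * admissible_radius c..c + 4 * admissible_radius c} x)"
proof (rule M_loc_least)
  fix \<phi> t assume t: "\<phi> \<in> test_functions" "0 < t" "t < admissible_radius x"
  let ?m = "admissible_radius c" and ?D = "\<bar>x - c\<bar>"
  let ?I = "{c - 4 * ?m..c + 4 * ?m}"
  let ?b = "5 * exp 3 / gdens c * (r / (r\<^sup>2 + (x - c)\<^sup>2) + 1 / ?m)"
  let ?v = "Defs.convolution (dilation t \<phi>) a x"
  have b: "0 \<le> ?b" using r by (intro mult_nonneg_nonneg add_nonneg_nonneg divide_nonneg_nonneg; simp add: less_imp_le)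
  show "ennreal (norm ?v) \<le> ennreal (?b * indicator ?I x)"
  proof (cases "t \<le> ?D - r")
    case True
    then show ?thesis using conv_far[OF t(1,2)] b by simp
  next
    case False
    \<comment> \<open>Only t > |x - c| - r remains. A distance of at most 2 is at most 2 /
      \<open>admissible_radius x\<close>, so the two admissible radii differ at most by the factor 3
      in this direction, and |x - c| < t + r is at most 3 + 1 = 4 radii of c.\<close>
    have "?D \<le> 2" using False r t admissible_radius_le_1[of x] admissible_radius_le_1[of c] by linarith
    moreover have "2 \<le> 2 / admissible_radius x"
      using admissible_radius_le_1[of x] by (simp add: field_simps)
    ultimately have "\<bar>c - x\<bar> \<le> 2 / admissible_radius x" by linarith
    then have "admissible_radius x \<le> 3 * ?m"
      using admissible_radius_le_mult[of c x 2] by simp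
    then have "?D \<le> 4 * ?m" using False r t by linarith
    then have I: "x \<in> ?I" by auto
    have "norm ?v \<le> ?b"
    proof (cases "?D < 2 * r")
      case True
      have G: "0 < measure gauss (cball c r)"
        using measure_gauss_pos[of "c - r" "c + r"] r by (simp add: cball_eq_atLeastAtMost)
      have "ennreal (norm ?v) \<le> M_loc a x" by (rule M_loc_upper[OF t])
      also have "\<dots> \<le> ennreal (2 * (1 / measure gauss (cball c r)))"
        by (rule M_loc_le_local_bound[OF measurable_a _ bound]) simp
      finally have "norm ?v \<le> 2 / measure gauss (cball c r)"
        by (simp add: ennreal_le_iff)
      also have "\<dots> \<le> 2 / (exp (- 3) * gdens c * (2 * r))"
        using measure_ball_ge r by (intro divide_left_mono mult_pos_pos G) auto
      also have "\<dots> = exp 3 / gdens c * (1 / r)"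
        using r by (simp add: exp_minus field_simps)
      also have "\<dots> \<le> exp 3 / gdens c * (5 * (r / (r\<^sup>2 + (x - c)\<^sup>2)))"
      proof (intro mult_left_mono)
        have "(x - c)\<^sup>2 \<le> (2 * r)\<^sup>2" using True by (intro power2_le_iff_abs_le[THEN iffD2]) auto
        then have "r\<^sup>2 + (x - c)\<^sup>2 \<le> 5 * r\<^sup>2" by (simp add: power_mult_distrib)
        moreover have "0 < r\<^sup>2 + (x - c)\<^sup>2" using r by (simp add: add_pos_nonneg)
        ultimately show "1 / r \<le> 5 * (r / (r\<^sup>2 + (x - c)\<^sup>2))"
          using r by (simp add: field_simps power2_eq_square)
      qed simp
      also have "\<dots> \<le> ?b" by (simp add: algebra_simps less_imp_le)
      finally show ?thesis .
    next
      case far: False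
      \<comment> \<open>Since the ball has radius at most |x - c| / 2, every contributing scale is
        at least |x - c| / 2.\<close>
      then have D: "0 < ?D" "?D / 2 \<le> t" "2 * r \<le> ?D" using r False by auto
      have "norm ?v \<le> exp 3 / gdens c * (r / t\<^sup>2 + 4 * r / (t * ?m))"
        by (rule conv_cancel[OF t(1,2)])
      also have "\<dots> \<le> exp 3 / gdens c * (5 * (r / (r\<^sup>2 + (x - c)\<^sup>2)) + 5 * (1 / ?m))"
      proof (intro mult_left_mono add_mono)
        have sq: "(2 * r)\<^sup>2 \<le> (x - c)\<^sup>2" using D r by (intro abs_le_square_iff[THEN iffD1]) auto
        have "(?D / 2)\<^sup>2 \<le> t\<^sup>2" using D by (intro power_mono) auto
        then have "(x - c)\<^sup>2 \<le> 4 * t\<^sup>2" by (simp add: power_divide)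
        then have "r\<^sup>2 + (x - c)\<^sup>2 \<le> 5 * t\<^sup>2" using sq by (simp add: power_mult_distrib)
        moreover have "0 < r\<^sup>2 + (x - c)\<^sup>2" using r by (simp add: add_pos_nonneg)
        ultimately have "r / (5 * t\<^sup>2) \<le> r / (r\<^sup>2 + (x - c)\<^sup>2)"
          using r t by (intro divide_left_mono mult_pos_pos) auto
        then show "r / t\<^sup>2 \<le> 5 * (r / (r\<^sup>2 + (x - c)\<^sup>2))" by simp
        have "r \<le> ?D / 2" using D(3) by simp
        then have "r \<le> t" using D(2) by (rule order_trans)
        then have "4 * r * ?m \<le> 5 * t * ?m" using r by (intro mult_right_mono) auto
        then show "4 * r / (t * ?m) \<le> 5 * (1 / ?m)"
          using t by (simp add: field_simps)
      qed simp
      also have "\<dots> = ?b" by (simp add: algebra_simps)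
      finally show ?thesis .
    qed
    then show ?thesis using I by (simp add: ennreal_leI)
  qed
qed

text \<open>The profile integrates to an arctan difference, at most \<open>pi\<close> for every
  radius r. The constant term 1 / \<open>admissible_radius c\<close> over an interval of 8
  admissible radii gives 8.\<close>

lemma nn_integral_M_loc_le: "(\<integral>\<^sup>+x. M_loc a x \<partial>gauss) \<le> ennreal (5 * exp 27 * (pi + 8))"
proof -
  let ?m = "admissible_radius c"
  let ?I = "{c - 4 * ?m..c + 4 * ?m}"
  let ?g = "\<lambda>x. 5 * exp 27 * (r / (r\<^sup>2 + (x - c)\<^sup>2) + 1 / ?m)"
  let ?G = "\<lambda>x. 5 * exp 27 * (arctan ((x - c) / r) + x / ?m)"
  have [measurable]: "M_loc a \<in> borel_measurable borel" by (rule borel_measurable_M_loc[OF integrable])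
  have "(\<integral>\<^sup>+x. M_loc a x \<partial>gauss) = (\<integral>\<^sup>+x. ennreal (gdens x) * M_loc a x \<partial>lborel)"
    by (rule nn_integral_gauss) simp
  also have "\<dots> \<le> (\<integral>\<^sup>+x. ennreal (?g x) * indicator ?I x \<partial>lborel)"
  proof (rule nn_integral_mono)
    fix x
    let ?b = "5 * exp 3 / gdens c * (r / (r\<^sup>2 + (x - c)\<^sup>2) + 1 / ?m)"
    have b: "0 \<le> ?b" using r by (intro mult_nonneg_nonneg add_nonneg_nonneg divide_nonneg_nonneg; simp add: less_imp_le)
    have "ennreal (gdens x) * M_loc a x \<le> ennreal (gdens x) * ennreal (?b * indicator ?I x)"
      by (intro mult_left_mono M_loc_le) simp
    also have "\<dots> = ennreal (gdens x * ?b) * indicator ?I x"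
      using b by (auto simp: ennreal_mult[symmetric] split: split_indicator)
    also have "\<dots> \<le> ennreal (?g x) * indicator ?I x"
    proof (cases "x \<in> ?I")
      case True
      \<comment> \<open>The support reaches 4 admissible radii, so K = 4 and K * (K + 2) = 24; the
        \<open>exp 3\<close> of the kernel bound makes it 27.\<close>
      have "gdens x \<le> exp 24 * gdens c"
        using gdens_le_mult(1)[of c x 4] True by (simp add: abs_le_iff)
      then have "gdens x * ?b \<le> (exp 24 * gdens c) * ?b"
        using b by (rule mult_right_mono)
      also have "\<dots> = ?g x"
        using exp_add[of 24 "3::real"] by simp
      finally show ?thesis by (intro mult_right_mono ennreal_leI) auto
    qed simp
    finally show "ennreal (gdens x) * M_loc a x \<le> ennreal (?g x) * indicator ?I x" .
  qed
  also have "\<dots> = ennreal (?G (c + 4 * ?m) - ?G (c - 4 * ?m))"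
  proof (rule nn_integral_FTC_Icc)
    show "(?G has_real_derivative ?g x) (at x)" for x
    proof -
      have "1 + ((x - c) / r)\<^sup>2 = (r\<^sup>2 + (x - c)\<^sup>2) / r\<^sup>2"
        using r by (simp add: power_divide field_simps)
      then have "inverse (1 + ((x - c) / r)\<^sup>2) * (1 / r) = r / (r\<^sup>2 + (x - c)\<^sup>2)"
        using r by (simp add: power2_eq_square)
      moreover have "((\<lambda>x. arctan ((x - c) / r)) has_real_derivative inverse (1 + ((x - c) / r)\<^sup>2) * (1 / r)) (at x)"
        by (rule DERIV_chain2[OF DERIV_arctan]) (rule DERIV_cdivide DERIV_cong[OF DERIV_diff[OF DERIV_ident DERIV_const]] | simp)+
      ultimately have "((\<lambda>x. arctan ((x - c) / r)) has_real_derivative r / (r\<^sup>2 + (x - c)\<^sup>2)) (at x)" by simp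
      then show ?thesis
        by (intro DERIV_cmult DERIV_add DERIV_cdivide[OF DERIV_ident])
    qed
    show "0 \<le> ?g x" for x
      using r by (intro mult_nonneg_nonneg add_nonneg_nonneg divide_nonneg_nonneg; simp add: less_imp_le)
    show "c - 4 * ?m \<le> c + 4 * ?m" by (simp add: less_imp_le)
  qed simp
  also have "\<dots> \<le> ennreal (5 * exp 27 * (pi + 8))"
  proof (rule ennreal_leI)
    have "arctan (4 * ?m / r) - arctan (- (4 * ?m / r)) \<le> pi"
      using arctan_bounded[of "4 * ?m / r"] by (simp add: arctan_minus)
    moreover have "(c + 4 * ?m) / ?m - (c - 4 * ?m) / ?m = 8"
      using admissible_radius_pos[of c] by (simp add: field_simps)
    ultimately have "(arctan (4 * ?m / r) + (c + 4 * ?m) / ?m) - (arctan (- (4 * ?m / r)) + (c - 4 * ?m) / ?m) \<le> pi + 8"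
      by linarith
    then have "5 * exp 27 * ((arctan (4 * ?m / r) + (c + 4 * ?m) / ?m) - (arctan (- (4 * ?m / r)) + (c - 4 * ?m) / ?m)) \<le> 5 * exp 27 * (pi + 8)"
      by (intro mult_left_mono) auto
    then show "?G (c + 4 * ?m) - ?G (c - 4 * ?m) \<le> 5 * exp 27 * (pi + 8)"
      by (simp add: right_diff_distrib)
  qed
  finally show ?thesis .
qed

text \<open>The flag x records whether A may cut the ball. If A contains the ball the integral is
  the mean, if A misses it the integrand vanishes; otherwise only the L1 norm is available.\<close>

lemma norm_set_integral_le:
  assumes A: "A \<in> sets borel" "cball c r \<subseteq> A \<or> cball c r \<inter> A = {} \<or> x"
  shows "norm (LINT y:A|gauss. a y) \<le> of_bool x"
proof -
  have le1: "norm (LINT y:A|gauss. a y) \<le> 1"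
  proof -
    have "norm (LINT y:A|gauss. a y) = norm (LINT y|gauss. indicator A y * a y)"
      unfolding set_lebesgue_integral_def by (intro arg_cong[where f=norm] Bochner_Integration.integral_cong) (auto simp: indicator_def)
    also have "\<dots> \<le> 1 * (LINT y|gauss. norm (a y))"
      using A by (intro norm_functional_le integrable) (auto simp: indicator_def)
    finally show ?thesis using norm1 by simp
  qed
  have "(LINT y:A|gauss. a y) = 0" if "cball c r \<subseteq> A"
  proof -
    have "(LINT y:A|gauss. a y) = (LINT y|gauss. a y)"
      unfolding set_lebesgue_integral_def
    proof (rule integral_cong_AE)
      show "AE y in gauss. indicat_real A y *\<^sub>R a y = a y"
        using supp unfolding AE_gauss by eventually_elim (use that in \<open>auto split: split_indicator\<close>)
    qed (use A in auto)
    then show ?thesis using mean by simp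
  qed
  moreover have "(LINT y:A|gauss. a y) = 0" if "cball c r \<inter> A = {}"
    unfolding set_lebesgue_integral_def
  proof (rule integral_eq_zero_AE)
    show "AE y in gauss. indicat_real A y *\<^sub>R a y = 0"
      using supp unfolding AE_gauss by eventually_elim (use that in \<open>auto split: split_indicator\<close>)
  qed
  ultimately show ?thesis using A(2) le1 by auto
qed

text \<open>A tail is nonzero only when its end lies in the ball or in its reflection, two sets of
  length 2 r on which x <= |c| + r. Admissibility bounds |c| r and r^2 by 1, so 4 r (|c| + r) <=
  8.\<close>

lemma E_functional_le: "E_functional a \<le> 8"
proof -
  let ?B = "cball c r"
  have "E_functional a \<le> (\<integral>\<^sup>+x. ennreal (\<bar>c\<bar> + r) * (indicator ?B x + indicator (uminus ` ?B) x) \<partial>lborel)"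
    unfolding E_functional_eq
  proof (rule nn_integral_mono)
    fix x :: real
    have B: "?B = {c - r..c + r}" "uminus ` ?B = {- c - r..- c + r}"
      by (simp_all add: cball_eq_atLeastAtMost)
    show "ennreal (x * tails a x) * indicator {0..} x \<le> ennreal (\<bar>c\<bar> + r) * (indicator ?B x + indicator (uminus ` ?B) x)"
    proof (cases "0 \<le> x")
      case True
      have 1: "norm (LINT y:{x..}|gauss. a y) \<le> of_bool (x \<in> ?B)"
        by (rule norm_set_integral_le) (auto simp: B)
      have 2: "norm (LINT y:{..-x}|gauss. a y) \<le> of_bool (x \<in> uminus ` ?B)"
        by (rule norm_set_integral_le) (auto simp: B)
      have "x * tails a x \<le> (\<bar>c\<bar> + r) * (of_bool (x \<in> ?B) + of_bool (x \<in> uminus ` ?B))"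
      proof (cases "x \<in> ?B \<or> x \<in> uminus ` ?B")
        case in_B: True
        then have "x \<le> \<bar>c\<bar> + r" unfolding B by auto
        then show ?thesis using True 1 2 by (intro mult_mono add_mono) auto
      next
        case False
        then show ?thesis using 1 2 by simp
      qed
      then have "ennreal (x * tails a x) \<le> ennreal ((\<bar>c\<bar> + r) * (of_bool (x \<in> ?B) + of_bool (x \<in> uminus ` ?B)))"
        by (rule ennreal_leI)
      also have "\<dots> = ennreal (\<bar>c\<bar> + r) * (indicator ?B x + indicator (uminus ` ?B) x)"
        using r by (simp add: ennreal_mult indicator_def of_bool_def)
      finally show ?thesis using True by simp
    qed simp
  qed
  also have "\<dots> = ennreal (\<bar>c\<bar> + r) * (ennreal (2 * r) + ennreal (2 * r))"
  proof -
    have "(\<integral>\<^sup>+x. (indicator ?B x + indicator (uminus ` ?B) x) \<partial>lborel) = ennreal (2 * r) + ennreal (2 * r)"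
      using r by (subst nn_integral_add) (auto simp: cball_eq_atLeastAtMost)
    then show ?thesis
      using r by (subst nn_integral_cmult) (auto simp: cball_eq_atLeastAtMost)
  qed
  also have "\<dots> = ennreal (4 * (\<bar>c\<bar> * r) + 4 * (r * r))"
    using r by (simp add: ennreal_mult[symmetric] algebra_simps flip: ennreal_plus)
  also have "\<dots> \<le> ennreal 8"
  proof (rule ennreal_leI)
    have "\<bar>c\<bar> * r \<le> \<bar>c\<bar> * admissible_radius c" using r by (intro mult_left_mono) auto
    also have "\<dots> \<le> 1" by (simp add: admissible_radius_eq)
    finally have "\<bar>c\<bar> * r \<le> 1" .
    moreover have "r * r \<le> 1" using r admissible_radius_le_1[of c] by (intro mult_le_one) auto
    ultimately show "4 * (\<bar>c\<bar> * r) + 4 * (r * r) \<le> 8" by linarith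
  qed
  finally show ?thesis by simp
qed

end

lemma gauss_atom_cases:
  assumes "gauss_atom a"
  obtains "a = (\<lambda>x. 1)" | c r where "mean_zero_atom a c r"
proof (cases "a = (\<lambda>x. 1)")
  case False
  then obtain B where B: "admissible_ball B" "AE x in gauss. x \<notin> B \<longrightarrow> a x = 0" "(LINT x|gauss. a x) = 0"
    "esssup gauss (\<lambda>x. ereal (norm (a x))) \<le> ereal (1 / measure gauss B)"
    using assms by (auto simp: gauss_atom_def)
  obtain c r where c: "0 < r" "r \<le> admissible_radius c" "B = cball c r"
    using B(1) by (auto simp: admissible_ball_def)
  have bd: "AE x in gauss. norm (a x) \<le> 1 / measure gauss B"
    using esssup_AE[of "\<lambda>x. ereal (norm (a x))" gauss]
  proof eventually_elim
    case (elim x)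
    then have "ereal (norm (a x)) \<le> ereal (1 / measure gauss B)" using B(4) by (rule order_trans)
    then show ?case by simp
  qed
  have int: "integrable gauss a" using assms by (rule gauss_atom_integrable)
  have "ennreal (LINT y|gauss. norm (a y)) \<le> 1"
    using gauss_atom_nn_integral_le[OF assms] int
    by (subst nn_integral_eq_integral[symmetric]) auto
  then have "(LINT y|gauss. norm (a y)) \<le> 1" by simp
  then have "mean_zero_atom a c r"
    using B c bd int by unfold_locales (auto simp: AE_gauss)
  then show ?thesis by (rule that(2))
qed (rule that(1))

lemma gauss_atom_M_loc_le:
  assumes "gauss_atom a"
  shows "(\<integral>\<^sup>+x. M_loc a x \<partial>gauss) \<le> ennreal (5 * exp 27 * (pi + 8))"
  using assms
proof (cases rule: gauss_atom_cases)
  case 1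
  have "1 * 1 \<le> exp (27::real) * (pi + 8)"
    using pi_gt_zero by (intro mult_mono) auto
  then have "2 \<le> ennreal (5 * exp 27 * (pi + 8))" by (simp add: numeral_le_ennreal_iff)
  then show ?thesis using M_loc_1_le 1 order_trans by blast
next
  case 2
  then show ?thesis by (rule mean_zero_atom.nn_integral_M_loc_le)
qed

lemma gauss_atom_E_functional_le:
  assumes "gauss_atom a"
  shows "E_functional a \<le> 8"
  using assms
proof (cases rule: gauss_atom_cases)
  case 1
  have "E_functional a \<le> 4" unfolding 1 by (rule E_functional_1_le)
  also have "(4::ennreal) \<le> 8" by simp
  finally show ?thesis .
qed (auto intro: mean_zero_atom.E_functional_le)

definition maximal_const :: real where
  "maximal_const = 5 * exp 27 * (pi + 8) + 8"

lemma maximal_const_pos: "0 < maximal_const"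
  unfolding maximal_const_def using pi_gt_zero by (intro add_pos_pos mult_pos_pos) auto

text \<open>The direction from H1: countable subadditivity of both functionals reduces the bound to
  the uniform estimates for atoms.\<close>

lemma M_loc_E_functional_le:
  assumes f: "integrable gauss f" and ad: "atomic_decomposition f l a"
  shows "gauss_L1_norm (M_loc f) + E_functional f \<le> ennreal maximal_const * ennreal (\<Sum>j. norm (l j))"
proof -
  note D = atomic_decompositionD[OF ad]
  let ?C = "ennreal (5 * exp 27 * (pi + 8))"
  have a: "gauss_atom (a j)" for j using D(1) by simp
  have "gauss_L1_norm (M_loc f) \<le> (\<integral>\<^sup>+x. (\<Sum>j. ennreal (norm (l j)) * M_loc (a j) x) \<partial>gauss)"
    unfolding gauss_L1_norm_def by (intro nn_integral_mono M_loc_atomic_decomposition_le[OF f ad])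
  also have "\<dots> = (\<Sum>j. \<integral>\<^sup>+x. ennreal (norm (l j)) * M_loc (a j) x \<partial>gauss)"
    by (rule nn_integral_suminf) (use a in \<open>auto\<close>)
  also have "\<dots> = (\<Sum>j. ennreal (norm (l j)) * (\<integral>\<^sup>+x. M_loc (a j) x \<partial>gauss))"
    using a by (subst nn_integral_cmult) auto
  finally have "gauss_L1_norm (M_loc f) + E_functional f
      \<le> (\<Sum>j. ennreal (norm (l j)) * (\<integral>\<^sup>+x. M_loc (a j) x \<partial>gauss)) + (\<Sum>j. ennreal (norm (l j)) * E_functional (a j))"
    using E_atomic_decomposition_le[OF f ad] by (intro add_mono)
  also have "\<dots> = (\<Sum>j. ennreal (norm (l j)) * ((\<integral>\<^sup>+x. M_loc (a j) x \<partial>gauss) + E_functional (a j)))"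
    by (simp add: suminf_add distrib_left)
  also have "\<dots> \<le> (\<Sum>j. ennreal (norm (l j)) * (?C + 8))"
    using gauss_atom_M_loc_le[OF a] gauss_atom_E_functional_le[OF a]
    by (intro suminf_le mult_left_mono add_mono) auto
  also have "\<dots> = (?C + 8) * (\<Sum>j. ennreal (norm (l j)))"
    by (simp add: mult.commute)
  also have "?C + 8 = ennreal maximal_const"
    unfolding maximal_const_def using pi_gt_zero by (subst ennreal_plus) auto
  also have "(\<Sum>j. ennreal (norm (l j))) = ennreal (\<Sum>j. norm (l j))"
    using D(2) by (intro suminf_ennreal2) auto
  finally show ?thesis .
qed

section \<open>Increments of the primitive and Lebesgue points\<close>

lemma square_pos_part_remainder:
  fixes a h :: real
  shows "\<bar>(max 0 (a + h))\<^sup>2 - (max 0 a)\<^sup>2 - 2 * max 0 a * h\<bar> \<le> h\<^sup>2"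
proof -
  consider "0 \<le> a" "0 \<le> a + h" | "0 \<le> a" "a + h < 0" | "a < 0" "0 \<le> a + h" | "a < 0" "a + h < 0"
    by linarith
  then show ?thesis
  proof cases
    case 1
    then show ?thesis by (simp add: power2_eq_square algebra_simps)
  next
    case 2
    then have "0 \<le> a * (- a - 2 * h)" by (intro mult_nonneg_nonneg) auto
    moreover have "0 \<le> (a + h)\<^sup>2" by simp
    ultimately show ?thesis using 2 by (simp add: power2_eq_square algebra_simps)
  next
    case 3
    then have "(a + h)\<^sup>2 \<le> h\<^sup>2" by (intro power_mono) auto
    then show ?thesis using 3 by simp
  qed simp
qed

text \<open>The remainder of first order is at most h^2 even across the knot, so truncated squares
  are C1; splines built from them meet the smoothness demanded of test functions.\<close>

lemma DERIV_square_pos_part: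
  "((\<lambda>v::real. (max 0 (v - k))\<^sup>2) has_real_derivative 2 * max 0 (v - k)) (at v)"
  unfolding DERIV_def
proof (subst LIM_zero_iff[symmetric], rule Lim_null_comparison)
  show "\<forall>\<^sub>F h in at 0. norm (((max 0 (v + h - k))\<^sup>2 - (max 0 (v - k))\<^sup>2) / h - 2 * max 0 (v - k)) \<le> \<bar>h\<bar>"
    unfolding eventually_at_filter
  proof (intro always_eventually allI impI)
    fix h :: real assume "h \<noteq> 0"
    then have "((max 0 (v + h - k))\<^sup>2 - (max 0 (v - k))\<^sup>2) / h - 2 * max 0 (v - k)
       = ((max 0 (v - k + h))\<^sup>2 - (max 0 (v - k))\<^sup>2 - 2 * max 0 (v - k) * h) / h"
      by (simp add: field_simps)
    also have "norm \<dots> \<le> h\<^sup>2 / \<bar>h\<bar>"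
      using square_pos_part_remainder[of "v - k" h] by (simp add: divide_right_mono)
    also have "\<dots> = \<bar>h\<bar>" using \<open>h \<noteq> 0\<close> by (simp add: power2_eq_square field_simps)
    finally show "norm (((max 0 (v + h - k))\<^sup>2 - (max 0 (v - k))\<^sup>2) / h - 2 * max 0 (v - k)) \<le> \<bar>h\<bar>" .
  qed
  show "((\<lambda>h::real. \<bar>h\<bar>) \<longlongrightarrow> 0) (at 0)"
    using tendsto_rabs[OF tendsto_ident_at, of 0 UNIV] by simp
qed

text \<open>A quadratic spline that rises from 0 to 1 between 1 and 2.\<close>

definition ramp :: "real \<Rightarrow> real" where
  "ramp v = 2 * (max 0 (v - 1))\<^sup>2 - 4 * (max 0 (v - 3/2))\<^sup>2 + 2 * (max 0 (v - 2))\<^sup>2"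

definition ramp_deriv :: "real \<Rightarrow> real" where
  "ramp_deriv v = 4 * max 0 (v - 1) - 8 * max 0 (v - 3/2) + 4 * max 0 (v - 2)"

lemma DERIV_ramp: "(ramp has_real_derivative ramp_deriv v) (at v)"
  unfolding ramp_def[abs_def] ramp_deriv_def
  by (rule DERIV_cong, (rule DERIV_add DERIV_diff DERIV_cmult DERIV_square_pos_part)+) simp

lemma DERIV_ramp_affine:
  "((\<lambda>u. ramp (\<sigma> * (u - x) / s)) has_real_derivative \<sigma> * ramp_deriv (\<sigma> * (u - x) / s) / s) (at u)"
  by (rule DERIV_cong[OF DERIV_chain2[OF DERIV_ramp]],
      (rule DERIV_cdivide DERIV_cmult DERIV_diff DERIV_ident DERIV_const)+, simp)

lemma continuous_on_ramp_deriv: "continuous_on UNIV ramp_deriv"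
  unfolding ramp_deriv_def[abs_def] by (intro continuous_intros)

lemma continuous_on_ramp: "continuous_on UNIV ramp"
  unfolding ramp_def[abs_def] by (intro continuous_intros)

lemma borel_measurable_ramp [measurable]: "ramp \<in> borel_measurable borel"
  by (rule borel_measurable_continuous_onI[OF continuous_on_ramp])

lemma ramp_eq_0: "v \<le> 1 \<Longrightarrow> ramp v = 0"
  by (simp add: ramp_def)

lemma ramp_eq_1: "2 \<le> v \<Longrightarrow> ramp v = 1"
  by (simp add: ramp_def power2_eq_square algebra_simps)

lemma ramp_left: "v \<in> {1..3/2} \<Longrightarrow> ramp v = 2 * (v - 1)\<^sup>2"
  by (simp add: ramp_def)

lemma ramp_right: "v \<in> {3/2..2} \<Longrightarrow> ramp v = 1 - 2 * (2 - v)\<^sup>2"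
  by (simp add: ramp_def power2_eq_square algebra_simps)

lemma ramp_le_half: "v \<le> 3/2 \<Longrightarrow> ramp v \<le> 1/2"
proof (cases "v \<le> 1")
  case False
  assume v: "v \<le> 3/2"
  then have "(v - 1)\<^sup>2 \<le> (1/2)\<^sup>2" using False by (intro power_mono) auto
  then show ?thesis using ramp_left[of v] v False by (simp add: power2_eq_square)
qed (simp add: ramp_eq_0)

lemma ramp_bounds: "0 \<le> ramp v" "ramp v \<le> 1"
proof -
  consider "v \<le> 1" | "v \<in> {1..3/2}" | "v \<in> {3/2..2}" | "2 \<le> v" by force
  then have "0 \<le> ramp v \<and> ramp v \<le> 1"
  proof cases
    case 2
    then have "ramp v \<le> 1/2" by (intro ramp_le_half) auto
    then show ?thesis using ramp_left[OF 2] by simp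
  next
    case 3
    then have "(2 - v)\<^sup>2 \<le> (1/2)\<^sup>2" by (intro power_mono) auto
    then show ?thesis using ramp_right[OF 3] by (simp add: power2_eq_square)
  qed (auto simp: ramp_eq_0 ramp_eq_1)
  then show "0 \<le> ramp v" "ramp v \<le> 1" by auto
qed

lemma ramp_deriv_bound: "\<bar>ramp_deriv v\<bar> \<le> 2"
  unfolding ramp_deriv_def by (auto simp: max_def abs_le_iff)

text \<open>The product \<open>gdens\<close> * \<beta>, rescaled to unit size around x, is a test
  function, so \<open>M_loc\<close> controls integrals of \<beta> * f against \<open>gauss\<close>.
  The bound is L times the order of the Gauss measure of an interval of length t at x.\<close>

lemma weighted_test:
  assumes f: "integrable gauss f" and M: "M_loc f x \<le> ennreal L" "0 \<le> L"
    and der: "\<And>u. (\<beta> has_real_derivative \<beta>' u) (at u)" and cont: "continuous_on UNIV \<beta>'"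
    and b: "\<And>u. \<bar>\<beta> u\<bar> \<le> 1" "\<And>u. \<bar>\<beta>' u\<bar> \<le> K / t"
    and t: "0 < t" "t < admissible_radius x" and \<rho>: "0 < \<rho>" "\<rho> < t"
    and supp: "\<And>u. \<rho> \<le> \<bar>u - x\<bar> \<Longrightarrow> \<beta> u = 0"
  shows "norm (LINT u|gauss. of_real (\<beta> u) * f u) \<le> (4 + K) * exp 3 * gdens x * t * L"
proof -
  have K: "0 \<le> K" using b(2)[of x] t by (smt (verit) divide_neg_pos)
  define A where "A = (4 + K) * exp 3 * gdens x"
  have A: "0 < A" using K by (simp add: A_def)
  have fm [measurable]: "f \<in> borel_measurable borel" by (rule borel_measurable_integrable_gauss[OF f])
  have cont\<beta>: "continuous_on UNIV \<beta>"
    using der by (intro continuous_at_imp_continuous_on ballI) (rule DERIV_isCont)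
  have contg: "continuous_on UNIV gdens"
    by (intro continuous_at_imp_continuous_on ballI isCont_gdens)
  define \<eta> where "\<eta> u = gdens u * \<beta> u" for u
  define \<eta>' where "\<eta>' u = gdens u * (\<beta>' u - 2 * u * \<beta> u)" for u
  have d\<eta>: "(\<eta> has_real_derivative \<eta>' u) (at u)" for u
    unfolding \<eta>_def[abs_def] \<eta>'_def
    by (rule DERIV_cong[OF DERIV_mult[OF gdens_deriv der]]) (simp add: algebra_simps)
  have c\<eta>': "continuous_on UNIV \<eta>'"
    unfolding \<eta>'_def[abs_def] by (intro continuous_intros cont cont\<beta> contg)
  have \<beta>'0: "\<beta>' u = 0" if "\<rho> < \<bar>u - x\<bar>" for u
  proof (rule DERIV_unique[OF der])
    have op: "open {v. \<rho> < \<bar>v - x\<bar>}" by (intro open_Collect_less continuous_intros)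
    show "(\<beta> has_real_derivative 0) (at u)"
      by (rule has_field_derivative_transform_within_open[OF DERIV_const[of 0] op])
        (use that supp in auto)
  qed
  have near: "gdens u \<le> exp 3 * gdens x" if "\<bar>u - x\<bar> \<le> \<rho>" for u
    using gdens_near(1)[of x u] that t \<rho> by (simp add: abs_minus_commute)
  have \<eta>A: "\<bar>\<eta> u\<bar> \<le> A" for u
  proof (cases "\<rho> \<le> \<bar>u - x\<bar>")
    case True
    then show ?thesis using supp A by (simp add: \<eta>_def)
  next
    case False
    have "\<bar>\<eta> u\<bar> \<le> (exp 3 * gdens x) * 1"
      unfolding \<eta>_def abs_mult using near[of u] False b(1)[of u] by (intro mult_mono) auto
    also have "\<dots> \<le> A" unfolding A_def using K by simp
    finally show ?thesis .
  qed
  have \<eta>'A: "\<bar>\<eta>' u\<bar> \<le> A / t" for u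
  proof (cases "\<rho> < \<bar>u - x\<bar>")
    case True
    then show ?thesis using supp[of u] \<beta>'0[of u] A t by (simp add: \<eta>'_def)
  next
    case False
    \<comment> \<open>Differentiating the density produces 2 u. Here |u| <= 2 / t because t is below
      the admissible radius, which explains the 4 in 4 + K.\<close>
    have "\<bar>u\<bar> \<le> 1 + \<bar>x\<bar>" using False \<rho> t admissible_radius_le_1[of x] by linarith
    also have "\<dots> \<le> 2 / admissible_radius x"
      using admissible_radius_mult[of x] by (simp add: field_simps)
    also have "\<dots> \<le> 2 / t" using t by (intro divide_left_mono mult_pos_pos) auto
    finally have u: "\<bar>u\<bar> \<le> 2 / t" .
    have "\<bar>\<beta>' u - 2 * u * \<beta> u\<bar> \<le> \<bar>\<beta>' u\<bar> + 2 * \<bar>u\<bar> * \<bar>\<beta> u\<bar>"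
      using abs_triangle_ineq4[of "\<beta>' u" "2 * u * \<beta> u"] by (simp add: abs_mult)
    also have "\<dots> \<le> K / t + 2 * (2 / t) * 1"
      using b[of u] u t by (intro add_mono mult_mono) auto
    also have "\<dots> = (4 + K) / t" by (simp add: add_divide_distrib)
    finally have "\<bar>\<eta>' u\<bar> \<le> (exp 3 * gdens x) * ((4 + K) / t)"
      unfolding \<eta>'_def abs_mult using near[of u] False t K by (intro mult_mono) auto
    then show ?thesis by (simp add: A_def mult.commute mult.left_commute)
  qed
  \<comment> \<open>The argument x - t * v undoes the reflection in the convolution, and A makes
    both the function and its derivative at most 1. The strict \<rho> < t keeps the closed support
    inside the open unit ball.\<close>
  define \<phi> :: "real \<Rightarrow> complex" where "\<phi> v = of_real (\<eta> (x - t * v) / A)" for v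
  define \<phi>' :: "real \<Rightarrow> complex" where "\<phi>' v = of_real (- t * \<eta>' (x - t * v) / A)" for v
  have d\<phi>: "(\<phi> has_vector_derivative \<phi>' v) (at v)" for v
  proof -
    have "((\<lambda>v. x - t * v) has_real_derivative - t) (at v)"
      by (auto intro!: derivative_eq_intros)
    from DERIV_cdivide[OF DERIV_chain2[OF d\<eta> this], of A]
    have "((\<lambda>v. \<eta> (x - t * v) / A) has_vector_derivative - t * \<eta>' (x - t * v) / A) (at v)"
      by (simp add: has_real_derivative_iff_has_vector_derivative mult.commute)
    then show ?thesis
      unfolding \<phi>_def[abs_def] \<phi>'_def
      by (rule bounded_linear.has_vector_derivative[OF bounded_linear_of_real])
  qed
  have c\<phi>': "continuous_on UNIV \<phi>'"
    unfolding \<phi>'_def[abs_def] using A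
    by (intro continuous_intros continuous_on_compose2[OF c\<eta>']) auto
  have sub: "{v. \<phi> v \<noteq> 0} \<subseteq> cball 0 (\<rho> / t)"
  proof
    fix v assume "v \<in> {v. \<phi> v \<noteq> 0}"
    then have "\<beta> (x - t * v) \<noteq> 0" by (auto simp: \<phi>_def \<eta>_def)
    then have "\<bar>t * v\<bar> < \<rho>" using supp[of "x - t * v"] by (cases "\<rho> \<le> \<bar>t * v\<bar>") auto
    then show "v \<in> cball 0 (\<rho> / t)" using t by (simp add: abs_mult field_simps)
  qed
  then have cl: "closure {v. \<phi> v \<noteq> 0} \<subseteq> cball 0 (\<rho> / t)" by (intro closure_minimal) auto
  have test: "\<phi> \<in> test_functions"
    unfolding test_functions_def
  proof (intro CollectI conjI allI)
    show "\<phi> C1_differentiable_on UNIV"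
      unfolding C1_differentiable_on_def using d\<phi> c\<phi>' by auto
    show "compact (closure {v. \<phi> v \<noteq> 0})"
      using cl by (intro compact_closure[THEN iffD2] bounded_subset[OF bounded_cball sub])
    show "closure {v. \<phi> v \<noteq> 0} \<subseteq> ball 0 1"
    proof
      fix v assume "v \<in> closure {v. \<phi> v \<noteq> 0}"
      then have "\<bar>v\<bar> \<le> \<rho> / t" using cl by auto
      also have "\<dots> < 1" using \<rho> t by simp
      finally show "v \<in> ball 0 1" by simp
    qed
    show "norm (\<phi> v) \<le> 1" for v
      using \<eta>A[of "x - t * v"] A by (simp add: \<phi>_def norm_divide)
    show "norm (vector_derivative \<phi> (at v)) \<le> 1" for v
    proof -
      have "norm (\<phi>' v) = t * \<bar>\<eta>' (x - t * v)\<bar> / A"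
        unfolding \<phi>'_def using A t by (simp only: norm_of_real) (simp add: abs_mult)
      also have "\<dots> \<le> t * (A / t) / A"
        using \<eta>'A[of "x - t * v"] A t by (intro divide_right_mono mult_left_mono) auto
      finally have "norm (\<phi>' v) \<le> 1" using A t by simp
      then show ?thesis using vector_derivative_at[OF d\<phi>] by simp
    qed
  qed
  have "Defs.convolution (dilation t \<phi>) f x = (LINT y|lborel. of_real (1 / (t * A)) * (of_real (gdens y) * (of_real (\<beta> y) * f y)))"
    unfolding Defs.convolution_def
  proof (rule Bochner_Integration.integral_cong)
    fix y
    have "x - t * ((x - y) / t) = y" using t by simp
    then show "dilation t \<phi> (x - y) * f y = of_real (1 / (t * A)) * (of_real (gdens y) * (of_real (\<beta> y) * f y))"
      by (simp add: dilation_def \<phi>_def \<eta>_def scaleR_conv_of_real)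
  qed simp
  also have "\<dots> = of_real (1 / (t * A)) * (LINT y|lborel. of_real (gdens y) * (of_real (\<beta> y) * f y))"
    by simp
  also have "(LINT y|lborel. of_real (gdens y) * (of_real (\<beta> y) * f y)) = (LINT y|gauss. of_real (\<beta> y) * f y)"
  proof -
    have [measurable]: "\<beta> \<in> borel_measurable borel" by (rule borel_measurable_continuous_onI[OF cont\<beta>])
    show ?thesis by (subst integral_gauss) (auto simp: scaleR_conv_of_real)
  qed
  finally have "Defs.convolution (dilation t \<phi>) f x = of_real (1 / (t * A)) * (LINT y|gauss. of_real (\<beta> y) * f y)" .
  moreover have "norm (Defs.convolution (dilation t \<phi>) f x) \<le> L"
    using order_trans[OF M_loc_upper[OF test t, of f] M(1)] M(2) by (simp add: ennreal_le_iff)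
  ultimately have "norm (of_real (1 / (t * A)) * (LINT y|gauss. of_real (\<beta> y) * f y)) \<le> L" by simp
  then have "1 / (t * A) * norm (LINT y|gauss. of_real (\<beta> y) * f y) \<le> L"
    using A t unfolding norm_mult norm_of_real by simp
  then have "norm (LINT y|gauss. of_real (\<beta> y) * f y) \<le> A * t * L"
    using A t by (simp add: field_simps)
  then show ?thesis by (simp only: A_def)
qed

section \<open>Telescoping of cutoffs\<close>

lemma abs_diff_divide_le:
  fixes a b p q P Q :: real
  assumes "0 < a" "0 < b" "\<bar>p\<bar> \<le> P" "\<bar>q\<bar> \<le> Q"
  shows "\<bar>p / a - q / b\<bar> \<le> P / a + Q / b"
proof -
  have "\<bar>p / a - q / b\<bar> \<le> \<bar>p / a\<bar> + \<bar>q / b\<bar>" by (rule abs_triangle_ineq4)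
  also have "\<dots> = \<bar>p\<bar> / a + \<bar>q\<bar> / b" using assms by simp
  also have "\<dots> \<le> P / a + Q / b" using assms by (intro add_mono divide_right_mono) auto
  finally show ?thesis .
qed

text \<open>The difference of the cutoffs at scales s / 2 and s lives within 2 s of x, on the side
  chosen by the sign \<sigma>. With t = 3 s its slope 6 / s is 18 / t, and (4 + 18) * 3 =
  66.\<close>

lemma bump_le:
  assumes f: "integrable gauss f" and M: "M_loc f x \<le> ennreal L" "0 \<le> L"
    and s: "0 < s" "3 * s < admissible_radius x" and \<sigma>: "\<bar>\<sigma>\<bar> = 1"
  shows "norm (LINT u|gauss. of_real (ramp (\<sigma> * (u - x) / (s / 2)) - ramp (\<sigma> * (u - x) / s)) * f u)
    \<le> 66 * exp 3 * gdens x * s * L"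
proof -
  let ?v = "\<lambda>u. \<sigma> * (u - x)"
  let ?b' = "\<lambda>u. \<sigma> * ramp_deriv (?v u / (s / 2)) / (s / 2) - \<sigma> * ramp_deriv (?v u / s) / s"
  have "norm (LINT u|gauss. of_real (ramp (?v u / (s / 2)) - ramp (?v u / s)) * f u) \<le> (4 + 18) * exp 3 * gdens x * (3 * s) * L"
  proof (rule weighted_test[OF f M, where \<beta>' = ?b' and \<rho> = "2 * s"])
    fix u
    show "((\<lambda>u. ramp (?v u / (s / 2)) - ramp (?v u / s)) has_real_derivative ?b' u) (at u)"
      by (intro DERIV_diff DERIV_ramp_affine)
    show "continuous_on UNIV ?b'"
      using s by (intro continuous_intros continuous_on_compose2[OF continuous_on_ramp_deriv]) auto
    show "\<bar>ramp (?v u / (s / 2)) - ramp (?v u / s)\<bar> \<le> 1"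
      using ramp_bounds[of "?v u / (s / 2)"] ramp_bounds[of "?v u / s"] by linarith
    have "\<bar>\<sigma> * ramp_deriv w\<bar> \<le> 2" for w
      using \<sigma> ramp_deriv_bound[of w] by (simp add: abs_mult)
    then have "\<bar>?b' u\<bar> \<le> 2 / (s / 2) + 2 / s"
      using s by (intro abs_diff_divide_le) auto
    then show "\<bar>?b' u\<bar> \<le> 18 / (3 * s)" by simp
    assume "2 * s \<le> \<bar>u - x\<bar>"
    then have far: "2 * s \<le> \<bar>?v u\<bar>" using \<sigma> by (simp add: abs_mult)
    show "ramp (?v u / (s / 2)) - ramp (?v u / s) = 0"
    proof (cases "0 \<le> ?v u")
      case True
      then have "2 * s \<le> ?v u" using far by simp
      then have "2 \<le> ?v u / s" "2 \<le> ?v u / (s / 2)" using s by (simp_all add: le_divide_eq)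
      then show ?thesis by (simp only: ramp_eq_1)
    next
      case False
      then have "?v u / s \<le> 0" "?v u / (s / 2) \<le> 0" using s by (auto intro!: divide_nonpos_pos)
      then have "?v u / s \<le> 1" "?v u / (s / 2) \<le> 1" by linarith+
      then show ?thesis by (simp only: ramp_eq_0)
    qed
  qed (use s in auto)
  then show ?thesis by simp
qed

lemma bump_right:
  assumes "integrable gauss f" "M_loc f x \<le> ennreal L" "0 \<le> L" "0 < s" "3 * s < admissible_radius x"
  shows "norm (LINT u|gauss. of_real (ramp ((u - x) / (s / 2)) - ramp ((u - x) / s)) * f u) \<le> 66 * exp 3 * gdens x * s * L"
  using bump_le[OF assms, of 1] by simp

lemma bump_left:
  assumes "integrable gauss f" "M_loc f x \<le> ennreal L" "0 \<le> L" "0 < s" "3 * s < admissible_radius x"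
  shows "norm (LINT u|gauss. of_real (ramp ((x - u) / (s / 2)) - ramp ((x - u) / s)) * f u) \<le> 66 * exp 3 * gdens x * s * L"
  using bump_le[OF assms, of "-1"] by simp

text \<open>For small \<open>s\<close> this is a \<open>C\<^sup>1\<close> approximation of the indicator function of the interval from \<open>x\<close> to \<open>y\<close>.\<close>

definition plateau :: "real \<Rightarrow> real \<Rightarrow> real \<Rightarrow> real \<Rightarrow> real" where
  "plateau x y s u = ramp ((u - x) / s) + ramp ((y - u) / s) - 1"

lemma borel_measurable_plateau [measurable]: "plateau x y s \<in> borel_measurable borel"
  unfolding plateau_def[abs_def] by measurable

lemma plateau_bound: "\<bar>plateau x y s u\<bar> \<le> 1"
  using ramp_bounds[of "(u - x) / s"] ramp_bounds[of "(y - u) / s"] unfolding plateau_def by linarith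

text \<open>At the coarsest scale, a quarter of the interval, the whole plateau is a single test
  function at x: slope 16 / (y - x) with t = y - x, whence 4 + 16 = 20.\<close>

lemma plateau_start:
  assumes f: "integrable gauss f" and M: "M_loc f x \<le> ennreal L" "0 \<le> L"
    and xy: "x < y" "y - x < admissible_radius x"
  shows "norm (LINT u|gauss. of_real (plateau x y ((y - x) / 4) u) * f u) \<le> 20 * exp 3 * gdens x * (y - x) * L"
proof -
  let ?d = "y - x"
  let ?s = "?d / 4"
  let ?b' = "\<lambda>u. ramp_deriv ((u - x) / ?s) / ?s + - ramp_deriv ((y - u) / ?s) / ?s - 0"
  have d: "0 < ?d" using xy by simp
  have "norm (LINT u|gauss. of_real (plateau x y ?s u) * f u) \<le> (4 + 16) * exp 3 * gdens x * ?d * L"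
    unfolding plateau_def
  proof (rule weighted_test[OF f M, where \<beta>' = ?b' and \<rho> = "3 / 4 * ?d"])
    fix u
    show "((\<lambda>u. ramp ((u - x) / ?s) + ramp ((y - u) / ?s) - 1) has_real_derivative ?b' u) (at u)"
      using DERIV_ramp_affine[of 1 x ?s u] DERIV_ramp_affine[of "-1" y ?s u]
      by (intro DERIV_diff DERIV_add DERIV_const) simp_all
    show "continuous_on UNIV ?b'"
      using d by (intro continuous_intros continuous_on_compose2[OF continuous_on_ramp_deriv]) auto
    show "\<bar>ramp ((u - x) / ?s) + ramp ((y - u) / ?s) - 1\<bar> \<le> 1"
      using plateau_bound by (simp add: plateau_def)
    have "?b' u = ramp_deriv ((u - x) / ?s) / ?s - ramp_deriv ((y - u) / ?s) / ?s"
      by simp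
    also have "\<bar>\<dots>\<bar> \<le> 2 / ?s + 2 / ?s"
      using d by (intro abs_diff_divide_le ramp_deriv_bound) auto
    finally show "\<bar>?b' u\<bar> \<le> 16 / ?d" by simp
    assume far: "3 / 4 * ?d \<le> \<bar>u - x\<bar>"
    show "ramp ((u - x) / ?s) + ramp ((y - u) / ?s) - 1 = 0"
    proof (cases "x \<le> u")
      case True
      then have "2 \<le> (u - x) / ?s" "(y - u) / ?s \<le> 1" using far d by (auto simp: field_simps)
      then show ?thesis by (simp only: ramp_eq_1 ramp_eq_0)
    next
      case False
      then have "(u - x) / ?s \<le> 1" "2 \<le> (y - u) / ?s" using far d by (auto simp: field_simps)
      then show ?thesis by (simp only: ramp_eq_1 ramp_eq_0)
    qed
  qed (use d xy in auto)
  then show ?thesis by simp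
qed

lemma plateau_tendsto:
  assumes "x < y"
  shows "(\<lambda>n. plateau x y ((y - x) / 4 / 2 ^ n) u) \<longlonglongrightarrow> indicator {x<..<y} u"
proof -
  have ev: "\<forall>\<^sub>F n in sequentially. 2 \<le> z / ((y - x) / 4 / 2 ^ n)" if "0 < z" for z
  proof -
    have "(\<lambda>n. (y - x) / 4 / 2 ^ n) \<longlonglongrightarrow> 0"
      by (rule LIMSEQ_divide_realpow_zero) simp
    then have "\<forall>\<^sub>F n in sequentially. (y - x) / 4 / 2 ^ n < z / 2"
      using that by (intro order_tendstoD(2)[where y=0]) auto
    then show ?thesis
      by eventually_elim (use \<open>x < y\<close> in \<open>simp add: field_simps\<close>)
  qed
  have neg: "ramp (z / ((y - x) / 4 / 2 ^ n)) = 0" if "z \<le> 0" for z n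
  proof -
    have "z / ((y - x) / 4 / 2 ^ n) \<le> 0" using that \<open>x < y\<close> by (intro divide_nonpos_pos) auto
    then show ?thesis by (intro ramp_eq_0) linarith
  qed
  have R: "(\<lambda>n. ramp (z / ((y - x) / 4 / 2 ^ n))) \<longlonglongrightarrow> of_bool (0 < z)" for z
  proof (cases "0 < z")
    case True
    have "\<forall>\<^sub>F n in sequentially. ramp (z / ((y - x) / 4 / 2 ^ n)) = of_bool (0 < z)"
      using ev[OF True] by eventually_elim (simp only: ramp_eq_1 True of_bool_eq)
    then show ?thesis by (rule tendsto_eventually)
  next
    case False
    then show ?thesis using neg[of z] by simp
  qed
  have "(\<lambda>n. plateau x y ((y - x) / 4 / 2 ^ n) u) \<longlonglongrightarrow> of_bool (0 < u - x) + of_bool (0 < y - u) - 1"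
    unfolding plateau_def by (intro tendsto_diff tendsto_add R tendsto_const)
  also have "of_bool (0 < u - x) + of_bool (0 < y - u) - 1 = (indicator {x<..<y} u :: real)"
    using \<open>x < y\<close> by (auto split: split_indicator)
  finally show ?thesis .
qed

text \<open>The indicator function is the coarsest plateau plus bumps at scales halved each time.
  The bump bounds form a geometric series in the scale, so the sum is of the order of the length,
  and \<open>M_loc\<close> is needed only at the two ends.\<close>

lemma norm_increment_le:
  assumes f: "integrable gauss f" and L: "0 \<le> L" "M_loc f x \<le> ennreal L" "M_loc f y \<le> ennreal L"
    and xy: "x < y" "y - x < admissible_radius x" "y - x < admissible_radius y"
  shows "norm (LINT u:{x..y}|gauss. f u) \<le> 86 * exp 9 * L * measure gauss {x..y}"
proof -
  have fm [measurable]: "f \<in> borel_measurable borel" by (rule borel_measurable_integrable_gauss[OF f])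
  let ?d = "y - x"
  define s where "s n = ?d / 4 / 2 ^ n" for n :: nat
  let ?T = "\<lambda>n. LINT u|gauss. of_real (plateau x y (s n) u) * f u"
  let ?C = "66 * exp 3 * (gdens x + gdens y) * L"
  have d: "0 < ?d" using xy by simp
  have s0: "0 < s n" "s (Suc n) = s n / 2" for n using d by (simp_all add: s_def)
  have s_le: "s n \<le> ?d / 4" for n
  proof -
    have "?d / 4 / 2 ^ n \<le> ?d / 4 / 1" using d by (intro divide_left_mono) auto
    then show ?thesis by (simp add: s_def)
  qed
  have int: "integrable gauss (\<lambda>u. of_real (b u) * f u)" if "b \<in> borel_measurable borel" "\<And>u. \<bar>b u\<bar> \<le> 1" for b
    using that by (intro integrable_bounded_mult[OF f, where K=1]) auto
  \<comment> \<open>Both ends enter \<open>plateau\<close> additively, so halving s changes it by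
    one bump at x and one at y.\<close>
  have step: "norm (?T (Suc n) - ?T n) \<le> ?C * s n" for n
  proof -
    let ?r = "\<lambda>u. ramp ((u - x) / (s n / 2)) - ramp ((u - x) / s n)"
    let ?l = "\<lambda>u. ramp ((y - u) / (s n / 2)) - ramp ((y - u) / s n)"
    have bd: "\<bar>?r u\<bar> \<le> 1" "\<bar>?l u\<bar> \<le> 1" for u
      using ramp_bounds[of "(u - x) / (s n / 2)"] ramp_bounds[of "(u - x) / s n"]
        ramp_bounds[of "(y - u) / (s n / 2)"] ramp_bounds[of "(y - u) / s n"] by linarith+
    have "?T (Suc n) - ?T n = (LINT u|gauss. of_real (plateau x y (s (Suc n)) u) * f u - of_real (plateau x y (s n) u) * f u)"
      by (intro Bochner_Integration.integral_diff[symmetric] int plateau_bound) measurable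
    also have "\<dots> = (LINT u|gauss. of_real (?r u) * f u + of_real (?l u) * f u)"
      by (intro Bochner_Integration.integral_cong) (auto simp: plateau_def s0 algebra_simps)
    also have "\<dots> = (LINT u|gauss. of_real (?r u) * f u) + (LINT u|gauss. of_real (?l u) * f u)"
      by (intro Bochner_Integration.integral_add int bd) measurable
    also have "norm \<dots> \<le> 66 * exp 3 * gdens x * s n * L + 66 * exp 3 * gdens y * s n * L"
      using s_le[of n] s0[of n] xy by (intro norm_triangle_mono bump_right bump_left f L) auto
    finally show ?thesis by (simp add: algebra_simps)
  qed
  have partial: "norm (?T n) \<le> 20 * exp 3 * gdens x * ?d * L + ?C * (?d / 2 * (1 - 1 / 2 ^ n))" for n
  proof (induction n)
    case 0
    show ?case using plateau_start[OF f L(2,1) xy(1,2)] by (simp add: s_def)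
  next
    case (Suc n)
    have "norm (?T (Suc n)) \<le> norm (?T n) + norm (?T (Suc n) - ?T n)"
      using norm_triangle_sub by blast
    also have "\<dots> \<le> (20 * exp 3 * gdens x * ?d * L + ?C * (?d / 2 * (1 - 1 / 2 ^ n))) + ?C * s n"
      by (rule add_mono[OF Suc step])
    also have "\<dots> = 20 * exp 3 * gdens x * ?d * L + ?C * (?d / 2 * (1 - 1 / 2 ^ n) + s n)"
      by (simp only: distrib_left add.assoc)
    also have "?d / 2 * (1 - 1 / 2 ^ n) + s n = ?d / 2 * (1 - 1 / 2 ^ Suc n)"
      by (simp add: s_def field_simps)
    finally show ?case .
  qed
  have lim: "?T \<longlonglongrightarrow> (LINT u|gauss. of_real (indicator {x<..<y} u) * f u)"
  proof (rule integral_dominated_convergence[where w="\<lambda>u. norm (f u)"])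
    show "AE u in gauss. (\<lambda>n. of_real (plateau x y (s n) u) * f u) \<longlonglongrightarrow> of_real (indicator {x<..<y} u) * f u"
      unfolding s_def using plateau_tendsto[OF xy(1)]
      by (intro always_eventually allI tendsto_mult tendsto_of_real tendsto_const)
    show "AE u in gauss. norm (of_real (plateau x y (s n) u) * f u) \<le> norm (f u)" for n
      using plateau_bound mult_right_mono[of _ 1 "norm (f _)"] by (intro always_eventually allI) (simp add: norm_mult)
    show "integrable gauss (\<lambda>u. norm (f u))" using f by simp
  qed simp_all
  have "norm (LINT u|gauss. of_real (indicator {x<..<y} u) * f u) \<le> 20 * exp 3 * gdens x * ?d * L + ?C * (?d / 2)"
  proof (rule LIMSEQ_le_const2[OF tendsto_norm[OF lim]], intro exI allI impI)
    fix n :: nat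
    have "?C * (?d / 2 * (1 - 1 / 2 ^ n)) \<le> ?C * (?d / 2)"
      using d L by (intro mult_left_mono) (auto simp: mult_le_cancel_left1 less_imp_le)
    then show "norm (?T n) \<le> 20 * exp 3 * gdens x * ?d * L + ?C * (?d / 2)"
      using partial[of n] by linarith
  qed
  \<comment> \<open>The scales sum to half the length, so each end receives 66 / 2 = 33, and x also
    the starting 20; in total 86.\<close>
  also have "\<dots> = exp 3 * ?d * L * (53 * gdens x + 33 * gdens y)" by (simp add: field_simps)
  also have "\<dots> \<le> exp 3 * ?d * L * (53 * (exp 3 * gdens x) + 33 * (exp 3 * gdens x))"
  proof (intro mult_left_mono add_mono)
    show "gdens y \<le> exp 3 * gdens x" using xy by (intro gdens_near(1)) auto
  qed (use d L in auto)
  also have "\<dots> = 86 * exp 9 * L * (exp (-3) * gdens x * ?d)"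
  proof -
    \<comment> \<open>Three factors \<open>exp 3\<close> meet in \<open>exp 9\<close>: from the test
      function, from comparing the densities at the ends, and from passing to the Gauss
      measure.\<close>
    have "exp 3 * exp 3 = exp 9 * exp (- 3 :: real)" by (simp flip: exp_add)
    then show ?thesis by algebra
  qed
  also have "\<dots> \<le> 86 * exp 9 * L * measure gauss {x..y}"
    using xy L by (intro mult_left_mono measure_gauss_interval(2)) auto
  also have "(LINT u|gauss. of_real (indicator {x<..<y} u) * f u) = (LINT u:{x..y}|gauss. f u)"
    unfolding set_lebesgue_integral_def
  proof (rule integral_cong_AE)
    have "AE u in lborel. u \<noteq> x" "AE u in lborel. u \<noteq> y" by (rule AE_lborel_singleton)+
    then show "AE u in gauss. of_real (indicator {x<..<y} u) * f u = indicator {x..y} u *\<^sub>R f u"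
      unfolding AE_gauss by eventually_elim (auto split: split_indicator)
  qed simp_all
  finally show ?thesis .
qed

text \<open>Differentiation of the integral is applied to |g - q| for the q of a countable dense
  set; a q close to g x then transfers the estimate to g x itself.\<close>

lemma AE_lebesgue_point:
  fixes g :: "real \<Rightarrow> complex"
  assumes g: "\<And>a b. set_integrable lborel {a..b} g"
  shows "AE x in lborel. \<forall>e>0. \<exists>d>0. \<forall>h. 0 < h \<and> h < d \<longrightarrow>
    (LINT u:{x..x + h}|lborel. norm (g u - g x)) \<le> e * h"
proof -
  have ci: "set_integrable lborel {a..b} (\<lambda>u. q)" for a b :: real and q :: complex
    unfolding set_integrable_def
    by (intro integrable_scaleR_left) (simp add: integrable_indicator_iff emeasure_lborel_Icc_eq)
  have int: "set_integrable lborel {a..b} (\<lambda>u. norm (g u - q))" for a b q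
    by (intro set_integrable_norm set_integral_diff(1) g ci)
  have pt: "AE x in lborel. \<forall>e>0. \<exists>d>0. \<forall>h. 0 < h \<and> h < d \<longrightarrow>
    (LINT u:{x..x + h}|lborel. norm (g u - q)) \<le> (norm (g x - q) + e) * h" for q
  proof -
    have io: "(\<lambda>u. norm (g u - q)) integrable_on cbox a b" for a b
      using set_borel_integral_eq_integral(1)[OF int] by simp
    show ?thesis
    proof (rule integrable_ccontinuous_explicit[OF io])
      fix N assume N: "negligible N" and leb: "\<And>x e. x \<notin> N \<Longrightarrow> 0 < e \<Longrightarrow>
        \<exists>d>0. \<forall>h. 0 < h \<and> h < d \<longrightarrow>
          norm (integral (cbox x (x + h *\<^sub>R One)) (\<lambda>u. norm (g u - q)) /\<^sub>R h ^ DIM(real) - norm (g x - q)) < e"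
      have "AE x in lebesgue. x \<notin> N"
        using N by (simp add: AE_not_in negligible_iff_null_sets)
      then have "AE x in lborel. x \<notin> N" by (simp add: AE_completion_iff)
      then show ?thesis
      proof eventually_elim
        case (elim x)
        show ?case
        proof (intro allI impI)
          fix e :: real assume "0 < e"
          from leb[OF elim this] obtain d where d: "0 < d" and
            le: "\<And>h. 0 < h \<Longrightarrow> h < d \<Longrightarrow> \<bar>integral {x..x + h} (\<lambda>u. norm (g u - q)) / h - norm (g x - q)\<bar> < e"
            by (auto simp: divide_inverse mult.commute)
          have "(LINT u:{x..x + h}|lborel. norm (g u - q)) \<le> (norm (g x - q) + e) * h" if h: "0 < h" "h < d" for h
          proof -
            have "(LINT u:{x..x + h}|lborel. norm (g u - q)) / h \<le> norm (g x - q) + e"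
              using le[OF h] by (simp add: set_borel_integral_eq_integral(2)[OF int])
            then show ?thesis using h by (simp add: field_simps)
          qed
          with d show "\<exists>d>0. \<forall>h. 0 < h \<and> h < d \<longrightarrow>
              (LINT u:{x..x + h}|lborel. norm (g u - q)) \<le> (norm (g x - q) + e) * h" by blast
        qed
      qed
    qed
  qed
  obtain Q :: "complex set" where Q: "countable Q" "\<And>X. open X \<Longrightarrow> X \<noteq> {} \<Longrightarrow> \<exists>q\<in>Q. q \<in> X"
    using countable_dense_exists by blast
  have "AE x in lborel. \<forall>q\<in>Q. \<forall>e>0. \<exists>d>0. \<forall>h. 0 < h \<and> h < d \<longrightarrow>
    (LINT u:{x..x + h}|lborel. norm (g u - q)) \<le> (norm (g x - q) + e) * h"
    using pt by (subst AE_ball_countable[OF Q(1)]) auto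
  then show ?thesis
  proof eventually_elim
    case (elim x)
    show ?case
    proof (intro allI impI)
      fix e :: real assume e: "0 < e"
      obtain q where q: "q \<in> Q" "q \<in> ball (g x) (e / 4)"
        using Q(2)[of "ball (g x) (e / 4)"] e by auto
      then have nq: "norm (g x - q) \<le> e / 4" by (simp add: dist_norm)
      have "0 < e / 4" using e by simp
      from elim[rule_format, OF q(1) this] obtain d where d: "0 < d" and
        le: "\<And>h. 0 < h \<Longrightarrow> h < d \<Longrightarrow> (LINT u:{x..x + h}|lborel. norm (g u - q)) \<le> (norm (g x - q) + e / 4) * h"
        by auto
      have "(LINT u:{x..x + h}|lborel. norm (g u - g x)) \<le> e * h" if h: "0 < h" "h < d" for h
      proof -
        have ci': "set_integrable lborel {x..x + h} (\<lambda>u. norm (g x - q))"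
          unfolding set_integrable_def by (simp add: integrable_indicator_iff emeasure_lborel_Icc_eq)
        have "(LINT u:{x..x + h}|lborel. norm (g u - g x))
           \<le> (LINT u:{x..x + h}|lborel. norm (g u - q) + norm (g x - q))"
        proof (rule set_integral_mono)
          show "norm (g u - g x) \<le> norm (g u - q) + norm (g x - q)" for u
            using norm_triangle_ineq4[of "g u - q" "g x - q"] by simp
          show "set_integrable lborel {x..x + h} (\<lambda>u. norm (g u - q) + norm (g x - q))"
            by (rule set_integral_add(1)[OF int ci'])
        qed (rule int)
        also have "\<dots> = (LINT u:{x..x + h}|lborel. norm (g u - q)) + (LINT u:{x..x + h}|lborel. norm (g x - q))"
          by (rule set_integral_add(2)[OF int ci'])
        also have "(LINT u:{x..x + h}|lborel. norm (g x - q)) = norm (g x - q) * h"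
          using h by (simp add: set_lebesgue_integral_def)
        also have "(LINT u:{x..x + h}|lborel. norm (g u - q)) + norm (g x - q) * h
           \<le> (norm (g x - q) + e / 4) * h + norm (g x - q) * h"
          using le[OF h] by simp
        also have "\<dots> = (2 * norm (g x - q) + e / 4) * h" by (simp add: algebra_simps)
        also have "\<dots> \<le> e * h"
        proof (rule mult_right_mono)
          show "2 * norm (g x - q) + e / 4 \<le> e" using nq e by linarith
        qed (use h in simp)
        finally show ?thesis .
      qed
      with d show "\<exists>d>0. \<forall>h. 0 < h \<and> h < d \<longrightarrow> (LINT u:{x..x + h}|lborel. norm (g u - g x)) \<le> e * h"
        by blast
    qed
  qed
qed

text \<open>On [x + s, x + 3/2 s] the finer cutoff has reached 1 while the coarser is still at most
  1/2, which gives half of s / 2. The finer cutoff is 1 before the coarser leaves 0, so the bump is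
  nonnegative.\<close>

lemma integral_bump_ge:
  assumes s: "0 < s"
  shows "s / 4 \<le> (LINT u|lborel. ramp ((u - x) / (s / 2)) - ramp ((u - x) / s))" (is "_ \<le> integral\<^sup>L _ ?b")
    and "integrable lborel (\<lambda>u. ramp ((u - x) / (s / 2)) - ramp ((u - x) / s))"
    and "0 \<le> ramp ((u - x) / (s / 2)) - ramp ((u - x) / s)"
    and "ramp ((u - x) / (s / 2)) - ramp ((u - x) / s) \<le> indicator {x..x + 2 * s} u"
proof -
  have nn: "0 \<le> ?b u" for u
  proof (cases "(u - x) / s \<le> 1")
    case True
    then show ?thesis using ramp_bounds by (simp add: ramp_eq_0)
  next
    case False
    then have "2 \<le> (u - x) / (s / 2)" using s by (simp add: field_simps)
    then show ?thesis using ramp_bounds by (simp add: ramp_eq_1)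
  qed
  have le: "?b u \<le> indicator {x..x + 2 * s} u" for u
  proof (cases "u \<in> {x..x + 2 * s}")
    case True
    then show ?thesis using ramp_bounds[of "(u - x) / (s / 2)"] ramp_bounds[of "(u - x) / s"] by simp
  next
    case False
    then consider "(u - x) / s \<le> 1 \<and> (u - x) / (s / 2) \<le> 1" | "2 \<le> (u - x) / s \<and> 2 \<le> (u - x) / (s / 2)"
      using s by (force simp: field_simps)
    then have "?b u = 0" by cases (simp_all only: ramp_eq_0 ramp_eq_1)
    then show ?thesis by simp
  qed
  have ge: "1 / 2 * indicator {x + s..x + 3 / 2 * s} u \<le> ?b u" for u
  proof (cases "u \<in> {x + s..x + 3 / 2 * s}")
    case True
    then have "2 \<le> (u - x) / (s / 2)" "(u - x) / s \<le> 3 / 2" using s by (auto simp: field_simps)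
    then have "ramp ((u - x) / (s / 2)) = 1" "ramp ((u - x) / s) \<le> 1 / 2"
      by (simp_all only: ramp_eq_1 ramp_le_half)
    then show ?thesis using True by simp
  qed (use nn in simp)
  have int: "integrable lborel ?b"
  proof (rule Bochner_Integration.integrable_bound)
    show "integrable lborel (\<lambda>u. indicator {x..x + 2 * s} u :: real)"
      by (simp add: integrable_indicator_iff emeasure_lborel_Icc_eq)
    show "AE u in lborel. norm (?b u) \<le> norm (indicator {x..x + 2 * s} u :: real)"
      using nn le by (intro always_eventually allI) simp
  qed measurable
  have "s / 4 = (LINT u|lborel. 1 / 2 * indicator {x + s..x + 3 / 2 * s} u)"
    using s by simp
  also have "\<dots> \<le> (LINT u|lborel. ?b u)"
    by (intro integral_mono int ge) (simp add: integrable_indicator_iff emeasure_lborel_Icc_eq)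
  finally show "s / 4 \<le> (LINT u|lborel. ?b u)" .
  show "integrable lborel ?b" by (rule int)
  show "0 \<le> ?b u" "?b u \<le> indicator {x..x + 2 * s} u" by (rule nn le)+
qed

text \<open>At a Lebesgue point of \<open>gdens\<close> * f the bump recovers the value up to a
  small error. Dividing the bump bound 66 s by its mass s / 4 gives 264.\<close>

lemma AE_norm_le_M_loc:
  assumes f: "integrable gauss f"
  shows "AE x in lborel. ennreal (norm (f x)) \<le> ennreal (264 * exp 3) * M_loc f x"
proof -
  have fm [measurable]: "f \<in> borel_measurable borel" by (rule borel_measurable_integrable_gauss[OF f])
  define g where "g u = gdens u *\<^sub>R f u" for u
  have gi: "integrable lborel g" unfolding g_def[abs_def] using f by (simp add: integrable_gauss_iff)
  have gs: "set_integrable lborel {a..b} g" for a b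
    unfolding set_integrable_def by (rule integrable_mult_indicator[OF _ gi]) simp
  from AE_lebesgue_point[OF gs]
  show ?thesis
  proof eventually_elim
    case (elim x)
    show ?case
    proof (cases "M_loc f x = top")
      case True
      then show ?thesis by (simp add: ennreal_mult_top)
    next
      case False
      define L where "L = enn2real (M_loc f x)"
      have L: "M_loc f x = ennreal L" "0 \<le> L" using False by (simp_all add: L_def less_top)
      have "norm (g x) \<le> 264 * exp 3 * gdens x * L + \<epsilon>" if \<epsilon>: "0 < \<epsilon>" for \<epsilon>
      proof -
        have "0 < \<epsilon> / 8" using \<epsilon> by simp
        from elim[rule_format, OF this] obtain d where d: "0 < d" and leb: "\<And>h. 0 < h \<Longrightarrow> h < d \<Longrightarrow>
            (LINT u:{x..x + h}|lborel. norm (g u - g x)) \<le> \<epsilon> / 8 * h"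
          by auto
        define s where "s = min (d / 4) (admissible_radius x / 4)"
        have s: "0 < s" "2 * s < d" "3 * s < admissible_radius x"
        proof -
          show "0 < s" using d by (simp add: s_def)
          have "s \<le> d / 4" "s \<le> admissible_radius x / 4" by (simp_all add: s_def)
          then show "2 * s < d" "3 * s < admissible_radius x"
            using d admissible_radius_pos[of x] by linarith+
        qed
        let ?b = "\<lambda>u. ramp ((u - x) / (s / 2)) - ramp ((u - x) / s)"
        note b = integral_bump_ge[OF s(1), where x = x]
        have big: "integrable lborel (\<lambda>u. of_real (?b u) * g u)"
        proof (rule Bochner_Integration.integrable_bound[OF gi])
          show "AE u in lborel. norm (of_real (?b u) * g u) \<le> norm (g u)"
          proof (intro always_eventually allI)
            fix u
            have "norm (of_real (?b u) :: complex) \<le> 1"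
            proof -
              have "?b u \<le> 1" using b(4)[of u] by (rule order_trans) (simp add: indicator_def)
              then show ?thesis using b(3)[of u] by (simp only: norm_of_real abs_of_nonneg)
            qed
            then show "norm (of_real (?b u) * g u) \<le> norm (g u)"
              unfolding norm_mult using mult_right_mono[of _ 1 "norm (g u)"] by simp
          qed
          have "g \<in> borel_measurable lborel" using gi by simp
          then show "(\<lambda>u. of_real (?b u) * g u) \<in> borel_measurable lborel" by measurable
        qed
        have bgx: "integrable lborel (\<lambda>u. of_real (?b u) * g x)"
          using b(2) by (intro integrable_mult_left integrable_of_real)
        have small: "(LINT u|lborel. norm (of_real (?b u) * g x - of_real (?b u) * g u)) \<le> \<epsilon> / 8 * (2 * s)"
        proof -
          have ind: "integrable lborel (\<lambda>u. indicator {x..x + 2 * s} u *\<^sub>R norm (g u - g x))"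
          proof -
            have "set_integrable lborel {x..x + 2 * s} (\<lambda>u. g u - g x)"
              by (intro set_integral_diff(1) gs)
                (simp add: set_integrable_def integrable_indicator_iff emeasure_lborel_Icc_eq)
            then have "set_integrable lborel {x..x + 2 * s} (\<lambda>u. norm (g u - g x))"
              by (rule set_integrable_norm)
            then show ?thesis unfolding set_integrable_def .
          qed
          have "(LINT u|lborel. norm (of_real (?b u) * g x - of_real (?b u) * g u))
             \<le> (LINT u|lborel. indicator {x..x + 2 * s} u *\<^sub>R norm (g u - g x))"
          proof (rule integral_mono)
            show "integrable lborel (\<lambda>u. norm (of_real (?b u) * g x - of_real (?b u) * g u))"
              by (intro integrable_norm Bochner_Integration.integrable_diff big bgx)
            fix u
            have "norm (of_real (?b u) * g x - of_real (?b u) * g u) = ?b u * norm (g u - g x)"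
              using b(3)[of u] by (simp only: right_diff_distrib[symmetric] norm_mult norm_of_real abs_of_nonneg norm_minus_commute)
            also have "\<dots> \<le> indicator {x..x + 2 * s} u * norm (g u - g x)"
              by (intro mult_right_mono b(4)) simp
            finally show "norm (of_real (?b u) * g x - of_real (?b u) * g u) \<le> indicator {x..x + 2 * s} u *\<^sub>R norm (g u - g x)"
              by simp
          qed (rule ind)
          also have "\<dots> \<le> \<epsilon> / 8 * (2 * s)"
            using leb[of "2 * s"] s by (simp add: set_lebesgue_integral_def)
          finally show ?thesis .
        qed
        have main: "norm (LINT u|lborel. of_real (?b u) * g u) \<le> 66 * exp 3 * gdens x * s * L"
        proof -
          have "(LINT u|lborel. of_real (?b u) * g u) = (LINT u|gauss. of_real (?b u) * f u)"
            by (subst integral_gauss) (auto simp: g_def intro!: Bochner_Integration.integral_cong)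
          then show ?thesis using bump_right[OF f _ L(2) s(1,3)] L by simp
        qed
        have "norm (g x) * (s / 4) \<le> norm (g x) * (LINT u|lborel. ?b u)"
          by (intro mult_left_mono b(1)) simp
        also have "\<dots> = norm (LINT u|lborel. of_real (?b u) * g x)"
        proof -
          have "(LINT u|lborel. of_real (?b u) * g x) = of_real (LINT u|lborel. ?b u) * g x"
            by (simp only: integral_mult_left_zero integral_complex_of_real)
          moreover have "0 \<le> (LINT u|lborel. ?b u)" using b(1) s by linarith
          ultimately show ?thesis by (simp only: norm_mult norm_of_real abs_of_nonneg mult.commute)
        qed
        also have "(LINT u|lborel. of_real (?b u) * g x)
            = (LINT u|lborel. of_real (?b u) * g u) + (LINT u|lborel. of_real (?b u) * g x - of_real (?b u) * g u)"
          using Bochner_Integration.integral_diff[OF bgx big] by simp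
        also have "norm \<dots> \<le> 66 * exp 3 * gdens x * s * L + \<epsilon> / 8 * (2 * s)"
          by (intro norm_triangle_mono main order_trans[OF integral_norm_bound small])
        also have "\<dots> = (264 * exp 3 * gdens x * L + \<epsilon>) * (s / 4)" by (simp add: algebra_simps)
        finally show ?thesis using s(1) by (simp add: mult_le_cancel_right)
      qed
      then have "norm (g x) \<le> 264 * exp 3 * gdens x * L" by (rule field_le_epsilon)
      then have "gdens x * norm (f x) \<le> gdens x * (264 * exp 3 * L)" by (simp add: g_def mult.commute mult.left_commute)
      then have "norm (f x) \<le> 264 * exp 3 * L" by simp
      then have "ennreal (norm (f x)) \<le> ennreal (264 * exp 3 * L)" by (rule ennreal_leI)
      then show ?thesis using L by (simp add: ennreal_mult)
    qed
  qed
qed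

section \<open>Decomposition on a short interval\<close>

text \<open>What matters is that the ends of a component lie outside U: for a level set this means
  that \<open>M_loc\<close> is under control exactly there.\<close>

lemma open_component_real:
  fixes U :: "real set"
  assumes U: "open U" "U \<subseteq> {a<..<b}" and I: "I \<in> components U"
  obtains \<alpha> \<beta> where "I = {\<alpha><..<\<beta>}" "\<alpha> < \<beta>" "a \<le> \<alpha>" "\<beta> \<le> b" "\<alpha> \<notin> U" "\<beta> \<notin> U"
proof -
  have op: "open I" using open_components[OF U(1) I] .
  have conn: "connected I" using in_components_connected[OF I] .
  have sub: "I \<subseteq> U" using in_components_subset[OF I] .
  have ne: "I \<noteq> {}" using in_components_nonempty[OF I] .
  have bd: "bdd_below I" "bdd_above I"
    using sub U(2) by (auto intro!: bdd_belowI[of _ a] bdd_aboveI[of _ b])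
  define \<alpha> \<beta> where "\<alpha> = Inf I" and "\<beta> = Sup I"
  have nin: "\<alpha> \<notin> I" "\<beta> \<notin> I"
  proof -
    have "\<exists>y\<in>I. y < x" "\<exists>y\<in>I. x < y" if x: "x \<in> I" for x
    proof -
      obtain e where e: "0 < e" "ball x e \<subseteq> I" by (rule openE[OF op x])
      then have "x - e / 2 \<in> I" "x + e / 2 \<in> I" by (auto simp: dist_real_def subset_iff)
      then show "\<exists>y\<in>I. y < x" "\<exists>y\<in>I. x < y" using e(1) by force+
    qed
    then show "\<alpha> \<notin> I" "\<beta> \<notin> I"
      using cInf_lower[OF _ bd(1)] cSup_upper[OF _ bd(2)] unfolding \<alpha>_def \<beta>_def by (meson not_le)+
  qed
  have I_eq: "I = {\<alpha><..<\<beta>}"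
  proof (intro equalityI subsetI)
    fix x assume "x \<in> I"
    then show "x \<in> {\<alpha><..<\<beta>}"
      using cInf_lower[OF _ bd(1)] cSup_upper[OF _ bd(2)] nin
      unfolding \<alpha>_def \<beta>_def by (auto simp: less_le)
  next
    fix x assume x: "x \<in> {\<alpha><..<\<beta>}"
    obtain y where "y \<in> I" "y < x" using x cInf_lessD[OF ne, of x] by (auto simp: \<alpha>_def)
    moreover obtain z where "z \<in> I" "x < z" using x less_cSupD[OF ne, of x] by (auto simp: \<beta>_def)
    ultimately have "{y..z} \<subseteq> I" using connected_contains_Icc[OF conn] by blast
    then show "x \<in> I" using \<open>y < x\<close> \<open>x < z\<close> by auto
  qed
  have lt: "\<alpha> < \<beta>" using ne I_eq by auto
  have notU: "z \<notin> U" if z: "z \<in> closure I" "z \<notin> I" for z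
  proof
    assume "z \<in> U"
    \<comment> \<open>A boundary point of I that belonged to U could be adjoined to I without losing
      connectedness, contradicting maximality.\<close>
    have "connected (insert z I)"
      using connected_intermediate_closure[OF conn, of "insert z I"] z(1) closure_subset by blast
    then have "insert z I \<subseteq> I"
      using components_maximal[OF I, of "insert z I"] sub \<open>z \<in> U\<close> ne by auto
    then show False using z(2) by auto
  qed
  have cl: "closure I = {\<alpha>..\<beta>}" unfolding I_eq using lt by (rule closure_greaterThanLessThan)
  have "\<alpha> \<notin> U" "\<beta> \<notin> U" using notU nin lt unfolding cl by auto
  moreover have "a \<le> \<alpha>" "\<beta> \<le> b"
  proof -
    have "{\<alpha><..<\<beta>} \<subseteq> {a..b}" using sub U(2) I_eq by force
    then have "{\<alpha>..\<beta>} \<subseteq> {a..b}" using closure_minimal[of "{\<alpha><..<\<beta>}" "{a..b}"] lt by (simp add: closure_greaterThanLessThan)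
    then show "a \<le> \<alpha>" "\<beta> \<le> b" using lt by auto
  qed
  ultimately show ?thesis using that I_eq lt by blast
qed

lemma set_integral_const_gauss:
  fixes c :: complex
  assumes "S \<in> sets borel"
  shows "set_integrable gauss S (\<lambda>x. c)" "(LINT x:S|gauss. c) = measure gauss S *\<^sub>R c"
proof -
  have int: "integrable gauss (indicator S :: real \<Rightarrow> real)"
    using assms by (simp add: integrable_indicator_iff less_top[symmetric])
  then show "set_integrable gauss S (\<lambda>x. c)"
    unfolding set_integrable_def by (rule integrable_scaleR_left)
  show "(LINT x:S|gauss. c) = measure gauss S *\<^sub>R c"
    unfolding set_lebesgue_integral_def using int by (subst integral_scaleR_left) auto
qed

lemma countable_components_open:
  fixes U :: "real set"
  assumes "open U"
  shows "countable (components U)"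
  using assms pairwise_disjoint_components[of U]
  by (intro countable_disjoint_open_subsets) (auto simp: pairwise_def disjnt_def open_components)

text \<open>A geometric sum is at most twice its largest term. This is the layer cake bound that
  turns the sum over levels into \<open>M_loc\<close>.\<close>

lemma sum_powers_below_le:
  fixes L r :: real
  assumes "0 < L"
  shows "(\<Sum>k<n. if 2 ^ k * L < r then 2 ^ k * L else 0) \<le> 2 * max 0 r"
proof (induction n)
  case (Suc n)
  show ?case
  proof (cases "2 ^ n * L < r")
    case True
    have "(\<Sum>k<Suc n. if 2 ^ k * L < r then 2 ^ k * L else 0) \<le> (\<Sum>k<Suc n. 2 ^ k * L)"
      using assms by (intro sum_mono) auto
    also have "\<dots> = (2 ^ Suc n - 1) * L"
      by (induction n) (auto simp: algebra_simps)
    also have "\<dots> \<le> 2 * (2 ^ n * L)" using assms by (simp add: algebra_simps)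
    also have "\<dots> \<le> 2 * max 0 r" using True by simp
    finally show ?thesis .
  qed (use Suc in simp)
qed simp

text \<open>\<open>short\<close> is demanded at every point, because it is used at the ends of each
  component and at the midpoints of the balls of all atoms. Positivity of L makes the heights 2^k L
  exhaust all finite values.\<close>

locale good_interval =
  fixes f :: "real \<Rightarrow> complex" and a b L :: real
  assumes f: "integrable gauss f"
    and ab: "a < b" and short: "\<And>x. x \<in> {a..b} \<Longrightarrow> b - a < admissible_radius x"
    and L: "0 < L" "M_loc f a \<le> ennreal L" "M_loc f b \<le> ennreal L"
    and finite_M: "(\<integral>\<^sup>+x. M_loc f x * indicator {a..b} x \<partial>gauss) < \<infinity>"
begin

abbreviation A :: real where "A \<equiv> 86 * exp 9"

definition mean :: "real set \<Rightarrow> complex" where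
  "mean I = (LINT u:I|gauss. f u) /\<^sub>R measure gauss I"

definition lvl :: "nat \<Rightarrow> real set" where
  "lvl k = {a<..<b} \<inter> {x. ennreal (2 ^ k * L) < M_loc f x}"

text \<open>
  The component averages play the role of the good part of a Calderon--Zygmund decomposition at
  height \<open>2 ^ k * L\<close>. Sharp cutoffs at the ends of a component are harmless, because both ends
  lie outside the level set, where increments are controlled.
\<close>

definition good :: "nat \<Rightarrow> real \<Rightarrow> complex" where
  "good k x = (if x \<in> lvl k then mean (connected_component_set (lvl k) x) else f x)"

lemma f_measurable [measurable]: "f \<in> borel_measurable borel"
  by (rule borel_measurable_integrable_gauss[OF f])

lemma open_lvl: "open (lvl k)"
  unfolding lvl_def by (intro open_Int open_M_loc_greater f) auto

lemma lvl_measurable [measurable]: "lvl k \<in> sets borel"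
  by (rule borel_open[OF open_lvl])

lemma lvl_subset: "lvl k \<subseteq> {a<..<b}"
  by (auto simp: lvl_def)

lemma lvl_antimono: "j \<le> k \<Longrightarrow> lvl k \<subseteq> lvl j"
proof
  fix x assume jk: "j \<le> k" and x: "x \<in> lvl k"
  have "2 ^ j * L \<le> 2 ^ k * L" using jk L(1) by (intro mult_right_mono power_increasing) auto
  then have "ennreal (2 ^ j * L) \<le> ennreal (2 ^ k * L)" by (rule ennreal_leI)
  then show "x \<in> lvl j" using x by (auto simp: lvl_def)
qed

lemma M_loc_outside_lvl: "x \<in> {a..b} \<Longrightarrow> x \<notin> lvl k \<Longrightarrow> M_loc f x \<le> ennreal (2 ^ k * L)"
proof -
  assume x: "x \<in> {a..b}" "x \<notin> lvl k"
  have "1 * L \<le> 2 ^ k * L" using L(1) by (intro mult_right_mono) auto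
  then have le: "ennreal L \<le> ennreal (2 ^ k * L)" by (intro ennreal_leI) simp
  consider "x = a" | "x = b" | "x \<in> {a<..<b}" using x by force
  then show ?thesis
  proof cases
    case 3
    then show ?thesis using x(2) by (simp add: lvl_def not_less)
  qed (use order_trans[OF L(2) le] order_trans[OF L(3) le] in simp_all)
qed

text \<open>The Lipschitz bound for the primitive, applied at two ends outside the level set, bounds
  the average although \<open>M_loc\<close> may be large in between. The closed variant of I serves
  the whole interval.\<close>

lemma mean_le:
  assumes "a \<le> \<alpha>" "\<alpha> < \<beta>" "\<beta> \<le> b" "\<alpha> \<notin> lvl k" "\<beta> \<notin> lvl k" "I = {\<alpha><..<\<beta>} \<or> I = {\<alpha>..\<beta>}"
  shows "norm (mean I) \<le> A * (2 ^ k * L)"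
proof -
  have G: "0 < measure gauss {\<alpha>..\<beta>}" using assms(2) by (rule measure_gauss_pos)
  have "(LINT u:{\<alpha><..<\<beta>}|gauss. f u) = (LINT u:{\<alpha>..\<beta>}|gauss. f u)"
    unfolding set_lebesgue_integral_def
  proof (rule integral_cong_AE)
    have "AE u in lborel. u \<noteq> \<alpha>" "AE u in lborel. u \<noteq> \<beta>" by (rule AE_lborel_singleton)+
    then show "AE u in gauss. indicator {\<alpha><..<\<beta>} u *\<^sub>R f u = indicator {\<alpha>..\<beta>} u *\<^sub>R f u"
      unfolding AE_gauss by eventually_elim (auto split: split_indicator)
  qed auto
  then have eq: "mean I = (LINT u:{\<alpha>..\<beta>}|gauss. f u) /\<^sub>R measure gauss {\<alpha>..\<beta>}"
    using assms(6) measure_gauss_ivl_eq[of \<alpha> \<beta>] assms(2) by (auto simp: mean_def)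
  have "norm (LINT u:{\<alpha>..\<beta>}|gauss. f u) \<le> A * (2 ^ k * L) * measure gauss {\<alpha>..\<beta>}"
  proof (rule norm_increment_le[OF f])
    show "\<beta> - \<alpha> < admissible_radius \<alpha>" "\<beta> - \<alpha> < admissible_radius \<beta>"
      using short[of \<alpha>] short[of \<beta>] assms by auto
  qed (use assms L(1) M_loc_outside_lvl in auto)
  then show ?thesis using G unfolding eq by (simp add: field_simps)
qed

lemma good_on_component:
  assumes "I \<in> components (lvl k)" "x \<in> I"
  shows "good k x = mean I" "x \<in> lvl k"
proof -
  show "x \<in> lvl k" using assms in_components_subset by blast
  moreover have "connected_component_set (lvl k) x = I"
    using assms by (metis components_iff connected_component_eq mem_Collect_eq)
  ultimately show "good k x = mean I" by (simp add: good_def)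
qed

lemma component_of:
  assumes "x \<in> lvl k"
  shows "connected_component_set (lvl k) x \<in> components (lvl k)" "x \<in> connected_component_set (lvl k) x"
  using assms by (auto simp: components_iff)

lemma component_interval:
  assumes "I \<in> components (lvl k)"
  obtains \<alpha> \<beta> where "I = {\<alpha><..<\<beta>}" "\<alpha> < \<beta>" "a \<le> \<alpha>" "\<beta> \<le> b" "\<alpha> \<notin> lvl k" "\<beta> \<notin> lvl k"
  using open_component_real[OF open_lvl lvl_subset assms] .

lemma component_measurable: "I \<in> components (lvl k) \<Longrightarrow> I \<in> sets borel"
  using open_components[OF open_lvl] by auto

lemma good_measurable [measurable]: "good k \<in> borel_measurable borel"
proof -
  let ?c = "\<lambda>x. mean (connected_component_set (lvl k) x)"
  have "continuous_on (lvl k) ?c"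
    unfolding continuous_on_eq_continuous_at[OF open_lvl]
  proof (intro ballI)
    fix x assume x: "x \<in> lvl k"
    have op: "open (connected_component_set (lvl k) x)" by (intro open_connected_component open_lvl)
    have "eventually (\<lambda>y. ?c y = ?c x) (nhds x)"
      using eventually_nhds_in_open[OF op component_of(2)[OF x]]
    proof eventually_elim
      case (elim y)
      then have "connected_component_set (lvl k) y = connected_component_set (lvl k) x"
        using connected_component_eq by blast
      then show ?case by simp
    qed
    then have "eventually (\<lambda>y. ?c y = ?c x) (at x)" by (auto simp: eventually_at_filter elim: eventually_mono)
    then show "isCont ?c x" unfolding isCont_def by (rule tendsto_eventually)
  qed
  then have "(\<lambda>x. indicator (lvl k) x *\<^sub>R ?c x) \<in> borel_measurable borel"
    by (intro borel_measurable_continuous_on_indicator) auto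
  then have "(\<lambda>x. indicator (lvl k) x *\<^sub>R ?c x + indicator (- lvl k) x *\<^sub>R f x) \<in> borel_measurable borel"
    by measurable
  also have "(\<lambda>x. indicator (lvl k) x *\<^sub>R ?c x + indicator (- lvl k) x *\<^sub>R f x) = good k"
    by (auto simp: good_def fun_eq_iff)
  finally show ?thesis .
qed

text \<open>On components this is the bound for averages; elsewhere |f| is at most a multiple of
  \<open>M_loc\<close> almost everywhere. The constant of the latter is absorbed since 264 <= 86 *
  \<open>exp 6\<close>.\<close>

lemma good_bound: "AE x in gauss. x \<in> {a..b} \<longrightarrow> norm (good k x) \<le> A * (2 ^ k * L)"
proof -
  have exp6: "264 * exp 3 \<le> A"
  proof -
    have "264 \<le> 86 * exp (6 :: real)" using exp_ge_add_one_self[of 6] by simp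
    then have "264 * exp 3 \<le> 86 * exp (6 :: real) * exp 3" by (rule mult_right_mono) simp
    also have "\<dots> = A" by (simp add: mult.assoc flip: exp_add)
    finally show ?thesis .
  qed
  from AE_norm_le_M_loc[OF f] show ?thesis
    unfolding AE_gauss
  proof eventually_elim
    case (elim x)
    show ?case
    proof
      assume x: "x \<in> {a..b}"
      show "norm (good k x) \<le> A * (2 ^ k * L)"
      proof (cases "x \<in> lvl k")
        case True
        obtain \<alpha> \<beta> where "connected_component_set (lvl k) x = {\<alpha><..<\<beta>}" "\<alpha> < \<beta>" "a \<le> \<alpha>" "\<beta> \<le> b" "\<alpha> \<notin> lvl k" "\<beta> \<notin> lvl k"
          using component_interval[OF component_of(1)[OF True]] .
        then show ?thesis using True by (simp add: good_def mean_le)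
      next
        case False
        have "ennreal (norm (f x)) \<le> ennreal (264 * exp 3) * ennreal (2 ^ k * L)"
          using elim M_loc_outside_lvl[OF x False] by (rule order_trans[OF _ mult_left_mono]) simp
        also have "\<dots> = ennreal (264 * exp 3 * (2 ^ k * L))"
          using L(1) by (simp add: ennreal_mult)
        finally have "norm (f x) \<le> 264 * exp 3 * (2 ^ k * L)"
          using L(1) by (subst (asm) ennreal_le_iff) auto
        also have "\<dots> \<le> A * (2 ^ k * L)" using exp6 L(1) by (intro mult_right_mono) auto
        finally show ?thesis using False by (simp add: good_def)
      qed
    qed
  qed
qed

lemma good_set_integrable:
  assumes "S \<subseteq> {a..b}" "S \<in> sets borel"
  shows "set_integrable gauss S (good k)"
  unfolding set_integrable_def
proof (rule Bochner_Integration.integrable_bound)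
  show "integrable gauss (\<lambda>x. A * (2 ^ k * L))" by simp
  show "AE x in gauss. norm (indicator S x *\<^sub>R good k x) \<le> norm (A * (2 ^ k * L))"
    using good_bound[of k] by eventually_elim (use assms L(1) in \<open>auto split: split_indicator\<close>)
qed (use assms in auto)

lemma f_set_integrable: "S \<in> sets borel \<Longrightarrow> set_integrable gauss S f"
  unfolding set_integrable_def by (rule integrable_indicator_mult[OF f])

lemma component_integral:
  assumes I: "I \<in> components (lvl k)"
  shows "(LINT x:I|gauss. f x - good k x) = 0"
proof -
  obtain \<alpha> \<beta> where J: "I = {\<alpha><..<\<beta>}" "\<alpha> < \<beta>" using component_interval[OF I] by metis
  have G: "measure gauss I \<noteq> 0"
    using measure_gauss_pos[OF J(2)] measure_gauss_ivl_eq[of \<alpha> \<beta>] J by simp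
  have Im: "I \<in> sets borel" using component_measurable[OF I] .
  have "(LINT x:I|gauss. f x - good k x) = (LINT x:I|gauss. f x - mean I)"
    using good_on_component(1)[OF I] Im by (intro set_lebesgue_integral_cong) auto
  also have "\<dots> = (LINT x:I|gauss. f x) - (LINT x:I|gauss. mean I)"
    using Im by (intro set_integral_diff f_set_integrable set_integral_const_gauss)
  also have "(LINT x:I|gauss. mean I) = measure gauss I *\<^sub>R mean I"
    using Im by (rule set_integral_const_gauss)
  also have "\<dots> = (LINT x:I|gauss. f x)" using G by (simp add: mean_def)
  finally show ?thesis by simp
qed

text \<open>Averaging preserves the integral over any S that is a union of full components and
  points outside the level set: the components in S are countable and disjoint, and f -
  \<open>good k\<close> has integral 0 on each.\<close>

lemma good_integral_eq:
  assumes S: "S \<in> sets borel" "S \<subseteq> {a..b}"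
    and sat: "\<And>x. x \<in> S \<inter> lvl k \<Longrightarrow> connected_component_set (lvl k) x \<subseteq> S"
  shows "(LINT x:S|gauss. good k x) = (LINT x:S|gauss. f x)"
proof -
  define C where "C = {I \<in> components (lvl k). I \<subseteq> S}"
  have cC: "countable C" unfolding C_def
    by (rule countable_subset[OF _ countable_components_open[OF open_lvl]]) auto
  define T where "T n = (if n \<in> to_nat_on C ` C then from_nat_into C n else {})" for n
  have T: "T n = {} \<or> T n \<in> C" for n using cC by (auto simp: T_def)
  have Tm: "T n \<in> sets gauss" for n
    using T[of n] component_measurable by (auto simp: C_def)
  have disj: "T i \<inter> T j = {}" if "i \<noteq> j" for i j
  proof (cases "i \<in> to_nat_on C ` C \<and> j \<in> to_nat_on C ` C")
    case True
    then obtain I J where IJ: "I \<in> C" "i = to_nat_on C I" "J \<in> C" "j = to_nat_on C J" by auto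
    then have "I \<noteq> J" using that by auto
    then have "I \<inter> J = {}"
      using IJ pairwise_disjoint_components[of "lvl k"] by (auto simp: C_def pairwise_def)
    then show ?thesis using True IJ cC by (simp add: T_def)
  qed (auto simp: T_def)
  have U: "(\<Union>n. T n) = S \<inter> lvl k"
  proof (intro equalityI subsetI)
    fix x assume "x \<in> (\<Union>n. T n)"
    then obtain n where n: "x \<in> T n" by auto
    then have "T n \<in> C" using T[of n] by auto
    then show "x \<in> S \<inter> lvl k" using n in_components_subset by (auto simp: C_def)
  next
    fix x assume x: "x \<in> S \<inter> lvl k"
    let ?I = "connected_component_set (lvl k) x"
    have I: "?I \<in> C" using x sat component_of(1) by (auto simp: C_def)
    then have "T (to_nat_on C ?I) = ?I" using cC by (simp add: T_def)
    then show "x \<in> (\<Union>n. T n)" using component_of(2) x by blast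
  qed
  have Sl: "S \<inter> lvl k \<in> sets borel" "S \<inter> lvl k \<subseteq> {a..b}" using S by auto
  have int: "set_integrable gauss S (\<lambda>x. f x - good k x)"
    using S by (intro set_integral_diff(1) f_set_integrable good_set_integrable) auto
  have "(LINT x:S|gauss. f x - good k x) = (LINT x:S \<inter> lvl k|gauss. f x - good k x)"
    unfolding set_lebesgue_integral_def
    by (intro Bochner_Integration.integral_cong) (auto simp: good_def split: split_indicator)
  also have "\<dots> = (\<Sum>n. LINT x:T n|gauss. f x - good k x)"
    unfolding U[symmetric]
  proof (rule lebesgue_integral_countable_add[OF Tm disj])
    show "set_integrable gauss (\<Union>n. T n) (\<lambda>x. f x - good k x)"
      unfolding U using Sl by (intro set_integral_diff(1) f_set_integrable good_set_integrable) auto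
  qed
  also have "\<dots> = (\<Sum>n. 0)"
  proof (rule suminf_cong)
    fix n show "(LINT x:T n|gauss. f x - good k x) = 0"
    proof (cases "T n = {}")
      case True
      then show ?thesis by (simp add: set_lebesgue_integral_def)
    next
      case False
      then show ?thesis using T[of n] component_integral unfolding C_def by blast
    qed
  qed
  finally have "(LINT x:S|gauss. f x - good k x) = 0" by simp
  then show ?thesis
    using set_integral_diff(2)[OF f_set_integrable[OF S(1)] good_set_integrable[OF S(2,1)], of k] by simp
qed

lemma gauss_H1_le_first:
  "gauss_H1_le (\<lambda>x. indicator {a..b} x *\<^sub>R (good 0 x - mean {a..b})) (ennreal (2 * A * L * measure gauss {a..b}))"
proof (rule gauss_H1_le_mean_zero[OF ab])
  have "b - a < admissible_radius ((a + b) / 2)" using ab by (intro short) (auto simp: field_simps)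
  moreover have "(b - a) / 2 \<le> b - a" using ab by simp
  ultimately show "(b - a) / 2 \<le> admissible_radius ((a + b) / 2)" by (meson less_imp_le order_trans)
  have m: "norm (mean {a..b}) \<le> A * L"
  proof -
    have "a \<notin> lvl 0" "b \<notin> lvl 0" using lvl_subset[of 0] by auto
    then show ?thesis using mean_le[of a b 0 "{a..b}"] ab by simp
  qed
  show "AE x in gauss. norm (indicator {a..b} x *\<^sub>R (good 0 x - mean {a..b})) \<le> 2 * A * L * indicator {a..b} x"
    using good_bound[of 0]
  proof eventually_elim
    case (elim x)
    show ?case
    proof (cases "x \<in> {a..b}")
      case True
      then have "norm (good 0 x - mean {a..b}) \<le> A * L + A * L"
        using elim m by (intro norm_triangle_le_diff add_mono) auto
      also have "\<dots> = 2 * A * L" by simp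
      finally show ?thesis using True by simp
    qed simp
  qed
  have "(LINT x:{a..b}|gauss. good 0 x - mean {a..b}) = (LINT x:{a..b}|gauss. good 0 x) - (LINT x:{a..b}|gauss. mean {a..b})"
    by (intro set_integral_diff good_set_integrable set_integral_const_gauss) auto
  also have "(LINT x:{a..b}|gauss. good 0 x) = (LINT x:{a..b}|gauss. f x)"
  proof (rule good_integral_eq)
    show "connected_component_set (lvl 0) x \<subseteq> {a..b}" for x
      using connected_component_subset[of "lvl 0" x] lvl_subset[of 0] by force
  qed auto
  also have "(LINT x:{a..b}|gauss. mean {a..b}) = measure gauss {a..b} *\<^sub>R mean {a..b}"
    by (rule set_integral_const_gauss) simp
  also have "\<dots> = (LINT x:{a..b}|gauss. f x)" using measure_gauss_pos[OF ab] by (simp add: mean_def)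
  finally show "(LINT x|gauss. indicator {a..b} x *\<^sub>R (good 0 x - mean {a..b})) = 0"
    by (simp add: set_lebesgue_integral_def)
qed simp

text \<open>Components at level k + 1 that meet I lie inside I, so both functions have the integral
  of f over I and the difference has mean zero. The bounds at heights 2^(k + 1) L and 2^k L add up
  to the factor 3.\<close>

lemma gauss_H1_le_component:
  assumes I: "I \<in> components (lvl k)"
  shows "gauss_H1_le (\<lambda>x. indicator I x *\<^sub>R (good (Suc k) x - good k x)) (ennreal (3 * A * (2 ^ k * L) * measure gauss I))"
proof -
  obtain \<alpha> \<beta> where J: "I = {\<alpha><..<\<beta>}" "\<alpha> < \<beta>" "a \<le> \<alpha>" "\<beta> \<le> b" "\<alpha> \<notin> lvl k" "\<beta> \<notin> lvl k"
    using component_interval[OF I] .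
  have Im: "I \<in> sets borel" "I \<subseteq> {a..b}" using component_measurable[OF I] J by auto
  have "gauss_H1_le (\<lambda>x. indicator I x *\<^sub>R (good (Suc k) x - good k x)) (ennreal (3 * A * (2 ^ k * L) * measure gauss {\<alpha>..\<beta>}))"
  proof (rule gauss_H1_le_mean_zero[OF J(2)])
    have "b - a < admissible_radius ((\<alpha> + \<beta>) / 2)" using J by (intro short) (auto simp: field_simps)
    moreover have "(\<beta> - \<alpha>) / 2 \<le> \<beta> - \<alpha>" "\<beta> - \<alpha> \<le> b - a" using J by simp_all
    ultimately show "(\<beta> - \<alpha>) / 2 \<le> admissible_radius ((\<alpha> + \<beta>) / 2)" by (meson less_imp_le order_trans)
    show "AE x in gauss. norm (indicator I x *\<^sub>R (good (Suc k) x - good k x)) \<le> 3 * A * (2 ^ k * L) * indicator {\<alpha>..\<beta>} x"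
      using good_bound[of k] good_bound[of "Suc k"]
    proof eventually_elim
      case (elim x)
      show ?case
      proof (cases "x \<in> I")
        case True
        then have "norm (good (Suc k) x - good k x) \<le> A * (2 ^ Suc k * L) + A * (2 ^ k * L)"
          using elim Im by (intro norm_triangle_le_diff add_mono) auto
        also have "\<dots> = 3 * A * (2 ^ k * L)" by (simp add: algebra_simps)
        finally have "norm (good (Suc k) x - good k x) \<le> 3 * A * (2 ^ k * L)" .
        then show ?thesis using True J by simp
      next
        case False
        then show ?thesis using L(1) by (simp split: split_indicator)
      qed
    qed
    have "(LINT x:I|gauss. good (Suc k) x - good k x) = (LINT x:I|gauss. good (Suc k) x) - (LINT x:I|gauss. good k x)"
      by (intro set_integral_diff good_set_integrable Im)
    also have "(LINT x:I|gauss. good (Suc k) x) = (LINT x:I|gauss. f x)"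
    proof (rule good_integral_eq[OF Im])
      fix x assume x: "x \<in> I \<inter> lvl (Suc k)"
      have "connected_component_set (lvl (Suc k)) x \<subseteq> connected_component_set (lvl k) x"
        by (intro connected_component_mono lvl_antimono) simp
      also have "connected_component_set (lvl k) x = I"
        using I x by (metis IntD1 components_iff connected_component_eq mem_Collect_eq)
      finally show "connected_component_set (lvl (Suc k)) x \<subseteq> I" .
    qed
    also have "(LINT x:I|gauss. good k x) = (LINT x:I|gauss. f x)"
    proof (rule good_integral_eq[OF Im])
      fix x assume x: "x \<in> I \<inter> lvl k"
      show "connected_component_set (lvl k) x \<subseteq> I"
        using I x by (metis IntD1 components_iff connected_component_eq mem_Collect_eq order_refl)
    qed
    finally show "(LINT x|gauss. indicator I x *\<^sub>R (good (Suc k) x - good k x)) = 0"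
      by (simp add: set_lebesgue_integral_def)
  qed (use Im in measurable)
  then show ?thesis using J measure_gauss_ivl_eq[of \<alpha> \<beta>] by simp
qed

text \<open>Outside level k both functions equal f, and the components are disjoint, so the costs of
  the components add up to the measure of the level set.\<close>

lemma gauss_H1_le_level:
  "gauss_H1_le (\<lambda>x. indicator {a..b} x *\<^sub>R (good (Suc k) x - good k x)) (ennreal (3 * A * (2 ^ k * L) * measure gauss (lvl k)))"
proof (rule gauss_H1_le_has_sum[OF countable_components_open[OF open_lvl] gauss_H1_le_component])
  fix B assume B: "finite B" "B \<subseteq> components (lvl k)"
  have "(\<Sum>I\<in>B. measure gauss I) = measure gauss (\<Union>I\<in>B. I)"
  proof (rule gauss.finite_measure_finite_Union[symmetric, OF B(1)])
    show "(\<lambda>I. I) ` B \<subseteq> gauss.events" using B component_measurable by auto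
    show "disjoint_family_on (\<lambda>I. I) B"
      using B pairwise_disjoint_components[of "lvl k"] by (auto simp: disjoint_family_on_def pairwise_def)
  qed
  also have "\<dots> \<le> measure gauss (lvl k)"
    using B in_components_subset by (intro gauss.finite_measure_mono) auto
  finally have "3 * A * (2 ^ k * L) * (\<Sum>I\<in>B. measure gauss I) \<le> 3 * A * (2 ^ k * L) * measure gauss (lvl k)"
    using L(1) by (intro mult_left_mono) auto
  then show "(\<Sum>I\<in>B. ennreal (3 * A * (2 ^ k * L) * measure gauss I)) \<le> ennreal (3 * A * (2 ^ k * L) * measure gauss (lvl k))"
    using L(1) by (subst sum_ennreal) (auto simp: sum_distrib_left intro!: ennreal_leI)
next
  show "AE x in gauss. ((\<lambda>I. indicator I x *\<^sub>R (good (Suc k) x - good k x)) has_sum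
      indicator {a..b} x *\<^sub>R (good (Suc k) x - good k x)) (components (lvl k))"
  proof (intro always_eventually allI)
    fix x
    show "((\<lambda>I. indicator I x *\<^sub>R (good (Suc k) x - good k x)) has_sum
      indicator {a..b} x *\<^sub>R (good (Suc k) x - good k x)) (components (lvl k))"
    proof (cases "x \<in> lvl k")
      case True
      let ?I = "connected_component_set (lvl k) x"
      show ?thesis
      proof (rule has_sum_finite_neutralI[where B = "{?I}"])
        show "{?I} \<subseteq> components (lvl k)" using component_of[OF True] by auto
        show "indicator I x *\<^sub>R (good (Suc k) x - good k x) = 0" if "I \<in> components (lvl k) - {?I}" for I
        proof -
          have "I \<inter> ?I = {}"
            using that component_of[OF True] pairwise_disjoint_components[of "lvl k"] by (auto simp: pairwise_def)
          then have "x \<notin> I" using component_of(2)[OF True] by blast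
          then show ?thesis by simp
        qed
        show "indicator {a..b} x *\<^sub>R (good (Suc k) x - good k x) = (\<Sum>I\<in>{?I}. indicator I x *\<^sub>R (good (Suc k) x - good k x))"
          using True lvl_subset[of k] component_of(2)[OF True] by (auto simp: indicator_def)
      qed simp
    next
      case False
      then have "x \<notin> lvl (Suc k)" using lvl_antimono[of k "Suc k"] by auto
      then show ?thesis using False by (simp add: good_def)
    qed
  qed
qed auto

text \<open>At each point the heights 2^k L below \<open>M_loc f x\<close> sum to at most 2
  \<open>M_loc f x\<close>; this doubles 3 A to 6 A.\<close>

lemma suminf_levels_le:
  "(\<Sum>k. ennreal (3 * A * (2 ^ k * L) * measure gauss (lvl k)))
     \<le> ennreal (6 * A) * (\<integral>\<^sup>+x. M_loc f x * indicator {a..b} x \<partial>gauss)"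
  unfolding suminf_eq_SUP
proof (rule SUP_least)
  fix n
  have [measurable]: "M_loc f \<in> borel_measurable borel" by (rule borel_measurable_M_loc[OF f])
  have "(\<Sum>k<n. ennreal (3 * A * (2 ^ k * L) * measure gauss (lvl k)))
     = (\<Sum>k<n. ennreal (3 * A) * (\<integral>\<^sup>+x. ennreal (2 ^ k * L) * indicator (lvl k) x \<partial>gauss))"
  proof (rule sum.cong)
    fix k
    have "(\<integral>\<^sup>+x. ennreal (2 ^ k * L) * indicator (lvl k) x \<partial>gauss) = ennreal (2 ^ k * L * measure gauss (lvl k))"
      using L(1) by (subst nn_integral_cmult_indicator) (auto simp: gauss.emeasure_eq_measure ennreal_mult)
    then show "ennreal (3 * A * (2 ^ k * L) * measure gauss (lvl k))
       = ennreal (3 * A) * (\<integral>\<^sup>+x. ennreal (2 ^ k * L) * indicator (lvl k) x \<partial>gauss)"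
      using L(1) by (simp add: ennreal_mult[symmetric] mult.assoc)
  qed simp
  also have "\<dots> = ennreal (3 * A) * (\<integral>\<^sup>+x. (\<Sum>k<n. ennreal (2 ^ k * L) * indicator (lvl k) x) \<partial>gauss)"
    by (subst nn_integral_sum) (auto simp: sum_distrib_left)
  also have "\<dots> \<le> ennreal (3 * A) * (\<integral>\<^sup>+x. 2 * (M_loc f x * indicator {a..b} x) \<partial>gauss)"
  proof (intro mult_left_mono nn_integral_mono)
    fix x
    show "(\<Sum>k<n. ennreal (2 ^ k * L) * indicator (lvl k) x) \<le> 2 * (M_loc f x * indicator {a..b} x)"
    proof (cases "x \<in> {a<..<b}")
      case True
      show ?thesis
      proof (cases "M_loc f x = top")
        case top: True
        then show ?thesis using True by (simp add: ennreal_mult_top)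
      next
        case False
        then obtain r where r: "M_loc f x = ennreal r" "0 \<le> r" by (cases "M_loc f x") auto
        have "(\<Sum>k<n. ennreal (2 ^ k * L) * indicator (lvl k) x) = (\<Sum>k<n. ennreal (if 2 ^ k * L < r then 2 ^ k * L else 0))"
          using True r L(1) by (intro sum.cong) (auto simp: lvl_def ennreal_less_iff)
        also have "\<dots> = ennreal (\<Sum>k<n. if 2 ^ k * L < r then 2 ^ k * L else 0)"
          using L(1) by (intro sum_ennreal) auto
        also have "\<dots> \<le> ennreal (2 * r)"
          using sum_powers_below_le[OF L(1), of r n] r by (intro ennreal_leI) simp
        finally show ?thesis using True r by (simp add: ennreal_mult)
      qed
    next
      case False
      then have "x \<notin> lvl k" for k using lvl_subset[of k] by auto
      then show ?thesis by simp
    qed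
  qed simp
  also have "\<dots> = ennreal (6 * A) * (\<integral>\<^sup>+x. M_loc f x * indicator {a..b} x \<partial>gauss)"
  proof -
    have "(\<integral>\<^sup>+x. 2 * (M_loc f x * indicator {a..b} x) \<partial>gauss) = 2 * (\<integral>\<^sup>+x. M_loc f x * indicator {a..b} x \<partial>gauss)"
      by (rule nn_integral_cmult) simp
    moreover have "ennreal (6 * A) = ennreal (3 * A) * 2"
      using ennreal_mult[of "3 * A" 2] by simp
    ultimately show ?thesis by (simp add: mult.assoc)
  qed
  finally show "(\<Sum>k<n. ennreal (3 * A * (2 ^ k * L) * measure gauss (lvl k)))
      \<le> ennreal (6 * A) * (\<integral>\<^sup>+x. M_loc f x * indicator {a..b} x \<partial>gauss)" .
qed

text \<open>The level differences telescope from \<open>good 0\<close> to f, and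
  \<open>good 0\<close> differs from the mean by one multiple of an atom.\<close>

lemma gauss_H1_le_interval:
  "gauss_H1_le (\<lambda>x. indicator {a..b} x *\<^sub>R (f x - mean {a..b}))
     (ennreal (6 * A) * (ennreal (L * measure gauss {a..b}) + (\<integral>\<^sup>+x. M_loc f x * indicator {a..b} x \<partial>gauss)))"
proof -
  have [measurable]: "M_loc f \<in> borel_measurable borel" by (rule borel_measurable_M_loc[OF f])
  let ?M = "\<integral>\<^sup>+x. M_loc f x * indicator {a..b} x \<partial>gauss"
  have fin: "ennreal (6 * A) * ?M < \<infinity>"
    using finite_M by (simp add: ennreal_mult_less_top)
  have rest: "gauss_H1_le (\<lambda>x. indicator {a..b} x *\<^sub>R (f x - good 0 x)) (ennreal (6 * A) * ?M)"
  proof (rule gauss_H1_le_sums[OF gauss_H1_le_level suminf_levels_le fin])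
    have "AE x in gauss. M_loc f x * indicator {a..b} x \<noteq> \<infinity>"
      using finite_M by (intro nn_integral_noteq_infinite) auto
    then show "AE x in gauss. (\<lambda>k. indicator {a..b} x *\<^sub>R (good (Suc k) x - good k x)) sums (indicator {a..b} x *\<^sub>R (f x - good 0 x))"
    proof eventually_elim
      case (elim x)
      show ?case
      proof (cases "x \<in> {a..b}")
        case True
        then have "M_loc f x < top" using elim by (simp add: less_top)
        then obtain r where r: "M_loc f x = ennreal r" "0 \<le> r" by (cases "M_loc f x") auto
        obtain n0 where n0: "r / L < 2 ^ n0" using real_arch_pow[of 2 "r / L"] by auto
        \<comment> \<open>Where \<open>M_loc\<close> is finite, x leaves the level sets after
          finitely many steps, so the telescoping sum is eventually constant.\<close>
        have "x \<notin> lvl n" if "n0 \<le> n" for n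
        proof -
          have "(2::real) ^ n0 \<le> 2 ^ n" using that by (intro power_increasing) auto
          then have "r / L < 2 ^ n" using n0 by linarith
          then have "r \<le> 2 ^ n * L" using L(1) by (simp add: field_simps)
          then show ?thesis using r by (auto simp: lvl_def not_less intro: ennreal_leI)
        qed
        then have ev: "\<forall>\<^sub>F n in sequentially. good n x - good 0 x = f x - good 0 x"
          by (auto simp: eventually_sequentially good_def)
        have "(\<lambda>n. \<Sum>k<n. (good (Suc k) x - good k x)) = (\<lambda>n. good n x - good 0 x)"
          by (rule ext) (rule sum_lessThan_telescope)
        then have "(\<lambda>k. good (Suc k) x - good k x) sums (f x - good 0 x)"
          unfolding sums_def using ev by (simp add: tendsto_eventually)
        then show ?thesis using True by simp
      qed simp
    qed
  qed simp
  have "gauss_H1_le (\<lambda>x. indicator {a..b} x *\<^sub>R (good 0 x - mean {a..b}) + indicator {a..b} x *\<^sub>R (f x - good 0 x))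
     (ennreal (2 * A * L * measure gauss {a..b}) + ennreal (6 * A) * ?M)"
    using fin by (intro gauss_H1_le_add gauss_H1_le_first rest) simp
  then have *: "gauss_H1_le (\<lambda>x. indicator {a..b} x *\<^sub>R (f x - mean {a..b}))
     (ennreal (2 * A * L * measure gauss {a..b}) + ennreal (6 * A) * ?M)"
    by (simp add: scaleR_diff_right)
  have "ennreal (2 * A * L * measure gauss {a..b}) \<le> ennreal (6 * A * (L * measure gauss {a..b}))"
    using L(1) by (intro ennreal_leI) (simp add: mult.assoc mult_right_mono)
  also have "\<dots> = ennreal (6 * A) * ennreal (L * measure gauss {a..b})"
    using L(1) by (intro ennreal_mult) auto
  finally show ?thesis
    using * by (elim gauss_H1_le_mono) (simp add: distrib_left add_right_mono)
qed

end

section \<open>Cutting the line\<close>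

text \<open>\<^const>\<open>sqrt\<close> is an odd function in HOL, so the grid is symmetric about the origin.\<close>

definition grid :: "int \<Rightarrow> real" where
  "grid j = sqrt (of_int j) / 16"

lemma grid_less [simp]: "grid i < grid j \<longleftrightarrow> i < j"
  by (simp add: grid_def divide_less_cancel)

lemma grid_le [simp]: "grid i \<le> grid j \<longleftrightarrow> i \<le> j"
  by (simp add: grid_def divide_le_cancel)

lemma grid_uminus: "grid (- j) = - grid j"
  by (simp add: grid_def real_sqrt_minus)

text \<open>With A and B the roots of j + 1 and j, (A - B) * (A + B) = 1. On the cell 1 + x is
  comparable to A + B, because A <= 1 + B and 16 x lies between B and A.\<close>

lemma grid_step_nonneg:
  assumes "0 \<le> j" "x \<in> {grid j..grid (j + 1)}"
  shows "1 / 512 \<le> (grid (j + 1) - grid j) * (1 + \<bar>x\<bar>)" "(grid (j + 1) - grid j) * (1 + \<bar>x\<bar>) \<le> 1 / 8"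
proof -
  define A B where "A = sqrt (of_int j + 1)" and "B = sqrt (of_int j)"
  have B: "0 \<le> B" and A: "1 \<le> A" "B < A" using assms(1) by (simp_all add: A_def B_def)
  have "A\<^sup>2 = of_int j + 1" "B\<^sup>2 = of_int j" using assms(1) by (simp_all add: A_def B_def)
  then have prod: "(A - B) * (A + B) = 1" by (simp add: power2_eq_square algebra_simps)
  have grids: "grid j = B / 16" "grid (j + 1) = A / 16" by (simp_all add: grid_def A_def B_def)
  have x: "B / 16 \<le> x" "x \<le> A / 16" "0 \<le> x" using assms(2) B grids by auto
  have AB1: "A \<le> 1 + B"
  proof (rule ccontr)
    assume "\<not> A \<le> 1 + B"
    then have "1 * 1 < (A - B) * (A + B)" using B A by (intro mult_strict_mono') auto
    then show False using prod by simp
  qed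
  have eq: "(grid (j + 1) - grid j) * (1 + \<bar>x\<bar>) = (A - B) * (1 + x) / 16"
    by (simp only: grids abs_of_nonneg[OF x(3)]) (simp add: field_simps)
  have "(A - B) * (1 + x) \<le> (A - B) * (2 * (A + B))"
  proof (rule mult_left_mono)
    have "16 * x \<le> A" using x by simp
    then show "1 + x \<le> 2 * (A + B)" using A B by argo
  qed (use A in simp)
  also have "(A - B) * (2 * (A + B)) = 2"
    by (subst mult.left_commute, subst prod) simp
  finally have "(A - B) * (1 + x) \<le> 2" .
  then show "(grid (j + 1) - grid j) * (1 + \<bar>x\<bar>) \<le> 1 / 8" unfolding eq by simp
  have "(A - B) * ((A + B) / 32) \<le> (A - B) * (1 + x)"
  proof (rule mult_left_mono)
    have "A + B \<le> 32 * (1 + x)" using x AB1 B by simp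
    then show "(A + B) / 32 \<le> 1 + x" by simp
  qed (use A in simp)
  then have "1 / 32 \<le> (A - B) * (1 + x)" by (simp only: times_divide_eq_right prod)
  then show "1 / 512 \<le> (grid (j + 1) - grid j) * (1 + \<bar>x\<bar>)" unfolding eq by simp
qed

lemma grid_step:
  assumes "x \<in> {grid j..grid (j + 1)}"
  shows "1 / 512 \<le> (grid (j + 1) - grid j) * (1 + \<bar>x\<bar>)" "(grid (j + 1) - grid j) * (1 + \<bar>x\<bar>) \<le> 1 / 8"
proof -
  have "1 / 512 \<le> (grid (j + 1) - grid j) * (1 + \<bar>x\<bar>) \<and> (grid (j + 1) - grid j) * (1 + \<bar>x\<bar>) \<le> 1 / 8"
  proof (cases "0 \<le> j")
    case True
    then show ?thesis using grid_step_nonneg assms by simp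
  next
    case False
    have g: "grid (- j - 1) = - grid (j + 1)" "grid (- j - 1 + 1) = - grid j"
      using grid_uminus[of "j + 1"] grid_uminus[of j] by simp_all
    have "- x \<in> {grid (- j - 1)..grid (- j - 1 + 1)}" using assms unfolding g by simp
    then show ?thesis
      using grid_step_nonneg[of "- j - 1" "- x"] False unfolding g by simp
  qed
  then show "1 / 512 \<le> (grid (j + 1) - grid j) * (1 + \<bar>x\<bar>)" "(grid (j + 1) - grid j) * (1 + \<bar>x\<bar>) \<le> 1 / 8"
    by auto
qed

lemma grid_step_le: "grid (j + 1) - grid j \<le> 1 / 8"
proof -
  have "(grid (j + 1) - grid j) * 1 \<le> (grid (j + 1) - grid j) * (1 + \<bar>grid j\<bar>)"
    by (intro mult_left_mono) auto
  also have "\<dots> \<le> 1 / 8" by (rule grid_step(2)) simp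
  finally show ?thesis by simp
qed

text \<open>Within three cells |x| varies by at most 3/8, so 1 + |x| changes at most by the factor
  11/8. Each cell contributes 11/8 * 1/8 = 11/64, and the total 33/64 stays below 1, as
  admissibility of two adjacent pieces requires.\<close>

lemma grid_three:
  assumes x: "x \<in> {grid j..grid (j + 3)}"
  shows "(grid (j + 3) - grid j) * (1 + \<bar>x\<bar>) \<le> 33 / 64"
proof -
  have e: "j + 1 + 1 = j + 2" "j + 2 + 1 = j + 3" by simp_all
  let ?d0 = "grid (j + 1) - grid j" and ?d1 = "grid (j + 2) - grid (j + 1)" and ?d2 = "grid (j + 3) - grid (j + 2)"
  have d: "?d0 \<le> 1 / 8" "?d1 \<le> 1 / 8" "?d2 \<le> 1 / 8"
    using grid_step_le[of j] grid_step_le[of "j + 1"] grid_step_le[of "j + 2"] unfolding e by auto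
  have le: "D * (1 + \<bar>x\<bar>) \<le> 11 / 64"
    if D: "0 \<le> D" "D * (1 + \<bar>c\<bar>) \<le> 1 / 8" and c: "c \<in> {grid j..grid (j + 3)}" for D c
  proof -
    have "\<bar>x\<bar> \<le> \<bar>c\<bar> + 3 / 8" using x c d by (auto simp: abs_if)
    then have "1 + \<bar>x\<bar> \<le> 11 / 8 * (1 + \<bar>c\<bar>)" by simp
    then have "D * (1 + \<bar>x\<bar>) \<le> D * (11 / 8 * (1 + \<bar>c\<bar>))" using D(1) by (rule mult_left_mono)
    also have "\<dots> = 11 / 8 * (D * (1 + \<bar>c\<bar>))" by simp
    also have "\<dots> \<le> 11 / 8 * (1 / 8)" using D(2) by (intro mult_left_mono) auto
    finally show ?thesis by simp
  qed
  have "?d0 * (1 + \<bar>x\<bar>) \<le> 11 / 64"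
    using grid_step(2)[of "grid j" j] by (intro le[of _ "grid j"]) auto
  moreover have "?d1 * (1 + \<bar>x\<bar>) \<le> 11 / 64"
    using grid_step(2)[of "grid (j + 1)" "j + 1"] unfolding e by (intro le[of _ "grid (j + 1)"]) auto
  moreover have "?d2 * (1 + \<bar>x\<bar>) \<le> 11 / 64"
    using grid_step(2)[of "grid (j + 2)" "j + 2"] unfolding e by (intro le[of _ "grid (j + 2)"]) auto
  ultimately show ?thesis by (simp add: algebra_simps)
qed

lemma grid_three_less_admissible_radius:
  assumes x: "x \<in> {grid j..grid (j + 3)}"
  shows "grid (j + 3) - grid j < admissible_radius x"
proof -
  have "grid (j + 3) - grid j \<le> (33 / 64) / (1 + \<bar>x\<bar>)"
    using grid_three[OF x] by (simp add: field_simps add_nonneg_pos)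
  also have "\<dots> < 1 / (1 + \<bar>x\<bar>)" by (intro divide_strict_right_mono) (auto simp: add_pos_nonneg)
  also have "\<dots> \<le> admissible_radius x" by (rule admissible_radius_ge)
  finally show ?thesis .
qed

abbreviation cmp :: real where "cmp \<equiv> 600 * exp 6"

text \<open>Three cells are at most 33/64 * 512 = 264 times as long as one, hence 528 times as long
  as half of one, rounded up to 600. The factor \<open>exp 6\<close> comes from replacing the
  measure of both intervals by length times the density at v.\<close>

lemma measure_gauss_comparable:
  assumes i: "i \<in> {j..j + 2}" and S: "s \<le> t" "{s..t} \<subseteq> {grid j..grid (j + 3)}"
    and V: "v \<le> v'" "{v..v'} \<subseteq> {grid j..grid (j + 3)}" "(grid (i + 1) - grid i) / 2 \<le> v' - v"
  shows "measure gauss {s..t} \<le> cmp * measure gauss {v..v'}"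
proof -
  let ?T = "grid (j + 3) - grid j"
  have v: "v \<in> {grid j..grid (j + 3)}" using V by auto
  have near: "\<bar>v - x\<bar> \<le> admissible_radius v" if "x \<in> {grid j..grid (j + 3)}" for x
    using grid_three_less_admissible_radius[OF v] that v by auto
  have "?T * (1 + \<bar>grid i\<bar>) \<le> 33 / 64" using i by (intro grid_three) auto
  also have "33 / 64 = 264 * (1 / 512 :: real)" by simp
  also have "\<dots> \<le> 264 * ((grid (i + 1) - grid i) * (1 + \<bar>grid i\<bar>))"
    using grid_step(1)[of "grid i" i] by (intro mult_left_mono) auto
  finally have "?T * (1 + \<bar>grid i\<bar>) \<le> (264 * (grid (i + 1) - grid i)) * (1 + \<bar>grid i\<bar>)"
    by (simp only: mult.assoc)
  then have "?T \<le> 264 * (grid (i + 1) - grid i)"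
    by (rule mult_right_le_imp_le) (simp add: add_pos_nonneg)
  moreover have "grid i < grid (i + 1)" by simp
  moreover have "grid (i + 1) - grid i \<le> 2 * (v' - v)" using V(3) by simp
  ultimately have T: "?T \<le> 600 * (v' - v)" by argo
  have "measure gauss {s..t} \<le> exp 3 * gdens v * (t - s)"
    using S near by (intro measure_gauss_interval(1)) blast+
  also have "\<dots> \<le> exp 3 * gdens v * (600 * (v' - v))"
  proof (rule mult_left_mono)
    show "t - s \<le> 600 * (v' - v)" using S T by auto
  qed simp
  also have "\<dots> = cmp * (exp (- 3) * gdens v * (v' - v))"
  proof -
    have "exp 3 = exp 6 * exp (- 3 :: real)" by (simp flip: exp_add)
    then show ?thesis by simp
  qed
  also have "\<dots> \<le> cmp * measure gauss {v..v'}"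
  proof (rule mult_left_mono)
    show "exp (- 3) * gdens v * (v' - v) \<le> measure gauss {v..v'}"
      using V(1,2) near by (intro measure_gauss_interval(2)) blast+
  qed simp
  finally show ?thesis .
qed

text \<open>Chebyshev argument for a bound R on the average. Doubling R yields the contradiction,
  which needs R to be positive and finite; \<open>H\<close> may be infinite on parts of W.\<close>

lemma exists_point_le_average:
  assumes [measurable]: "H \<in> borel_measurable borel" "W \<in> sets borel"
    and W: "0 < measure gauss W"
    and avg: "(\<integral>\<^sup>+x. H x * indicator W x \<partial>gauss) \<le> R * ennreal (measure gauss W)" and R: "0 < R" "R < \<infinity>"
  shows "\<exists>x\<in>W. H x \<le> 2 * R"
proof (rule ccontr)
  assume "\<not> ?thesis"
  then have gt: "2 * R \<le> H x" if "x \<in> W" for x using that by (auto simp: not_le)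
  have "2 * R * ennreal (measure gauss W) = (\<integral>\<^sup>+x. 2 * R * indicator W x \<partial>gauss)"
    by (subst nn_integral_cmult_indicator) (auto simp: gauss.emeasure_eq_measure)
  also have "\<dots> \<le> (\<integral>\<^sup>+x. H x * indicator W x \<partial>gauss)"
    using gt by (intro nn_integral_mono) (auto split: split_indicator)
  also have "\<dots> \<le> R * ennreal (measure gauss W)" by (rule avg)
  finally have le: "2 * R * ennreal (measure gauss W) \<le> R * ennreal (measure gauss W)" .
  obtain \<rho> where \<rho>: "R = ennreal \<rho>" "0 < \<rho>" using R by (cases R) (auto simp: ennreal_less_zero_iff)
  have "ennreal (2 * \<rho> * measure gauss W) \<le> ennreal (\<rho> * measure gauss W)"
    using le \<rho> by (simp add: ennreal_mult)
  then have "2 * \<rho> * measure gauss W \<le> \<rho> * measure gauss W"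
    using \<rho> by (subst (asm) ennreal_le_iff) auto
  then show False using \<rho> W by simp
qed

text \<open>The grid index of y is the floor of 256 y |y|, the inverse of the grid map. The
  perturbed point x i may lie to the right of y, and then i - 1 is the right index.\<close>

lemma exists_grid_cell:
  assumes x: "\<And>i. grid i \<le> x i" "\<And>i. x i \<le> grid (i + 1)"
  shows "\<exists>i. x i \<le> y \<and> y < x (i + 1)"
proof -
  let ?s = "256 * (y * \<bar>y\<bar>)"
  define i where "i = \<lfloor>?s\<rfloor>"
  have "y * \<bar>y\<bar> = (if 0 \<le> y then y\<^sup>2 else - (y\<^sup>2))" by (simp add: power2_eq_square)
  then have "sqrt (y * \<bar>y\<bar>) = y" by (simp add: real_sqrt_minus)
  then have s: "sqrt ?s = 16 * y"
    by (simp add: real_sqrt_mult)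
  have "of_int i \<le> ?s" "?s < of_int (i + 1)" unfolding i_def by (auto simp: floor_correct)
  then have "sqrt (of_int i) \<le> sqrt ?s" "sqrt ?s < sqrt (of_int (i + 1))"
    by (simp_all only: real_sqrt_le_iff real_sqrt_less_iff)
  then have "grid i \<le> y" "y < grid (i + 1)" unfolding s by (simp_all add: grid_def)
  then show ?thesis
    using x(1)[of "i + 1"] x(2)[of "i - 1"] by (cases "x i \<le> y") (auto intro: exI[of _ i] exI[of _ "i - 1"])
qed

lemma L1_norm_le_M_loc:
  assumes f: "integrable gauss f"
  shows "ennreal (LINT x|gauss. norm (f x)) \<le> ennreal (264 * exp 3) * gauss_L1_norm (M_loc f)"
proof -
  have [measurable]: "M_loc f \<in> borel_measurable borel" by (rule borel_measurable_M_loc[OF f])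
  have "ennreal (LINT x|gauss. norm (f x)) = (\<integral>\<^sup>+x. ennreal (norm (f x)) \<partial>gauss)"
    using f by (subst nn_integral_eq_integral) auto
  also have "\<dots> \<le> (\<integral>\<^sup>+x. ennreal (264 * exp 3) * M_loc f x \<partial>gauss)"
    using AE_norm_le_M_loc[OF f] by (intro nn_integral_mono_AE) (simp add: AE_gauss)
  also have "\<dots> = ennreal (264 * exp 3) * gauss_L1_norm (M_loc f)"
    unfolding gauss_L1_norm_def by (rule nn_integral_cmult) simp
  finally show ?thesis .
qed

text \<open>The parameter \<delta> only serves to keep averages and heights positive, also where
  \<open>M_loc f\<close> vanishes; it enters the final bound additively.\<close>

locale mean_zero_function =
  fixes f :: "real \<Rightarrow> complex" and \<delta> :: real
  assumes f: "integrable gauss f" and mean0: "(LINT x|gauss. f x) = 0"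
    and M_finite: "gauss_L1_norm (M_loc f) < \<infinity>" and E_finite: "E_functional f < \<infinity>"
    and \<delta>: "0 < \<delta>"
begin

section \<open>Primitive of a function of mean zero and budgets of cells\<close>

definition F :: "real \<Rightarrow> complex" where
  "F x = (LINT y:{x..}|gauss. f y)"

definition h :: "real \<Rightarrow> ennreal" where
  "h x = M_loc f x + ennreal \<delta>"

text \<open>The number 1024 is twice 512, the lower bound for a cell being halved for a half cell;
  the exponential covers the comparison of density and measure.\<close>

abbreviation wt :: real where "wt \<equiv> 1024 * exp 6"

text \<open>Cut points are sought only in the left half of each cell, which keeps consecutive ones
  at least half a cell apart; otherwise the intervals between them could be arbitrarily
  short.\<close>

definition half :: "int \<Rightarrow> real" where
  "half j = (grid j + grid (j + 1)) / 2"

abbreviation W :: "int \<Rightarrow> real set" where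
  "W j \<equiv> {grid j..half j}"

text \<open>The budget of cell j: its share of \<open>M_loc\<close> and of the weighted integral of
  F that E controls. Every cost below is a multiple of such budgets, apart from the integral of
  \<open>M_loc\<close> over a piece.\<close>

definition R :: "int \<Rightarrow> ennreal" where
  "R j = (\<integral>\<^sup>+x. h x * indicator (W j) x \<partial>gauss)
    + ennreal wt * (\<integral>\<^sup>+x. ennreal ((1 + \<bar>x\<bar>) * norm (F x)) * indicator (W j) x \<partial>lborel)"

definition Rtot :: ennreal where
  "Rtot = (\<integral>\<^sup>+x. h x \<partial>gauss) + ennreal wt * (\<integral>\<^sup>+x. ennreal ((1 + \<bar>x\<bar>) * norm (F x)) \<partial>lborel)"

lemma f_measurable [measurable]: "f \<in> borel_measurable borel"
  by (rule borel_measurable_integrable_gauss[OF f])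

lemma M_measurable [measurable]: "M_loc f \<in> borel_measurable borel"
  by (rule borel_measurable_M_loc[OF f])

lemma h_measurable [measurable]: "h \<in> borel_measurable borel"
  unfolding h_def[abs_def] by measurable

lemma F_measurable [measurable]: "(\<lambda>x. norm (F x)) \<in> borel_measurable borel"
  unfolding F_def by measurable

lemma nn_integral_h: "(\<integral>\<^sup>+x. h x \<partial>gauss) = gauss_L1_norm (M_loc f) + ennreal \<delta>"
  unfolding h_def gauss_L1_norm_def using gauss.emeasure_space_1 by (subst nn_integral_add) auto

lemma norm_F_le: "norm (F x) \<le> (LINT x|gauss. norm (f x))"
proof -
  have "norm (F x) \<le> (LINT y|gauss. norm (indicator {x..} y *\<^sub>R f y))"
    unfolding F_def set_lebesgue_integral_def by (rule integral_norm_bound)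
  also have "\<dots> \<le> (LINT y|gauss. norm (f y))"
    using f integrable_indicator_mult[OF f, of "{x..}"]
    by (intro integral_mono integrable_norm) (auto split: split_indicator)
  finally show ?thesis .
qed

lemma F_diff: "x \<le> y \<Longrightarrow> F x - F y = (LINT u:{x..y}|gauss. f u)"
proof -
  assume xy: "x \<le> y"
  have "F x - F y = (LINT u|gauss. indicator {x..} u *\<^sub>R f u - indicator {y..} u *\<^sub>R f u)"
    unfolding F_def set_lebesgue_integral_def
    by (intro Bochner_Integration.integral_diff[symmetric] integrable_indicator_mult f) auto
  also have "\<dots> = (LINT u:{x..y}|gauss. f u)"
    unfolding set_lebesgue_integral_def
  proof (rule integral_cong_AE)
    show "AE u in gauss. indicator {x..} u *\<^sub>R f u - indicator {y..} u *\<^sub>R f u = indicator {x..y} u *\<^sub>R f u"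
      unfolding AE_gauss using AE_lborel_singleton[of y]
      by eventually_elim (use xy in \<open>auto split: split_indicator\<close>)
  qed auto
  finally show ?thesis .
qed

text \<open>Mean zero turns the right tail into minus the left tail, so at negative points F is the
  left tail measured by E.\<close>

lemma F_eq_left_tail: "norm (F x) = norm (LINT y:{..x}|gauss. f y)"
proof -
  have "F x + (LINT y:{..x}|gauss. f y) = (LINT u|gauss. indicator {x..} u *\<^sub>R f u + indicator {..x} u *\<^sub>R f u)"
    unfolding F_def set_lebesgue_integral_def
    by (intro Bochner_Integration.integral_add[symmetric] integrable_indicator_mult f) auto
  also have "\<dots> = (LINT u|gauss. f u)"
  proof (rule integral_cong_AE)
    show "AE u in gauss. indicator {x..} u *\<^sub>R f u + indicator {..x} u *\<^sub>R f u = f u"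
      unfolding AE_gauss using AE_lborel_singleton[of x]
      by eventually_elim (auto split: split_indicator)
  qed auto
  finally have "F x = - (LINT y:{..x}|gauss. f y)" using mean0 by (simp add: eq_neg_iff_add_eq_0)
  then show ?thesis by simp
qed

text \<open>For |x| > 1 the weight 1 + |x| is at most 2 |x| and E applies. On [-1, 1], where the
  weight of E degenerates, F is bounded by the L1 norm of f, giving 2 * 2 times that norm.\<close>

lemma nn_integral_F_le:
  "(\<integral>\<^sup>+x. ennreal ((1 + \<bar>x\<bar>) * norm (F x)) \<partial>lborel)
     \<le> 4 * ennreal (LINT x|gauss. norm (f x)) + 2 * E_functional f"
proof -
  let ?N = "LINT x|gauss. norm (f x)"
  let ?r = "\<lambda>x. ennreal (x * norm (LINT y:{x..}|gauss. f y)) * indicator {0..} x"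
  let ?l = "\<lambda>x. ennreal (x * norm (LINT y:{..-x}|gauss. f y)) * indicator {0..} x"
  have N: "0 \<le> ?N" by simp
  have le: "ennreal ((1 + \<bar>x\<bar>) * norm (F x)) \<le> ennreal (2 * ?N) * indicator {-1..1} x + 2 * (?r x + ?l (- x))" for x
  proof -
    consider "x \<in> {-1..1}" | "1 < x" | "x < -1" by force
    then show ?thesis
    proof cases
      case 1
      have "(1 + \<bar>x\<bar>) * norm (F x) \<le> 2 * ?N" using 1 norm_F_le[of x] by (intro mult_mono) auto
      then have "ennreal ((1 + \<bar>x\<bar>) * norm (F x)) \<le> ennreal (2 * ?N)" by (rule ennreal_leI)
      then show ?thesis using 1 by (simp add: add_increasing2)
    next
      case 2
      have "(1 + \<bar>x\<bar>) * norm (F x) \<le> (2 * x) * norm (F x)" using 2 by (intro mult_right_mono) auto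
      then have "ennreal ((1 + \<bar>x\<bar>) * norm (F x)) \<le> ennreal (2 * (x * norm (F x)))" by (intro ennreal_leI) simp
      also have "\<dots> = 2 * ?r x" using 2 by (simp add: ennreal_mult F_def)
      also have "\<dots> \<le> ennreal (2 * ?N) * indicator {-1..1} x + 2 * (?r x + ?l (- x))"
        by (intro add_increasing mult_left_mono add_increasing2) auto
      finally show ?thesis .
    next
      case 3
      have "(1 + \<bar>x\<bar>) * norm (F x) \<le> (2 * - x) * norm (F x)" using 3 by (intro mult_right_mono) auto
      then have "ennreal ((1 + \<bar>x\<bar>) * norm (F x)) \<le> ennreal (2 * (- x * norm (F x)))" by (intro ennreal_leI) simp
      also have "\<dots> = 2 * ennreal (- x * norm (F x))"
      proof -
        have "0 \<le> - x * norm (F x)" using 3 by (intro mult_nonneg_nonneg) auto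
        then show ?thesis by (subst ennreal_mult) auto
      qed
      also have "ennreal (- x * norm (F x)) = ?l (- x)" using 3 by (simp add: F_eq_left_tail)
      also have "2 * ?l (- x) \<le> ennreal (2 * ?N) * indicator {-1..1} x + 2 * (?r x + ?l (- x))"
        by (intro add_increasing mult_left_mono add_increasing) auto
      finally show ?thesis .
    qed
  qed
  have m [measurable]: "?r \<in> borel_measurable borel" "?l \<in> borel_measurable borel" by measurable
  have "(\<integral>\<^sup>+x. ennreal ((1 + \<bar>x\<bar>) * norm (F x)) \<partial>lborel)
     \<le> (\<integral>\<^sup>+x. ennreal (2 * ?N) * indicator {-1..1} x + 2 * (?r x + ?l (- x)) \<partial>lborel)"
    by (rule nn_integral_mono[OF le])
  also have "\<dots> = (\<integral>\<^sup>+x. ennreal (2 * ?N) * indicator {-1..1::real} x \<partial>lborel) + (\<integral>\<^sup>+x. 2 * (?r x + ?l (- x)) \<partial>lborel)"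
    by (rule nn_integral_add) measurable
  also have "(\<integral>\<^sup>+x. 2 * (?r x + ?l (- x)) \<partial>lborel) = 2 * ((\<integral>\<^sup>+x. ?r x \<partial>lborel) + (\<integral>\<^sup>+x. ?l (- x) \<partial>lborel))"
    by (subst nn_integral_cmult) (auto simp: nn_integral_add)
  also have "(\<integral>\<^sup>+x. ?l (- x) \<partial>lborel) = (\<integral>\<^sup>+x. ?l x \<partial>lborel)"
    using nn_integral_real_affine[of ?l "-1" 0] m by simp
  also have "(\<integral>\<^sup>+x. ?r x \<partial>lborel) + (\<integral>\<^sup>+x. ?l x \<partial>lborel) = (\<integral>\<^sup>+x. ?r x + ?l x \<partial>lborel)"
    by (rule nn_integral_add[symmetric]) measurable
  also have "\<dots> = E_functional f"
    unfolding E_functional_eq by (intro nn_integral_cong) (auto simp: distrib_left split: split_indicator)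
  also have "(\<integral>\<^sup>+x. ennreal (2 * ?N) * indicator {-1..1::real} x \<partial>lborel) = ennreal (2 * ?N) * 2"
    by (subst nn_integral_cmult_indicator) auto
  also have "\<dots> = 4 * ennreal ?N"
    using N by (simp add: ennreal_mult mult.commute mult.left_commute)
  finally show ?thesis .
qed

lemma Rtot_le: "Rtot \<le> ennreal (2000000 * exp 9) * (gauss_L1_norm (M_loc f) + E_functional f + ennreal \<delta>)"
proof -
  let ?M = "gauss_L1_norm (M_loc f)" and ?E = "E_functional f"
  have "Rtot \<le> (?M + ennreal \<delta>) + ennreal wt * (4 * (ennreal (264 * exp 3) * ?M) + 2 * ?E)"
    unfolding Rtot_def nn_integral_h
    by (intro add_left_mono mult_left_mono order_trans[OF nn_integral_F_le] add_right_mono L1_norm_le_M_loc[OF f]) auto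
  also have "\<dots> = ?M + ennreal \<delta> + ennreal (wt * 4 * (264 * exp 3)) * ?M + ennreal (wt * 2) * ?E"
  proof -
    have gen: "ennreal (a * 4 * c) = ennreal a * 4 * ennreal c" "ennreal (a * 2) = ennreal a * 2"
      if "0 \<le> a" "0 \<le> c" for a c
      using that by (simp_all add: ennreal_mult)
    have "ennreal (wt * 4 * (264 * exp 3)) = ennreal wt * 4 * ennreal (264 * exp 3)" "ennreal (wt * 2) = ennreal wt * 2"
      by (intro gen[of wt "264 * exp 3"]; simp)+
    then show ?thesis by (simp only: distrib_left mult.assoc add.assoc)
  qed
  also have "\<dots> \<le> ennreal (exp 9) * ?M + ennreal (2000000 * exp 9) * ennreal \<delta>
      + ennreal (1900000 * exp 9) * ?M + ennreal (2000000 * exp 9) * ?E"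
  proof (intro add_mono mult_right_mono)
    have "ennreal 1 \<le> ennreal (exp 9)" by (intro ennreal_leI) simp
    then show "?M \<le> ennreal (exp 9) * ?M" using mult_right_mono[of 1 "ennreal (exp 9)" ?M] by simp
    have "(1::real) \<le> 2000000 * exp 9" using exp_ge_add_one_self[of 9] by simp
    then have "ennreal 1 \<le> ennreal (2000000 * exp 9)" by (rule ennreal_leI)
    then show "ennreal \<delta> \<le> ennreal (2000000 * exp 9) * ennreal \<delta>"
      using mult_right_mono[of 1 "ennreal (2000000 * exp 9)" "ennreal \<delta>"] by simp
    have "exp 6 * exp 3 = exp (9 :: real)" by (simp flip: exp_add)
    \<comment> \<open>The coefficient of the maximal function is 1024 * 4 * 264 = 1081344; rounding
      to 1900000 leaves room for the remaining \<open>exp 9\<close>.\<close>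
    then have "wt * 4 * (264 * exp 3) = 1081344 * exp 9" by simp
    then show "ennreal (wt * 4 * (264 * exp 3)) \<le> ennreal (1900000 * exp 9)" by (intro ennreal_leI) simp
    have "exp 6 \<le> exp (9::real)" by simp
    then have "wt * 2 \<le> 2000000 * exp 9" using exp_gt_zero[of "6::real"] by argo
    then show "ennreal (wt * 2) \<le> ennreal (2000000 * exp 9)" by (rule ennreal_leI)
  qed auto
  also have "\<dots> = ennreal (exp 9 + 1900000 * exp 9) * ?M + ennreal (2000000 * exp 9) * ennreal \<delta> + ennreal (2000000 * exp 9) * ?E"
  proof -
    have gen: "ennreal p * m + d + ennreal q * m + e = ennreal (p + q) * m + d + e"
      if "0 \<le> p" "0 \<le> q" for p q and m d e :: ennreal
      using that by (simp add: distrib_left distrib_right ac_simps)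
    show ?thesis by (rule gen) auto
  qed
  also have "\<dots> \<le> ennreal (2000000 * exp 9) * ?M + ennreal (2000000 * exp 9) * ennreal \<delta> + ennreal (2000000 * exp 9) * ?E"
    by (intro add_right_mono mult_right_mono ennreal_leI) auto
  also have "\<dots> = ennreal (2000000 * exp 9) * (?M + ?E + ennreal \<delta>)"
    by (simp only: distrib_left add_ac)
  finally show ?thesis .
qed

lemma Rtot_finite: "Rtot < \<infinity>"
proof -
  have "ennreal (2000000 * exp 9) * (gauss_L1_norm (M_loc f) + E_functional f + ennreal \<delta>) < \<infinity>"
    using M_finite E_finite by (simp add: ennreal_mult_less_top)
  then show ?thesis using Rtot_le by (rule order_le_less_trans[rotated])
qed

lemma half_less: "grid j < half j" "half j < grid (j + 1)"
  unfolding half_def using grid_less[of j "j + 1"] by (simp_all del: grid_less)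

lemma W_disjoint: "x \<in> W i \<Longrightarrow> x \<in> W j \<Longrightarrow> i = j"
proof (rule ccontr)
  assume x: "x \<in> W i" "x \<in> W j" and "i \<noteq> j"
  have *: False if "x \<in> W i" "x \<in> W j" "i < j" for i j
  proof -
    have "grid (i + 1) \<le> grid j" using that(3) by simp
    moreover have "grid j \<le> x" "x \<le> half i" using that(1,2) by simp_all
    ultimately show False using half_less(2)[of i] by linarith
  qed
  show False
  proof (cases "i < j")
    case True
    then show False by (rule *[OF x])
  next
    case False
    then have "j < i" using \<open>i \<noteq> j\<close> by simp
    then show False by (rule *[OF x(2,1)])
  qed
qed

text \<open>The half cells are disjoint, so no point is counted twice.\<close>

lemma sum_R_le:
  assumes "finite B"
  shows "(\<Sum>j\<in>B. R j) \<le> Rtot"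
proof -
  have ind: "(\<Sum>j\<in>B. indicator (W j) x) \<le> (1 :: ennreal)" for x
  proof (cases "\<exists>j\<in>B. x \<in> W j")
    case True
    then obtain j where j: "j \<in> B" "x \<in> W j" by auto
    have "indicator (W k) x = (if k = j then 1 else 0 :: ennreal)" for k
    proof (cases "k = j")
      case True
      then show ?thesis using j(2) by simp
    next
      case False
      then have "x \<notin> W k" using W_disjoint[OF _ j(2)] by blast
      then show ?thesis using False by simp
    qed
    then have "(\<Sum>j\<in>B. indicator (W j) x) = (\<Sum>k\<in>B. if k = j then 1 else 0 :: ennreal)" by simp
    also have "\<dots> \<le> 1" using assms by (simp add: sum.delta)
    finally show ?thesis .
  next
    case False
    then have "(\<Sum>j\<in>B. indicator (W j) x) = (0 :: ennreal)"
      by (intro sum.neutral ballI indicator_simps(2)) blast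
    then show ?thesis by simp
  qed
  have le: "(\<Sum>j\<in>B. \<integral>\<^sup>+x. g x * indicator (W j) x \<partial>N) \<le> (\<integral>\<^sup>+x. g x \<partial>N)"
    if [measurable]: "g \<in> borel_measurable borel" and N: "sets N = sets borel" for g :: "real \<Rightarrow> ennreal" and N
  proof -
    note [measurable_cong] = N
    have "(\<Sum>j\<in>B. \<integral>\<^sup>+x. g x * indicator (W j) x \<partial>N) = (\<integral>\<^sup>+x. (\<Sum>j\<in>B. g x * indicator (W j) x) \<partial>N)"
      by (rule nn_integral_sum[symmetric]) measurable
    also have "\<dots> = (\<integral>\<^sup>+x. g x * (\<Sum>j\<in>B. indicator (W j) x) \<partial>N)"
      by (simp add: sum_distrib_left)
    also have "\<dots> \<le> (\<integral>\<^sup>+x. g x * 1 \<partial>N)"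
      by (intro nn_integral_mono mult_left_mono ind) auto
    finally show ?thesis by simp
  qed
  have "(\<Sum>j\<in>B. R j) = (\<Sum>j\<in>B. \<integral>\<^sup>+x. h x * indicator (W j) x \<partial>gauss)
    + ennreal wt * (\<Sum>j\<in>B. \<integral>\<^sup>+x. ennreal ((1 + \<bar>x\<bar>) * norm (F x)) * indicator (W j) x \<partial>lborel)"
    unfolding R_def by (simp only: sum.distrib sum_distrib_left)
  also have "\<dots> \<le> Rtot"
    unfolding Rtot_def by (intro add_mono mult_left_mono le) auto
  finally show ?thesis .
qed

lemma R_le: "R j \<le> Rtot"
  using sum_R_le[of "{j}"] by simp

lemma measure_W_pos: "0 < measure gauss (W j)"
  using half_less by (intro measure_gauss_pos)

lemma R_pos: "0 < R j"
proof -
  have "0 < ennreal \<delta> * ennreal (measure gauss (W j))"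
    using \<delta> measure_W_pos[of j] by (simp add: ennreal_zero_less_mult_iff)
  also have "\<dots> = (\<integral>\<^sup>+x. ennreal \<delta> * indicator (W j) x \<partial>gauss)"
    by (subst nn_integral_cmult_indicator) (auto simp: gauss.emeasure_eq_measure)
  also have "\<dots> \<le> (\<integral>\<^sup>+x. h x * indicator (W j) x \<partial>gauss)"
    by (intro nn_integral_mono mult_right_mono) (auto simp: h_def)
  also have "\<dots> \<le> R j" unfolding R_def by simp
  finally show ?thesis .
qed

text \<open>A half cell has length at least a multiple of 1 / (1 + |x|), so its measure is at least
  that multiple of \<open>gdens x\<close> / (1 + |x|). This converts a Gauss average of F into the
  Lebesgue integral with weight 1 + |x|.\<close>

lemma gdens_le_on_W:
  assumes x: "x \<in> W j"
  shows "gdens x \<le> measure gauss (W j) * (wt * (1 + \<bar>x\<bar>))"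
proof -
  have sub: "y \<in> {grid j..grid (j + 3)}" if "y \<in> W j" for y
  proof -
    have "half j \<le> grid (j + 3)" using half_less(2)[of j] grid_le[of "j + 1" "j + 3"] by linarith
    then show ?thesis using that by auto
  qed
  have near: "\<bar>x - y\<bar> \<le> admissible_radius x" if "y \<in> W j" for y
    using grid_three_less_admissible_radius[OF sub[OF x]] sub[OF x] sub[OF that] by auto
  have xin: "x \<in> {grid j..grid (j + 1)}" using x half_less(2)[of j] by auto
  have len: "half j - grid j = (grid (j + 1) - grid j) / 2" by (simp add: half_def field_simps)
  have "1 \<le> 1024 * ((half j - grid j) * (1 + \<bar>x\<bar>))"
  proof -
    have "1024 * ((half j - grid j) * (1 + \<bar>x\<bar>)) = 512 * ((grid (j + 1) - grid j) * (1 + \<bar>x\<bar>))"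
      unfolding len by simp
    then show ?thesis using grid_step(1)[OF xin] by argo
  qed
  then have "gdens x * 1 \<le> gdens x * (1024 * ((half j - grid j) * (1 + \<bar>x\<bar>)))"
    by (rule mult_left_mono) simp
  also have "\<dots> \<le> (exp 3 * gdens x) * (1024 * ((half j - grid j) * (1 + \<bar>x\<bar>)))"
    using half_less(1)[of j] by (intro mult_right_mono) auto
  also have "\<dots> = (exp (- 3) * gdens x * (half j - grid j)) * (wt * (1 + \<bar>x\<bar>))"
  proof -
    have "exp 3 = exp 6 * exp (- 3 :: real)" by (simp flip: exp_add)
    then show ?thesis by simp
  qed
  also have "\<dots> \<le> measure gauss (W j) * (wt * (1 + \<bar>x\<bar>))"
    using near half_less(1)[of j] by (intro mult_right_mono measure_gauss_interval(2)) auto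
  finally show ?thesis by simp
qed

text \<open>One point must serve both \<open>M_loc\<close> and F, so the average is taken of their
  combination; scaling h by the measure of the half cell puts both terms on the scale of
  \<open>R j\<close>.\<close>

lemma exists_good_point:
  "\<exists>x\<in>W j. h x * ennreal (measure gauss (W j)) + ennreal (norm (F x)) \<le> 2 * R j"
proof (rule exists_point_le_average[OF _ _ measure_W_pos _ R_pos])
  let ?G = "measure gauss (W j)"
  let ?e = "\<lambda>x. ennreal ((1 + \<bar>x\<bar>) * norm (F x)) * indicator (W j) x"
  have "(\<integral>\<^sup>+x. (h x * ennreal ?G + ennreal (norm (F x))) * indicator (W j) x \<partial>gauss)
     = (\<integral>\<^sup>+x. ennreal ?G * (h x * indicator (W j) x) + ennreal (norm (F x)) * indicator (W j) x \<partial>gauss)"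
  proof (rule nn_integral_cong)
    have "(p * g + n) * i = g * (p * i) + n * i" for p g n i :: ennreal
      by (metis distrib_right mult.assoc mult.commute)
    then show "(h x * ennreal ?G + ennreal (norm (F x))) * indicator (W j) x
      = ennreal ?G * (h x * indicator (W j) x) + ennreal (norm (F x)) * indicator (W j) x" for x .
  qed
  also have "\<dots> = ennreal ?G * (\<integral>\<^sup>+x. h x * indicator (W j) x \<partial>gauss) + (\<integral>\<^sup>+x. ennreal (norm (F x)) * indicator (W j) x \<partial>gauss)"
    by (subst nn_integral_add) (auto simp: nn_integral_cmult)
  also have "(\<integral>\<^sup>+x. ennreal (norm (F x)) * indicator (W j) x \<partial>gauss)
     = (\<integral>\<^sup>+x. ennreal (gdens x) * (ennreal (norm (F x)) * indicator (W j) x) \<partial>lborel)"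
    by (rule nn_integral_gauss) simp
  also have "\<dots> \<le> (\<integral>\<^sup>+x. ennreal (?G * wt) * ?e x \<partial>lborel)"
  proof (rule nn_integral_mono)
    fix x
    have "gdens x * norm (F x) \<le> (?G * wt) * ((1 + \<bar>x\<bar>) * norm (F x))" if "x \<in> W j"
      using mult_right_mono[OF gdens_le_on_W[OF that], of "norm (F x)"] by (simp add: ac_simps)
    then show "ennreal (gdens x) * (ennreal (norm (F x)) * indicator (W j) x) \<le> ennreal (?G * wt) * ?e x"
      by (auto simp: ennreal_mult[symmetric] split: split_indicator intro!: ennreal_leI)
  qed
  also have "\<dots> = ennreal ?G * (ennreal wt * (\<integral>\<^sup>+x. ?e x \<partial>lborel))"
    by (subst nn_integral_cmult) (auto simp: ennreal_mult mult.assoc)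
  finally show "(\<integral>\<^sup>+x. (h x * ennreal ?G + ennreal (norm (F x))) * indicator (W j) x \<partial>gauss) \<le> R j * ennreal ?G"
    unfolding R_def by (simp add: distrib_left distrib_right ac_simps)
  show "R j < \<infinity>" using R_le Rtot_finite by (rule order_le_less_trans)
qed simp_all

section \<open>Cut points and the intervals between them\<close>

definition pt :: "int \<Rightarrow> real" where
  "pt j = (SOME x. x \<in> W j \<and> h x * ennreal (measure gauss (W j)) + ennreal (norm (F x)) \<le> 2 * R j)"

lemma pt: "pt j \<in> W j" "h (pt j) * ennreal (measure gauss (W j)) + ennreal (norm (F (pt j))) \<le> 2 * R j"
proof -
  have "\<exists>x. x \<in> W j \<and> h x * ennreal (measure gauss (W j)) + ennreal (norm (F x)) \<le> 2 * R j"
    using exists_good_point[of j] by blast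
  from someI_ex[OF this] show "pt j \<in> W j" "h (pt j) * ennreal (measure gauss (W j)) + ennreal (norm (F (pt j))) \<le> 2 * R j"
    unfolding pt_def by auto
qed

lemma pt_h: "h (pt j) * ennreal (measure gauss (W j)) \<le> 2 * R j"
  and pt_F: "ennreal (norm (F (pt j))) \<le> 2 * R j"
  using pt(2)[of j] by (auto intro: order_trans[rotated] simp: add_increasing add_increasing2)

lemma pt_grid: "grid j \<le> pt j" "pt j \<le> half j" "pt j < grid (j + 1)" "pt j < pt (j + 1)"
proof -
  show "grid j \<le> pt j" "pt j \<le> half j" using pt(1)[of j] by auto
  then show "pt j < grid (j + 1)" using half_less(2)[of j] by linarith
  then show "pt j < pt (j + 1)" using pt(1)[of "j + 1"] by auto
qed

lemma pt_mono: "i < j \<Longrightarrow> pt i < pt j"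
proof -
  assume "i < j"
  then have "grid (i + 1) \<le> grid j" by simp
  then show ?thesis using pt_grid(3)[of i] pt_grid(1)[of j] by linarith
qed

abbreviation J :: "int \<Rightarrow> real set" where
  "J j \<equiv> {pt j..pt (j + 1)}"

lemma J_subset: "{pt j..pt (j + 2)} \<subseteq> {grid j..grid (j + 3)}"
  using pt_grid(1)[of j] pt_grid(3)[of "j + 2"] by (auto simp: add.assoc)

lemma pt_order: "pt j < pt (j + 1)" "pt (j + 1) < pt (j + 2)"
  by (intro pt_mono; simp)+

lemma measure_J_pos: "0 < measure gauss (J j)"
  by (rule measure_gauss_pos[OF pt_order(1)])

lemma measure_J_le: "measure gauss (J j) \<le> cmp * measure gauss (W j)" "measure gauss (J j) \<le> cmp * measure gauss (W (j + 1))"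
proof -
  have J: "J j \<subseteq> {grid j..grid (j + 3)}" using J_subset[of j] pt_order[of j] by auto
  have g: "half j \<le> grid (j + 3)" "half (j + 1) \<le> grid (j + 3)" "grid j \<le> grid (j + 1)"
    using half_less(2)[of j] half_less(2)[of "j + 1"] grid_le[of "j + 1" "j + 3"] grid_le[of "j + 1 + 1" "j + 3"] grid_le[of j "j + 1"]
    by linarith+
  have len: "(grid (i + 1) - grid i) / 2 \<le> half i - grid i" for i by (simp add: half_def field_simps)
  show "measure gauss (J j) \<le> cmp * measure gauss (W j)"
    using J g half_less(1)[of j] pt_order(1)[of j] by (intro measure_gauss_comparable[of j j] len) auto
  show "measure gauss (J j) \<le> cmp * measure gauss (W (j + 1))"
    using J g half_less(1)[of "j + 1"] pt_order(1)[of j] by (intro measure_gauss_comparable[of "j + 1" j] len) auto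
qed

text \<open>Each interval is at least half a cell long because its left end lies in a left half, and
  both together stay within three cells.\<close>

lemma measure_double_le:
  "measure gauss {pt j..pt (j + 2)} \<le> cmp * measure gauss (J j)"
  "measure gauss {pt j..pt (j + 2)} \<le> cmp * measure gauss (J (j + 1))"
proof -
  have len: "(grid (i + 1) - grid i) / 2 \<le> pt (i + 1) - pt i" for i
  proof -
    have "(grid (i + 1) - grid i) / 2 = grid (i + 1) - half i" by (simp add: half_def field_simps)
    then show ?thesis using pt_grid(2)[of i] pt_grid(1)[of "i + 1"] by linarith
  qed
  have J: "J j \<subseteq> {grid j..grid (j + 3)}" "{pt (j + 1)..pt (j + 2)} \<subseteq> {grid j..grid (j + 3)}"
    using J_subset[of j] pt_order[of j] by auto
  show "measure gauss {pt j..pt (j + 2)} \<le> cmp * measure gauss (J j)"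
    using J pt_order[of j] by (intro measure_gauss_comparable[of j j] J_subset len) auto
  have "j + 1 + 1 = j + 2" by simp
  have "measure gauss {pt j..pt (j + 2)} \<le> cmp * measure gauss {pt (j + 1)..pt (j + 2)}"
  proof (rule measure_gauss_comparable[of "j + 1" j])
    show "(grid (j + 1 + 1) - grid (j + 1)) / 2 \<le> pt (j + 2) - pt (j + 1)"
      using len[of "j + 1"] by (simp only: \<open>j + 1 + 1 = j + 2\<close>)
  qed (use J pt_order[of j] J_subset[of j] in \<open>simp_all only: less_imp_le\<close>, simp_all)
  then show "measure gauss {pt j..pt (j + 2)} \<le> cmp * measure gauss (J (j + 1))"
    by (simp only: \<open>j + 1 + 1 = j + 2\<close>)
qed

lemma h_pt_finite: "h (pt j) < \<infinity>"
proof (rule ccontr)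
  assume "\<not> ?thesis"
  then have "h (pt j) * ennreal (measure gauss (W j)) = \<infinity>"
    using measure_W_pos[of j] by (simp add: not_less top_unique ennreal_top_mult ennreal_eq_0_iff)
  moreover have "2 * R j < \<infinity>"
    using order_le_less_trans[OF R_le Rtot_finite] by (simp add: ennreal_mult_less_top)
  ultimately show False using pt_h[of j] by (simp add: top_unique)
qed

text \<open>The sum of the values of h at both ends is positive, finite and bounds
  \<open>M_loc\<close> at either end, as required of a height L.\<close>

definition height :: "int \<Rightarrow> real" where
  "height j = enn2real (h (pt j) + h (pt (j + 1)))"

lemma ennreal_height: "ennreal (height j) = h (pt j) + h (pt (j + 1))"
  unfolding height_def using h_pt_finite by (intro ennreal_enn2real) (simp add: less_top)

lemma height_pos: "0 < height j"
proof -
  have "ennreal \<delta> \<le> h (pt j)" unfolding h_def by (rule add_increasing) auto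
  also have "\<dots> \<le> ennreal (height j)" unfolding ennreal_height by (rule add_increasing2) auto
  finally have "ennreal \<delta> \<le> ennreal (height j)" .
  then show ?thesis using \<delta> by (simp add: ennreal_le_iff2)
qed

lemma good_interval_J: "good_interval f (pt j) (pt (j + 1)) (height j)"
proof
  show "integrable gauss f" by (rule f)
  show "pt j < pt (j + 1)" by (rule pt_order)
  show "pt (j + 1) - pt j < admissible_radius x" if "x \<in> J j" for x
  proof -
    have "J j \<subseteq> {grid j..grid (j + 3)}" using J_subset[of j] pt_order[of j] by auto
    moreover have "pt j \<in> J j" "pt (j + 1) \<in> J j" using pt_order[of j] by auto
    ultimately have "pt j \<in> {grid j..grid (j + 3)}" "pt (j + 1) \<in> {grid j..grid (j + 3)}" "x \<in> {grid j..grid (j + 3)}"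
      using that by blast+
    then show ?thesis using grid_three_less_admissible_radius[of x j] by auto
  qed
  show "0 < height j" by (rule height_pos)
  show "M_loc f (pt j) \<le> ennreal (height j)" "M_loc f (pt (j + 1)) \<le> ennreal (height j)"
    unfolding ennreal_height h_def by (auto intro!: add_increasing add_increasing2 simp: add.assoc)
  have "(\<integral>\<^sup>+x. M_loc f x * indicator (J j) x \<partial>gauss) \<le> gauss_L1_norm (M_loc f)"
    unfolding gauss_L1_norm_def by (intro nn_integral_mono) (auto split: split_indicator)
  then show "(\<integral>\<^sup>+x. M_loc f x * indicator (J j) x \<partial>gauss) < \<infinity>"
    using M_finite by (rule order_le_less_trans)
qed

section \<open>Pieces of the decomposition and their costs\<close>

definition avg :: "int \<Rightarrow> complex" where
  "avg j = (LINT u:J j|gauss. f u) /\<^sub>R measure gauss (J j)"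

text \<open>
  The first kind of piece oscillates on a single cell; pieces of the second kind telescope and move
  the mass of one cell to the next.
\<close>

definition piece :: "int \<times> bool \<Rightarrow> real \<Rightarrow> complex" where
  "piece = (\<lambda>(j, b) x. if b
    then F (pt (j + 1)) * of_real (indicator (J (j + 1)) x / measure gauss (J (j + 1)) - indicator (J j) x / measure gauss (J j))
    else indicator (J j) x *\<^sub>R (f x - avg j))"

abbreviation KA :: real where "KA \<equiv> 6 * (86 * exp 9)"

definition cost :: "int \<times> bool \<Rightarrow> ennreal" where
  "cost = (\<lambda>(j, b). if b then ennreal (4 * cmp) * R (j + 1)
    else ennreal KA * (ennreal (2 * cmp) * (R j + R (j + 1)) + (\<integral>\<^sup>+x. M_loc f x * indicator (J j) x \<partial>gauss)))"

text \<open>The term height times measure splits into the two ends; the measure of the interval is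
  compared with the half cell in which each end was chosen, where the choice of the point gives at
  most 2 R.\<close>

lemma gauss_H1_le_cell: "gauss_H1_le (piece (j, False)) (cost (j, False))"
proof -
  interpret good_interval f "pt j" "pt (j + 1)" "height j" by (rule good_interval_J)
  have "ennreal (height j * measure gauss (J j)) = (h (pt j) + h (pt (j + 1))) * ennreal (measure gauss (J j))"
    using height_pos[of j] by (simp add: ennreal_mult ennreal_height)
  also have "\<dots> = h (pt j) * ennreal (measure gauss (J j)) + h (pt (j + 1)) * ennreal (measure gauss (J j))"
    by (rule distrib_right)
  also have "\<dots> \<le> h (pt j) * ennreal (cmp * measure gauss (W j)) + h (pt (j + 1)) * ennreal (cmp * measure gauss (W (j + 1)))"
    by (intro add_mono mult_left_mono ennreal_leI measure_J_le) auto
  also have "\<dots> = ennreal cmp * (h (pt j) * ennreal (measure gauss (W j)) + h (pt (j + 1)) * ennreal (measure gauss (W (j + 1))))"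
    by (simp only: ennreal_mult'' measure_nonneg distrib_left mult.left_commute)
  also have "\<dots> \<le> ennreal cmp * (2 * R j + 2 * R (j + 1))"
    by (intro mult_left_mono add_mono pt_h) auto
  also have "\<dots> = ennreal (2 * cmp) * (R j + R (j + 1))"
  proof -
    have gen: "ennreal (2 * c) = ennreal c * 2" if "0 \<le> c" for c
      using that by (simp add: ennreal_mult mult.commute)
    have "ennreal (2 * cmp) = ennreal cmp * 2" by (rule gen) simp
    then show ?thesis by (simp only: distrib_left mult.assoc)
  qed
  finally have "ennreal (height j * measure gauss (J j)) \<le> ennreal (2 * cmp) * (R j + R (j + 1))" .
  then have "ennreal KA * (ennreal (height j * measure gauss (J j)) + (\<integral>\<^sup>+x. M_loc f x * indicator (J j) x \<partial>gauss)) \<le> cost (j, False)"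
    unfolding cost_def prod.case if_False by (intro mult_left_mono add_right_mono) auto
  moreover have "piece (j, False) = (\<lambda>x. indicator (J j) x *\<^sub>R (f x - mean (J j)))"
    by (simp add: piece_def avg_def mean_def)
  ultimately show ?thesis using gauss_H1_le_interval by (simp only: gauss_H1_le_mono)
qed

text \<open>Both normalised indicators have integral 1, so their difference has mean zero, and it is
  supported in an admissible interval. Each of its two heights times the total measure is at most
  \<open>cmp\<close>, and |F| <= 2 R at the cut point gives 4 \<open>cmp\<close> R.\<close>

lemma gauss_H1_le_transfer: "gauss_H1_le (piece (j, True)) (cost (j, True))"
proof -
  let ?G0 = "measure gauss (J j)" and ?G1 = "measure gauss (J (j + 1))" and ?S = "{pt j..pt (j + 2)}"
  let ?u = "\<lambda>x. indicator (J (j + 1)) x / ?G1 - indicator (J j) x / ?G0 :: real"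
  let ?F = "norm (F (pt (j + 1)))"
  have e: "j + 1 + 1 = j + 2" by simp
  have G: "0 < ?G0" "0 < ?G1" by (rule measure_J_pos)+
  have "gauss_H1_le (\<lambda>x. F (pt (j + 1)) * of_real (?u x)) (ennreal (?F * (1 / ?G1 + 1 / ?G0) * measure gauss ?S))"
  proof (rule gauss_H1_le_mean_zero)
    show "pt j < pt (j + 2)" using pt_order[of j] by simp
    have "(pt j + pt (j + 2)) / 2 \<in> ?S" using pt_order[of j] by (auto simp: field_simps)
    then have "(pt j + pt (j + 2)) / 2 \<in> {grid j..grid (j + 3)}" using J_subset by blast
    then have "grid (j + 3) - grid j < admissible_radius ((pt j + pt (j + 2)) / 2)"
      by (rule grid_three_less_admissible_radius)
    moreover have "pt (j + 2) - pt j \<le> grid (j + 3) - grid j"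
      using pt_grid(1)[of j] pt_grid(3)[of "j + 2"] by (simp add: add.assoc)
    moreover have "(pt (j + 2) - pt j) / 2 \<le> pt (j + 2) - pt j" using pt_order[of j] by simp
    ultimately show "(pt (j + 2) - pt j) / 2 \<le> admissible_radius ((pt j + pt (j + 2)) / 2)"
      by (meson less_imp_le order_trans)
    show "(\<lambda>x. F (pt (j + 1)) * of_real (?u x)) \<in> borel_measurable borel" by measurable
    show "AE x in gauss. norm (F (pt (j + 1)) * of_real (?u x)) \<le> ?F * (1 / ?G1 + 1 / ?G0) * indicator ?S x"
    proof (intro always_eventually allI)
      fix x
      show "norm (F (pt (j + 1)) * of_real (?u x)) \<le> ?F * (1 / ?G1 + 1 / ?G0) * indicator ?S x"
      proof (cases "x \<in> ?S")
        case True
        have "\<bar>?u x\<bar> \<le> \<bar>indicator (J (j + 1)) x / ?G1\<bar> + \<bar>indicator (J j) x / ?G0\<bar>"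
          by (rule abs_triangle_ineq4)
        also have "\<dots> \<le> 1 / ?G1 + 1 / ?G0"
          using G by (intro add_mono) (auto simp: abs_divide indicator_def)
        finally have "?F * \<bar>?u x\<bar> \<le> ?F * (1 / ?G1 + 1 / ?G0)" by (rule mult_left_mono) simp
        then show ?thesis using True by (simp only: norm_mult norm_of_real indicator_simps mult_1_right)
      next
        case False
        then have "?u x = 0" using pt_order[of j] unfolding e by (auto simp: indicator_def)
        moreover have "indicator ?S x = (0 :: real)" using False by simp
        ultimately show ?thesis by (simp only: of_real_0 mult_zero_right norm_zero order_refl)
      qed
    qed
    have int: "integrable gauss (indicator {a..b} :: real \<Rightarrow> real)" for a b
      by (simp add: integrable_indicator_iff less_top[symmetric])
    have "(LINT x|gauss. ?u x) = (LINT x|gauss. indicator (J (j + 1)) x / ?G1) - (LINT x|gauss. indicator (J j) x / ?G0)"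
      by (intro Bochner_Integration.integral_diff integrable_divide_zero) (simp_all add: int)
    also have "\<dots> = 0" using G by (simp add: int)
    finally show "(LINT x|gauss. F (pt (j + 1)) * of_real (?u x)) = 0"
      by (simp only: integral_mult_right_zero integral_complex_of_real) simp
  qed
  moreover have "piece (j, True) = (\<lambda>x. F (pt (j + 1)) * of_real (?u x))"
    by (simp add: piece_def)
  moreover have "ennreal (?F * (1 / ?G1 + 1 / ?G0) * measure gauss ?S) \<le> cost (j, True)"
  proof -
    have "(1 / ?G1 + 1 / ?G0) * measure gauss ?S = measure gauss ?S / ?G1 + measure gauss ?S / ?G0"
      by (simp add: field_simps)
    also have "\<dots> \<le> cmp + cmp"
      using measure_double_le[of j] G by (intro add_mono) (simp_all add: divide_le_eq e)
    finally have "?F * ((1 / ?G1 + 1 / ?G0) * measure gauss ?S) \<le> ?F * (cmp + cmp)"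
      by (rule mult_left_mono) simp
    then have "ennreal (?F * (1 / ?G1 + 1 / ?G0) * measure gauss ?S) \<le> ennreal (?F * (cmp + cmp))"
      by (intro ennreal_leI) (simp only: mult.assoc)
    also have "\<dots> = ennreal ?F * ennreal (cmp + cmp)" by (rule ennreal_mult) auto
    also have "\<dots> \<le> 2 * R (j + 1) * ennreal (cmp + cmp)" by (intro mult_right_mono pt_F) auto
    also have "\<dots> = cost (j, True)"
    proof -
      have "2 * r * ennreal (c + c) = ennreal (4 * c) * r" if "0 \<le> c" for c and r :: ennreal
        using that by (simp add: ennreal_mult mult_2[symmetric] ac_simps del: ennreal_plus)
      from this[of cmp "R (j + 1)"] show ?thesis unfolding cost_def by simp
    qed
    finally show ?thesis .
  qed
  ultimately show ?thesis by (simp only: gauss_H1_le_mono)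
qed

lemma AE_not_pt: "AE x in gauss. x \<notin> range pt"
  unfolding AE_gauss
  by (rule AE_not_in) (intro countable_imp_null_set_lborel countable_image countableI_type)

lemma J_unique: "x \<notin> range pt \<Longrightarrow> x \<in> J i \<Longrightarrow> x \<in> J j \<Longrightarrow> i = j"
proof (rule ccontr)
  assume x: "x \<notin> range pt" "x \<in> J i" "x \<in> J j" and "i \<noteq> j"
  have *: "False" if "x \<in> J i" "x \<in> J j" "i < j" for i j
  proof -
    have "pt (i + 1) \<le> pt j" using pt_mono[of "i + 1" j] that(3) by (cases "i + 1 = j") auto
    moreover have "x \<le> pt (i + 1)" "pt j \<le> x" using that(1,2) by simp_all
    ultimately have "x = pt j" by linarith
    then show False using x(1) by simp
  qed
  show False
  proof (cases "i < j")
    case True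
    then show False by (rule *[OF x(2,3)])
  next
    case False
    then have "j < i" using \<open>i \<noteq> j\<close> by simp
    then show False by (rule *[OF x(3,2)])
  qed
qed

text \<open>Off the cut points x lies in one interval, so only three pieces are nonzero: its
  oscillating piece and the transfers across its two ends. The transfers sum to the average that the
  first piece subtracts.\<close>

lemma AE_pieces_has_sum: "AE x in gauss. ((\<lambda>p. piece p x) has_sum f x) UNIV"
  using AE_not_pt
proof eventually_elim
  case (elim x)
  have "\<And>i. pt i \<le> grid (i + 1)" using pt_grid(3) by (simp add: less_imp_le)
  from exists_grid_cell[of pt x, OF pt_grid(1) this] obtain i where "pt i \<le> x" "x < pt (i + 1)" by blast
  then have i: "x \<in> J i" by simp
  have ind: "indicator (J j) x = (if j = i then 1 else 0 :: real)" for j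
    proof (cases "j = i")
      case True
      then show ?thesis using i by simp
    next
      case False
      then have "x \<notin> J j" using J_unique[OF elim _ i] by blast
      then show ?thesis using False by simp
    qed
  show ?case
  proof (rule has_sum_finite_neutralI[where B = "{(i, False), (i, True), (i - 1, True)}"])
    show "piece p x = 0" if "p \<in> UNIV - {(i, False), (i, True), (i - 1, True)}" for p
    proof (cases p)
      case (Pair j b)
      then have "(b \<longrightarrow> j \<noteq> i \<and> j + 1 \<noteq> i) \<and> (\<not> b \<longrightarrow> j \<noteq> i)" using that by auto
      then show ?thesis unfolding Pair piece_def prod.case ind by auto
    qed
    have "piece (i, False) x = f x - avg i" unfolding piece_def prod.case if_True if_False ind by simp
    moreover have "piece (i, True) x = - (F (pt (i + 1)) / of_real (measure gauss (J i)))"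
      unfolding piece_def prod.case if_True if_False ind by simp
    moreover have "piece (i - 1, True) x = F (pt i) / of_real (measure gauss (J i))"
      unfolding piece_def prod.case if_True if_False ind by simp
    \<comment> \<open>Summation by parts in pointwise form: the integral over an interval is the
      increment of the primitive.\<close>
    moreover have "avg i = F (pt i) / of_real (measure gauss (J i)) - F (pt (i + 1)) / of_real (measure gauss (J i))"
    proof -
      have eq: "(LINT u:J i|gauss. f u) = F (pt i) - F (pt (i + 1))"
        using F_diff[of "pt i" "pt (i + 1)"] pt_order(1)[of i] by simp
      show ?thesis
        unfolding avg_def eq by (simp add: right_diff_distrib scaleR_conv_of_real divide_inverse mult.commute)
    qed
    ultimately show "f x = (\<Sum>p\<in>{(i, False), (i, True), (i - 1, True)}. piece p x)"
      by simp
  qed auto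
qed

lemma sum_nn_integral_J_le:
  assumes "finite B"
  shows "(\<Sum>j\<in>B. \<integral>\<^sup>+x. M_loc f x * indicator (J j) x \<partial>gauss) \<le> Rtot"
proof -
  have ind: "AE x in gauss. (\<Sum>j\<in>B. M_loc f x * indicator (J j) x) \<le> h x"
    using AE_not_pt
  proof eventually_elim
    case (elim x)
    show ?case
    proof (cases "\<exists>j\<in>B. x \<in> J j")
      case True
      then obtain j where j: "j \<in> B" "x \<in> J j" by auto
      have "indicator (J k) x = (if k = j then 1 else 0 :: ennreal)" for k
    proof (cases "k = j")
      case True
      then show ?thesis using j(2) by simp
    next
      case False
      then have "x \<notin> J k" using J_unique[OF elim _ j(2)] by blast
      then show ?thesis using False by simp
    qed
      then have "(\<Sum>k\<in>B. M_loc f x * indicator (J k) x) = (\<Sum>k\<in>B. if k = j then M_loc f x else 0)"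
        by (intro sum.cong) auto
      also have "\<dots> = M_loc f x" using assms j(1) by (simp add: sum.delta)
      finally show ?thesis by (simp add: h_def)
    next
      case False
      then have "(\<Sum>j\<in>B. M_loc f x * indicator (J j) x) = 0" by (intro sum.neutral) auto
      then show ?thesis by simp
    qed
  qed
  have "(\<Sum>j\<in>B. \<integral>\<^sup>+x. M_loc f x * indicator (J j) x \<partial>gauss) = (\<integral>\<^sup>+x. (\<Sum>j\<in>B. M_loc f x * indicator (J j) x) \<partial>gauss)"
    by (rule nn_integral_sum[symmetric]) measurable
  also have "\<dots> \<le> (\<integral>\<^sup>+x. h x \<partial>gauss)" by (rule nn_integral_mono_AE[OF ind])
  also have "\<dots> \<le> Rtot" unfolding Rtot_def by simp
  finally show ?thesis .
qed

text \<open>A finite set of pairs is enlarged to all flags over its cells. Each of the sums of R j,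
  of R (j + 1) and of the integrals of \<open>M_loc\<close> is then at most
  \<open>Rtot\<close>.\<close>

lemma sum_cost_le:
  assumes B: "finite B"
  shows "sum cost B \<le> ennreal (KA * (4 * cmp + 1) + 4 * cmp) * Rtot"
proof -
  let ?B = "fst ` B"
  have fin: "finite ?B" using B by simp
  have R1: "(\<Sum>j\<in>?B. R (j + 1)) \<le> Rtot"
  proof -
    have "(\<Sum>j\<in>?B. R (j + 1)) = (\<Sum>j\<in>(\<lambda>j. j + 1) ` ?B. R j)" by (subst sum.reindex) auto
    also have "\<dots> \<le> Rtot" using fin by (intro sum_R_le) auto
    finally show ?thesis .
  qed
  have "sum cost B \<le> sum cost (?B \<times> UNIV)"
  proof (rule sum_mono2)
    show "B \<subseteq> ?B \<times> UNIV" by force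
  qed (use fin in auto)
  also have "\<dots> = (\<Sum>j\<in>?B. cost (j, False) + cost (j, True))"
    by (simp add: sum.cartesian_product' UNIV_bool)
  also have "\<dots> = ennreal KA * (ennreal (2 * cmp) * ((\<Sum>j\<in>?B. R j) + (\<Sum>j\<in>?B. R (j + 1)))
      + (\<Sum>j\<in>?B. \<integral>\<^sup>+x. M_loc f x * indicator (J j) x \<partial>gauss)) + ennreal (4 * cmp) * (\<Sum>j\<in>?B. R (j + 1))"
    unfolding cost_def prod.case if_True if_False
    by (simp only: sum.distrib sum_distrib_left[symmetric])
  also have "\<dots> \<le> ennreal KA * (ennreal (2 * cmp) * (Rtot + Rtot) + Rtot) + ennreal (4 * cmp) * Rtot"
    by (intro add_mono mult_left_mono R1 sum_R_le sum_nn_integral_J_le fin) auto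
  also have "\<dots> = ennreal (KA * (4 * cmp + 1) + 4 * cmp) * Rtot"
  proof -
    have "ennreal k * (ennreal (2 * c) * (r + r) + r) + ennreal (4 * c) * r = ennreal (k * (4 * c + 1) + 4 * c) * r"
      if "0 \<le> k" "0 \<le> c" for k c and r :: ennreal
    proof -
      have "ennreal (2 * c) * (r + r) = ennreal (4 * c) * r"
        using that by (simp add: ennreal_mult mult_2[symmetric] ac_simps)
      then have "ennreal (2 * c) * (r + r) + r = ennreal (4 * c + 1) * r"
        using that by (subst ennreal_plus) (auto simp: distrib_right)
      then show ?thesis
        using that by (subst ennreal_plus) (auto simp: distrib_right ennreal_mult mult.assoc)
    qed
    from this[of KA cmp Rtot] show ?thesis by simp
  qed
  finally show ?thesis .
qed

lemma gauss_H1_le_Rtot: "gauss_H1_le f (ennreal (KA * (4 * cmp + 1) + 4 * cmp) * Rtot)"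
proof (rule gauss_H1_le_has_sum[where A = UNIV and f = piece and c = cost])
  show "gauss_H1_le (piece p) (cost p)" for p
    using gauss_H1_le_cell gauss_H1_le_transfer by (cases p) (metis (full_types))
  show "ennreal (KA * (4 * cmp + 1) + 4 * cmp) * Rtot < \<infinity>"
    using Rtot_finite by (simp add: ennreal_mult_less_top)
  show "sum cost B \<le> ennreal (KA * (4 * cmp + 1) + 4 * cmp) * Rtot" if "finite B" for B
    using that by (rule sum_cost_le)
  show "AE x in gauss. ((\<lambda>p. piece p x) has_sum f x) UNIV" by (rule AE_pieces_has_sum)
qed simp_all

end

section \<open>The characterization\<close>

lemma E_functional_diff_le:
  assumes f: "integrable gauss f" and g: "integrable gauss g"
  shows "E_functional (\<lambda>x. f x - g x) \<le> E_functional f + E_functional g"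
proof -
  note [measurable] = borel_measurable_integrable_gauss[OF f] borel_measurable_integrable_gauss[OF g]
  have diff: "norm (LINT y:A|gauss. f y - g y) \<le> norm (LINT y:A|gauss. f y) + norm (LINT y:A|gauss. g y)"
    if "A \<in> sets borel" for A
  proof -
    have "set_integrable gauss A f" "set_integrable gauss A g"
      using that f g by (simp_all add: set_integrable_def integrable_indicator_mult)
    then show ?thesis by (simp add: norm_triangle_ineq4)
  qed
  have "ennreal (x * tails (\<lambda>x. f x - g x) x) * indicator {0..} x
      \<le> ennreal (x * tails f x) * indicator {0..} x + ennreal (x * tails g x) * indicator {0..} x" for x
  proof (cases "0 \<le> x")
    case True
    have "tails (\<lambda>x. f x - g x) x \<le> tails f x + tails g x"
      using diff[of "{x..}"] diff[of "{..-x}"] by simp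
    then have "x * tails (\<lambda>x. f x - g x) x \<le> x * (tails f x + tails g x)"
      using True by (rule mult_left_mono)
    also have "\<dots> = x * tails f x + x * tails g x" by (rule distrib_left)
    finally have "ennreal (x * tails (\<lambda>x. f x - g x) x) \<le> ennreal (x * tails f x + x * tails g x)"
      by (rule ennreal_leI)
    also have "\<dots> = ennreal (x * tails f x) + ennreal (x * tails g x)"
      using True by (intro ennreal_plus) auto
    finally show ?thesis using True by simp
  qed simp
  then have "E_functional (\<lambda>x. f x - g x)
    \<le> (\<integral>\<^sup>+x. ennreal (x * tails f x) * indicator {0..} x + ennreal (x * tails g x) * indicator {0..} x \<partial>lborel)"
    unfolding E_functional_eq by (rule nn_integral_mono)
  also have "\<dots> = E_functional f + E_functional g"
    unfolding E_functional_eq by (rule nn_integral_add) measurable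
  finally show ?thesis .
qed

text \<open>A constant is a multiple of the constant atom, so the bound for atomic decompositions
  applies to it.\<close>

lemma M_loc_E_functional_const_le:
  "gauss_L1_norm (M_loc (\<lambda>x. m)) + E_functional (\<lambda>x. m) \<le> ennreal maximal_const * ennreal (norm m)"
proof -
  obtain l a where la: "atomic_decomposition (\<lambda>x. m) l a" "ennreal (\<Sum>j. norm (l j)) \<le> ennreal (norm m)"
    using gauss_H1_le_const[of m] by (auto simp: gauss_H1_le_def)
  have "gauss_L1_norm (M_loc (\<lambda>x. m)) + E_functional (\<lambda>x. m) \<le> ennreal maximal_const * ennreal (\<Sum>j. norm (l j))"
    by (rule M_loc_E_functional_le[OF _ la(1)]) simp
  also have "\<dots> \<le> ennreal maximal_const * ennreal (norm m)"
    using la(2) by (rule mult_left_mono) simp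
  finally show ?thesis .
qed

definition mean_zero_const :: real where
  "mean_zero_const = (6 * (86 * exp 9) * (4 * cmp + 1) + 4 * cmp) * (2000000 * exp 9)"

text \<open>The mean m of f is at most 264 * \<open>exp 3\<close> times the norm of
  \<open>M_loc f\<close>. Subtracting it raises the other two functionals by
  \<open>maximal_const\<close> * |m|, and adding it back as a multiple of the constant atom costs
  another |m|.\<close>

definition atomic_const :: real where
  "atomic_const = mean_zero_const + (mean_zero_const * maximal_const + 1) * (264 * exp 3)"

lemma mean_zero_const_pos: "0 < mean_zero_const"
  unfolding mean_zero_const_def by (intro mult_pos_pos add_pos_pos) auto

lemma atomic_const_pos: "0 < atomic_const"
  unfolding atomic_const_def using mean_zero_const_pos maximal_const_pos
  by (intro add_pos_pos mult_pos_pos) auto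

lemma (in mean_zero_function) gauss_H1_le_norms:
  "gauss_H1_le f (ennreal mean_zero_const * (gauss_L1_norm (M_loc f) + E_functional f + ennreal \<delta>))"
proof (rule gauss_H1_le_mono[OF gauss_H1_le_Rtot])
  let ?c = "KA * (4 * cmp + 1) + 4 * cmp" and ?N = "gauss_L1_norm (M_loc f) + E_functional f + ennreal \<delta>"
  have "ennreal ?c * Rtot \<le> ennreal ?c * (ennreal (2000000 * exp 9) * ?N)"
    by (intro mult_left_mono Rtot_le) auto
  also have "\<dots> = ennreal (?c * (2000000 * exp 9)) * ?N"
  proof -
    have gen: "ennreal p * (ennreal q * r) = ennreal (p * q) * r" if "0 \<le> p" "0 \<le> q" for p q and r :: ennreal
      using that by (simp add: ennreal_mult mult.assoc)
    show ?thesis by (rule gen) auto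
  qed
  finally show "ennreal ?c * Rtot \<le> ennreal mean_zero_const * ?N"
    by (simp only: mean_zero_const_def)
qed

text \<open>Subtracting the mean reduces to the case of mean zero; the constant function is itself an atom.\<close>

lemma gauss_H1_le_M_loc_E_functional:
  assumes f: "integrable gauss f" and M: "gauss_L1_norm (M_loc f) < \<infinity>" and E: "E_functional f < \<infinity>"
    and \<delta>: "0 < \<delta>"
  shows "gauss_H1_le f (ennreal atomic_const * (gauss_L1_norm (M_loc f) + E_functional f + ennreal \<delta>))"
proof -
  define m where "m = (LINT x|gauss. f x)"
  define g where "g = (\<lambda>x. f x - m)"
  let ?N = "gauss_L1_norm (M_loc f) + E_functional f + ennreal \<delta>"
  let ?A = "ennreal mean_zero_const" and ?B = "ennreal maximal_const"
  have c: "integrable gauss (\<lambda>x. m)" by simp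
  have [measurable]: "M_loc f \<in> borel_measurable borel" "M_loc (\<lambda>x. m) \<in> borel_measurable borel"
    by (intro borel_measurable_M_loc f c)+
  have Mg: "gauss_L1_norm (M_loc g) \<le> gauss_L1_norm (M_loc f) + gauss_L1_norm (M_loc (\<lambda>x. m))"
  proof -
    have "gauss_L1_norm (M_loc g) \<le> (\<integral>\<^sup>+x. M_loc f x + M_loc (\<lambda>x. m) x \<partial>gauss)"
      unfolding gauss_L1_norm_def g_def by (intro nn_integral_mono M_loc_diff_le f c)
    also have "\<dots> = gauss_L1_norm (M_loc f) + gauss_L1_norm (M_loc (\<lambda>x. m))"
      unfolding gauss_L1_norm_def by (rule nn_integral_add) auto
    finally show ?thesis .
  qed
  have Eg: "E_functional g \<le> E_functional f + E_functional (\<lambda>x. m)"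
    unfolding g_def by (rule E_functional_diff_le[OF f c])
  have "gauss_L1_norm (M_loc g) + E_functional g
     \<le> (gauss_L1_norm (M_loc f) + gauss_L1_norm (M_loc (\<lambda>x. m))) + (E_functional f + E_functional (\<lambda>x. m))"
    by (intro add_mono Mg Eg)
  also have "\<dots> = gauss_L1_norm (M_loc f) + E_functional f + (gauss_L1_norm (M_loc (\<lambda>x. m)) + E_functional (\<lambda>x. m))"
    by (simp only: add_ac)
  also have "\<dots> \<le> gauss_L1_norm (M_loc f) + E_functional f + ?B * ennreal (norm m)"
    by (intro add_left_mono M_loc_E_functional_const_le)
  finally have g_le: "gauss_L1_norm (M_loc g) + E_functional g \<le> gauss_L1_norm (M_loc f) + E_functional f + ?B * ennreal (norm m)" .
  have g_fin: "gauss_L1_norm (M_loc g) + E_functional g < \<infinity>"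
    using M E by (intro order_le_less_trans[OF g_le]) (simp add: ennreal_mult_less_top)
  have "mean_zero_function g \<delta>"
  proof
    show "integrable gauss g" unfolding g_def using f by simp
    have "measure gauss UNIV = 1" using gauss.prob_space by simp
    then show "(LINT x|gauss. g x) = 0" unfolding g_def m_def using f by simp
    show "gauss_L1_norm (M_loc g) < \<infinity>" "E_functional g < \<infinity>"
      using g_fin by auto
    show "0 < \<delta>" by (rule \<delta>)
  qed
  then have "gauss_H1_le g (?A * (gauss_L1_norm (M_loc g) + E_functional g + ennreal \<delta>))"
    by (rule mean_zero_function.gauss_H1_le_norms)
  then have Hg: "gauss_H1_le g (?A * (?N + ?B * ennreal (norm m)))"
  proof (rule gauss_H1_le_mono)
    have "gauss_L1_norm (M_loc g) + E_functional g + ennreal \<delta>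
       \<le> gauss_L1_norm (M_loc f) + E_functional f + ?B * ennreal (norm m) + ennreal \<delta>"
      by (intro add_right_mono g_le)
    also have "\<dots> = ?N + ?B * ennreal (norm m)" by (simp only: add_ac)
    finally show "?A * (gauss_L1_norm (M_loc g) + E_functional g + ennreal \<delta>) \<le> ?A * (?N + ?B * ennreal (norm m))"
      by (rule mult_left_mono) simp
  qed
  have N_fin: "?N < \<infinity>" using M E by simp
  have "gauss_H1_le (\<lambda>x. g x + m) (?A * (?N + ?B * ennreal (norm m)) + ennreal (norm m))"
    using N_fin by (intro gauss_H1_le_add[OF Hg gauss_H1_le_const]) (simp add: ennreal_mult_less_top)
  then have Hf: "gauss_H1_le f (?A * (?N + ?B * ennreal (norm m)) + ennreal (norm m))"
    by (simp add: g_def)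
  \<comment> \<open>The mean is bounded by the L1 norm of f, which \<open>M_loc f\<close> dominates
    almost everywhere; no tail information enters.\<close>
  have m_le: "ennreal (norm m) \<le> ennreal (264 * exp 3) * ?N"
  proof -
    have "norm m \<le> (LINT x|gauss. norm (f x))" unfolding m_def by (rule integral_norm_bound)
    then have "ennreal (norm m) \<le> ennreal (LINT x|gauss. norm (f x))" by (rule ennreal_leI)
    also have "\<dots> \<le> ennreal (264 * exp 3) * gauss_L1_norm (M_loc f)" by (rule L1_norm_le_M_loc[OF f])
    also have "\<dots> \<le> ennreal (264 * exp 3) * ?N"
      by (intro mult_left_mono) (auto simp: add.assoc)
    finally show ?thesis .
  qed
  show ?thesis
  proof (rule gauss_H1_le_mono[OF Hf])
    have "?A * (?N + ?B * ennreal (norm m)) + ennreal (norm m)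
      \<le> ?A * (?N + ?B * (ennreal (264 * exp 3) * ?N)) + ennreal (264 * exp 3) * ?N"
      by (intro add_mono mult_left_mono m_le order_refl) auto
    also have "\<dots> = ennreal atomic_const * ?N"
    proof -
      have gen: "ennreal p * (r + ennreal q * (ennreal s * r)) + ennreal s * r = ennreal (p + (p * q + 1) * s) * r"
        if "0 \<le> p" "0 \<le> q" "0 \<le> s" for p q s and r :: ennreal
        using that by (simp add: ennreal_mult ennreal_plus distrib_left distrib_right mult.assoc add.assoc)
      show ?thesis
        unfolding atomic_const_def
        using mean_zero_const_pos maximal_const_pos by (intro gen) auto
    qed
    finally show "?A * (?N + ?B * ennreal (norm m)) + ennreal (norm m) \<le> ennreal atomic_const * ?N" .
  qed
qed

lemma M_loc_E_functional_le_gauss_H1_norm: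
  assumes f: "integrable gauss f"
  shows "ennreal (1 / maximal_const) * (gauss_L1_norm (M_loc f) + E_functional f) \<le> gauss_H1_norm f"
  unfolding gauss_H1_norm_def
proof (rule Inf_greatest)
  fix s assume "s \<in> {ennreal (\<Sum>j. norm (l j)) | l a. atomic_decomposition f l a}"
  then obtain l a where s: "s = ennreal (\<Sum>j. norm (l j))" and ad: "atomic_decomposition f l a" by auto
  have "ennreal (1 / maximal_const) * (gauss_L1_norm (M_loc f) + E_functional f)
     \<le> ennreal (1 / maximal_const) * (ennreal maximal_const * s)"
    unfolding s by (intro mult_left_mono M_loc_E_functional_le[OF f ad]) simp
  also have "\<dots> = ennreal (1 / maximal_const * maximal_const) * s"
    using maximal_const_pos by (subst ennreal_mult) (auto simp: mult.assoc)
  also have "\<dots> = s" using maximal_const_pos by simp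
  finally show "ennreal (1 / maximal_const) * (gauss_L1_norm (M_loc f) + E_functional f) \<le> s" .
qed

text \<open>The additive term is removed by letting \<delta> = e / \<open>atomic_const\<close> tend
  to 0, which is harmless since the norm is an infimum. If the right side is infinite the bound is
  trivial.\<close>

lemma gauss_H1_norm_le_M_loc_E_functional:
  assumes f: "integrable gauss f"
  shows "gauss_H1_norm f \<le> ennreal atomic_const * (gauss_L1_norm (M_loc f) + E_functional f)"
proof (cases "gauss_L1_norm (M_loc f) < \<infinity> \<and> E_functional f < \<infinity>")
  case True
  show ?thesis
  proof (rule ennreal_le_epsilon)
    fix e :: real assume e: "0 < e"
    have d: "0 < e / atomic_const" using e atomic_const_pos by simp
    have "gauss_H1_norm f \<le> ennreal atomic_const * (gauss_L1_norm (M_loc f) + E_functional f + ennreal (e / atomic_const))"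
      using True by (intro gauss_H1_leD(3)[OF gauss_H1_le_M_loc_E_functional[OF f _ _ d]]) auto
    also have "\<dots> = ennreal atomic_const * (gauss_L1_norm (M_loc f) + E_functional f) + ennreal (atomic_const * (e / atomic_const))"
      using e atomic_const_pos by (subst ennreal_mult) (auto simp: distrib_left)
    also have "atomic_const * (e / atomic_const) = e" using atomic_const_pos by simp
    finally show "gauss_H1_norm f \<le> ennreal atomic_const * (gauss_L1_norm (M_loc f) + E_functional f) + ennreal e" .
  qed
next
  case False
  then have eq: "gauss_L1_norm (M_loc f) + E_functional f = top" by (auto simp: not_less top_unique)
  have "ennreal atomic_const * (gauss_L1_norm (M_loc f) + E_functional f) = top"
    unfolding eq using atomic_const_pos by (simp add: ennreal_mult_top)
  then show ?thesis by simp
qed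

theorem theorem3p3:
  shows "(\<forall>f :: real \<Rightarrow> complex. integrable gauss f \<longrightarrow>
            (f \<in> gauss_H1 \<longleftrightarrow> in_gauss_L1 (M_loc f) \<and> E_functional f < \<infinity>)) \<and>
         (\<exists>c C :: real. 0 < c \<and> 0 < C \<and>
            (\<forall>f \<in> gauss_H1.
               ennreal c * (gauss_L1_norm (M_loc f) + E_functional f) \<le> gauss_H1_norm f \<and>
               gauss_H1_norm f \<le> ennreal C * (gauss_L1_norm (M_loc f) + E_functional f)))"
proof (rule conjI)
  show "\<forall>f :: real \<Rightarrow> complex. integrable gauss f \<longrightarrow>
            (f \<in> gauss_H1 \<longleftrightarrow> in_gauss_L1 (M_loc f) \<and> E_functional f < \<infinity>)"
  proof (intro allI impI iffI)
    fix f :: "real \<Rightarrow> complex"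
    assume f: "integrable gauss f" and "f \<in> gauss_H1"
    then obtain l a where ad: "atomic_decomposition f l a" by (auto simp: gauss_H1_def)
    have "gauss_L1_norm (M_loc f) + E_functional f < \<infinity>"
      using M_loc_E_functional_le[OF f ad] by (rule order_le_less_trans) (simp add: ennreal_mult_less_top)
    then show "in_gauss_L1 (M_loc f) \<and> E_functional f < \<infinity>"
      using borel_measurable_M_loc[OF f] by (auto simp: in_gauss_L1_def)
  next
    fix f :: "real \<Rightarrow> complex"
    assume f: "integrable gauss f" and "in_gauss_L1 (M_loc f) \<and> E_functional f < \<infinity>"
    \<comment> \<open>For membership any positive \<delta> serves, here 1.\<close>
    then show "f \<in> gauss_H1"
      using gauss_H1_leD(2)[OF gauss_H1_le_M_loc_E_functional[OF f, of 1]] by (auto simp: in_gauss_L1_def)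
  qed
  have int: "integrable gauss f" if "f \<in> gauss_H1" for f using that by (simp add: gauss_H1_def)
  show "\<exists>c C :: real. 0 < c \<and> 0 < C \<and>
            (\<forall>f \<in> gauss_H1.
               ennreal c * (gauss_L1_norm (M_loc f) + E_functional f) \<le> gauss_H1_norm f \<and>
               gauss_H1_norm f \<le> ennreal C * (gauss_L1_norm (M_loc f) + E_functional f))"
    using maximal_const_pos atomic_const_pos
    by (intro exI[of _ "1 / maximal_const"] exI[of _ atomic_const] conjI ballI
        M_loc_E_functional_le_gauss_H1_norm gauss_H1_norm_le_M_loc_E_functional int) auto
qed

end
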